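(* In the setting and with the notation of the context, let $q=(q_x^\top,q_y^\top)^\top=\mathbf 0$ and $L_0=\mathbf 0$. Let $\mu>-1/\tilde n$, and let the pair $(A,C)$ be observable. Let $\rho>0$, $P_a\in\mathbb R^{n\times n}$ and $Y\in\mathbb R^{n\times p}$ solve the system of linear matrix inequalities $$P_a\succ 0,\quad (\Delta^\top+\Delta)\otimes P_a\succ 0,\quad P_aG_{\mathbf d}+G_{\mathbf d}^\top P_a\succ 0,$$ $$P_aA+A^\top P_a+YC+C^\top Y^\top+\rho\,(P_aG_{\mathbf d}+G_{\mathbf d}^\top P_a)\prec 0 .$$ Put $\bar H=P_a^{-1}Y=(\bar H_1,\dots,\bar H_N)$ with $\bar H_i\in\mathbb R^{n\times p_i}$, let $H_i=\bar H_i/\zeta_i$, $i=1,\dots,N$, and let $\nu>0$ be large enough. Let the canonical homogeneous norm $\|\cdot\|_{\mathbf d}$ be induced by the weighted Euclidean norm $\|x\|_{P_a}=\sqrt{x^\top P_a x}$. Let the nonlinear distributed observer $$\dot{\hat x}_i=A\hat x_i+Bu+\gamma(t,\hat x_i)+g(|\omega_i|)H_i\omega_i+\nu\|\theta_i\|_{\mathbf d}^{\mu}\theta_i,\qquad i=1,\dots,N,$$ operate under a strongly connected graph $\mathcal G$. Then its error equation $$\dot e=\big(\tilde A+\mathrm{diag}\{g(|\omega_i|)\}_{i=1}^N\tilde H\tilde C-\nu\,\mathrm{diag}\{\|\theta_i\|_{\mathbf d}^{\mu}I_n\}_{i=1}^N(\mathcal L\otimes I_n)\big)e+\Gamma(t,\hat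 x,x)$$ is globally uniformly finite-time stable if $\mu<0$ (respectively, globally uniformly nearly fixed-time stable if $\mu>0$), provided that $\mu$ is close enough to zero and $\gamma$ satisfies $$\big\|\tilde{\mathbf d}(-\ln\|\hat x-\tilde x\|_{\tilde{\mathbf d}})\,(\hat\gamma(t,\hat x)-\tilde\gamma(t,x))\big\|_P\le \tau\,\|\hat x-\tilde x\|_{\tilde{\mathbf d}}^{\mu}\qquad \forall t>0,\ \forall \hat x_i,x\in\mathbb R^n\ (\hat x\ne\tilde x),$$ with $0<\tau<\rho/3$. In the finite-time case the settling-time function satisfies $$T(e(0))\le \frac{3}{\mu(3\tau-\rho)}\,\|e(0)\|_{\tilde{\mathbf d}}^{-\mu}.$$
   Context: **Plant and sensors.** $\dot x=Ax+Bu+\gamma(t,x)+q_x$, $t>0$, with $x\in\mathbb R^n$, $u\in\mathbb R^m$, $A\in\mathbb R^{n\times n}$, $B\in\mathbb R^{n\times m}$, $\gamma\in C(\mathbb R\times\mathbb R^n,\mathbb R^n)$, $q_x\in L^\infty(\mathbb R,\mathbb R^n)$. Local outputs: $y_i=C_ix+q_{y,i}$, $i=1,\dots,N$, with $C_i\in\mathbb R^{p_i\times n}$, $q_{y,i}\in L^\infty(\mathbb R,\mathbb R^{p_i})$. Let $C=(C_1^\top,\dots,C_N^\top)^\top\in\mathbb R^{p\times n}$, $p=\sum_i p_i$, $q_y=(q_{y,1}^\top,\dots,q_{y,N}^\top)^\top$. $|\cdot|$ is the Euclidean norm; $M\succ0$ ($\prec0$) means symmetric positive (negative) definite; $\otimes$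 is the Kronecker product; $\mathbf 1_N\in\mathbb R^N$ is the all-ones vector. **Graph.** $\mathcal G$ is a directed graph on nodes $\{1,\dots,N\}$ without self-loops; $(i,j)$ is an edge if $j$ can send information to $i$; $a_{ij}=1$ if $(i,j)$ is an edge and $0$ otherwise. $\mathcal L=\{l_{ij}\}$ with $l_{ij}=-a_{ij}$ for $i\ne j$, $l_{ii}=\sum_k a_{ik}$ is the Laplacian, $\mathcal L_i$ its $i$-th row. When $\mathcal G$ is strongly connected, $\zeta=(\zeta_1,\dots,\zeta_N)^\top$ is the left $0$-eigenvector of $\mathcal L$ with $\zeta^\top\mathbf 1_N=1$ (all $\zeta_i>0$), and $\Delta$ is an $(N-1)\times(N-1)$ matrix, whose eigenvalues are the nonzero eigenvalues of $\mathcal L$, such that $T^{-1}\mathcal LT=\begin{pmatrix}0&0\\0&\Delta\end{pmatrix}$ with $T=(\mathbf 1_N,Y_1)$, $T^{-1}=(\zeta,Y_2)^\top$, $T\in\mathbb R^{N\times N}$. **The matrices $G_0$, $L_0$.** For observable $(A,C)$, $(Y_0,G_0)\in\mathbb R^{n\times p}\times\mathbb R^{n\times n}$ is a solution of $G_0A-AG_0+Y_0C=-A$, $CG_0=\mathbf 0$, such that $I_n+G_0$ is invertible and $A_0=A+L_0C$ is nilpotent, where $L_0=(I_n+G_0)^{-1}Y_0$. Let $\tilde n$ be the least $k$ such that the matrix with blocks $C,CA,\dots,CA^{k-1}$ has full rank $n$. **Dilations and homogeneous norms.** $G_{\mathbf d}=\mu G_0+I_n$, $\mathbf d(s)=\exp(sG_{\mathbf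 d})$, $s\in\mathbb R$. For a linear dilation $\mathbf d(s)=\exp(sG)$ (with all eigenvalues of $G$ having positive real part) that is monotone for a norm $\|\cdot\|$ (i.e. $s\mapsto\|\mathbf d(s)x\|$ is strictly increasing for every $x\ne\mathbf 0$), the canonical homogeneous norm induced by $\|\cdot\|$ is $\|\mathbf 0\|_{\mathbf d}=0$ and $\|x\|_{\mathbf d}=e^{s_x}$ where $\|\mathbf d(-s_x)x\|=1$, for $x\neq\mathbf 0$. Further, $P=I_N\otimes P_a$, $\|e\|_P=\sqrt{e^\top Pe}$, $\tilde{\mathbf d}=I_N\otimes\mathbf d$ (generated by $G_{\tilde{\mathbf d}}=I_N\otimes G_{\mathbf d}$), and $\|\cdot\|_{\tilde{\mathbf d}}$ is the canonical homogeneous norm on $\mathbb R^{Nn}$ induced by $\|\cdot\|_P$. **Observer notation.** $\hat x_i\in\mathbb R^n$ is the state of observer $i$; $e_i=\hat x_i-x$, $e=(e_1^\top,\dots,e_N^\top)^\top$, $\hat x=(\hat x_1^\top,\dots,\hat x_N^\top)^\top$, $\tilde x=\mathbf 1_N\otimes x$. $\omega_i=C_i\hat x_i-y_i=C_ie_i-q_{y,i}$; $\theta_i=\sum_j a_{ij}(\hat x_j-\hat x_i)=-(\mathcal L_i\otimes I_n)e$; $g(|\omega_i|)=\exp(\mu(G_0+I_n)\ln|\omega_i|)$. The terms $g(|\omega_i|)H_i\omega_i$ and $\|\theta_i\|_{\mathbf d}^\mu\theta_i$ are set to $\mathbf 0$ (by continuity) at $\omega_i=\mathbf 0$, $\theta_i=\mathbf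 0$. $\tilde A=I_N\otimes A$, $\tilde H=\mathrm{diag}\{H_i\}_{i=1}^N$, $\tilde C=\mathrm{diag}\{C_i\}_{i=1}^N$. $\hat\gamma(t,\hat x)=(\gamma^\top(t,\hat x_1),\dots,\gamma^\top(t,\hat x_N))^\top$, $\tilde\gamma(t,x)=\mathbf 1_N\otimes\gamma(t,x)$, $\Gamma(t,\hat x,x)=\hat\gamma(t,\hat x)-\tilde\gamma(t,x)$. **Stability notions** (for a system with state $e$ and initial state $e(0)$). Globally uniformly finite-time stable: Lyapunov stable and there is a locally bounded settling-time function $T$ such that $\|e(t)\|=0$ for all $t\ge T(e(0))$. Globally uniformly nearly fixed-time stable: Lyapunov stable and for every $r>0$ there is $T_r>0$, independent of $e(0)$, with $\|e(t)\|<r$ for all $t\ge T_r$. *)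

theory Defs
  imports "HOL-Analysis.Analysis"
begin

section \<open>Matrices\<close>

definition mpow :: "real^'n^'n \<Rightarrow> nat \<Rightarrow> real^'n^'n" where
  "mpow M k = (((**) M) ^^ k) (mat 1)"

definition mexp :: "real^'n^'n \<Rightarrow> real^'n^'n" where
  "mexp M = (\<Sum>k. mpow M k /\<^sub>R fact k)"

definition nilpotent_mat :: "real^'n^'n \<Rightarrow> bool" where
  "nilpotent_mat M \<longleftrightarrow> (\<exists>k. mpow M k = 0)"

text \<open>Positive definiteness of the principal submatrix of \<open>M\<close> with index set \<open>I\<close>
  (vectors on \<open>I\<close> are vectors that vanish off \<open>I\<close>). The index set may be empty. This is how
  an \<open>(N - 1) \<times> (N - 1)\<close> block is handled as part of an \<open>N \<times> N\<close> matrix, also for \<open>N = 1\<close>.\<close>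

definition pos_def_on :: "'i::finite set \<Rightarrow> real^'i^'i \<Rightarrow> bool" where
  "pos_def_on I M \<longleftrightarrow>
     (\<forall>i\<in>I. \<forall>j\<in>I. M $ i $ j = M $ j $ i) \<and>
     (\<forall>x. x \<noteq> 0 \<and> (\<forall>i. i \<notin> I \<longrightarrow> x $ i = 0) \<longrightarrow> x \<bullet> (M *v x) > 0)"

abbreviation pos_def :: "real^'i^'i \<Rightarrow> bool" where
  "pos_def M \<equiv> pos_def_on UNIV M"

abbreviation neg_def :: "real^'i^'i \<Rightarrow> bool" where
  "neg_def M \<equiv> pos_def (- M)"

definition kron :: "real^'b^'a \<Rightarrow> real^'d^'c \<Rightarrow> real^('b \<times> 'd)^('a \<times> 'c)" where
  "kron M K = (\<chi> a b. M $ fst a $ fst b * K $ snd a $ snd b)"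

text \<open>The space \<open>\<real>\<^sup>N\<^sup>n\<close> is \<open>real^('v \<times> 'n)\<close>, where \<open>'v\<close> indexes the nodes;
  \<open>stack (\<lambda>_. x)\<close> is the Kronecker product of the all-ones vector with \<open>x\<close>.\<close>

definition blk :: "real^('v \<times> 'n) \<Rightarrow> 'v::finite \<Rightarrow> real^'n" where
  "blk e i = (\<chi> k. e $ (i, k))"

definition stack :: "('v::finite \<Rightarrow> real^'n) \<Rightarrow> real^('v \<times> 'n)" where
  "stack f = (\<chi> a. f (fst a) $ snd a)"

definition block_diag :: "('v::finite \<Rightarrow> real^'n^'n) \<Rightarrow> real^('v \<times> 'n)^('v \<times> 'n)" where
  "block_diag M = (\<chi> a b. if fst a = fst b then M (fst a) $ snd a $ snd b else 0)"


section \<open>Distributed outputs\<close>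

text \<open>The output space \<open>\<real>\<^sup>p\<close> is \<open>real^'p\<close>, and \<open>own r\<close> is the node that measures the scalar
  output \<open>r\<close>. Hence the local output matrix \<open>C\<^sub>i\<close> consists of the rows \<open>r\<close> of \<open>C\<close> with
  \<open>own r = i\<close>, the local gain \<open>H\<^sub>i\<close> of the columns \<open>r\<close> of \<open>H\<close> with \<open>own r = i\<close>, and
  \<open>p\<^sub>i = card {r. own r = i}\<close>. A vector of \<open>\<real>\<^sup>p\<^sup>i\<close> is a vector of \<open>\<real>\<^sup>p\<close> that is zero in all
  coordinates not owned by \<open>i\<close>.\<close>

definition local_out :: "('p::finite \<Rightarrow> 'v) \<Rightarrow> 'v \<Rightarrow> real^'p \<Rightarrow> real^'p" where
  "local_out own i w = (\<chi> r. if own r = i then w $ r else 0)"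

definition out_diag :: "('p::finite \<Rightarrow> 'v::finite) \<Rightarrow> real^'n^'p \<Rightarrow> real^('v \<times> 'n)^'p" where
  "out_diag own C = (\<chi> r a. if own r = fst a then C $ r $ snd a else 0)"

definition gain_diag :: "('p::finite \<Rightarrow> 'v::finite) \<Rightarrow> real^'p^'n \<Rightarrow> real^'p^('v \<times> 'n)" where
  "gain_diag own H = (\<chi> a r. if own r = fst a then H $ snd a $ r else 0)"

text \<open>Rows of the matrix with blocks \<open>C, C A, \<dots>, C A\<^sup>k\<^sup>-\<^sup>1\<close>; the dimension of their span is
  its rank.\<close>

definition obs_rows :: "real^'n^'n \<Rightarrow> real^'n^'p \<Rightarrow> nat \<Rightarrow> (real^'n) set" where
  "obs_rows A C k = (\<Union>j<k. rows (C ** mpow A j))"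

definition observable :: "real^'n^'n \<Rightarrow> real^'n^'p \<Rightarrow> bool" where
  "observable A (C :: real^'n^'p) \<longleftrightarrow> dim (obs_rows A C CARD('n)) = CARD('n)"

definition obs_index :: "real^'n^'n \<Rightarrow> real^'n^'p \<Rightarrow> nat" where
  "obs_index A (C :: real^'n^'p) = (LEAST k. dim (obs_rows A C k) = CARD('n))"


section \<open>Communication graph\<close>

text \<open>\<open>(i, j) \<in> E\<close> means that \<open>j\<close> can send information to \<open>i\<close>.\<close>

definition adj :: "('v \<times> 'v) set \<Rightarrow> 'v \<Rightarrow> 'v \<Rightarrow> real" where
  "adj E i j = (if (i, j) \<in> E then 1 else 0)"

definition laplacian :: "('v::finite \<times> 'v) set \<Rightarrow> real^'v^'v" where
  "laplacian E = (\<chi> i j. if i = j then (\<Sum>k\<in>UNIV. adj E i k) else - adj E i j)"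

definition strongly_connected :: "('v \<times> 'v) set \<Rightarrow> bool" where
  "strongly_connected E \<longleftrightarrow> (\<forall>i j. (i, j) \<in> E\<^sup>*)"


section \<open>Dilations and homogeneous norms\<close>

definition weighted_norm :: "real^'i^'i \<Rightarrow> real^'i \<Rightarrow> real" where
  "weighted_norm P x = sqrt (x \<bullet> (P *v x))"

definition hom_norm :: "(real^'i \<Rightarrow> real) \<Rightarrow> (real \<Rightarrow> real^'i^'i) \<Rightarrow> real^'i \<Rightarrow> real" where
  "hom_norm nrm d x = (if x = 0 then 0 else exp (THE s. nrm (d (- s) *v x) = 1))"

definition dil_gen :: "real \<Rightarrow> real^'n^'n \<Rightarrow> real^'n^'n" where
  "dil_gen \<mu> G0 = \<mu> *\<^sub>R G0 + mat 1"

definition dil :: "real \<Rightarrow> real^'n^'n \<Rightarrow> real \<Rightarrow> real^'n^'n" where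
  "dil \<mu> G0 s = mexp (s *\<^sub>R dil_gen \<mu> G0)"

definition dil_net :: "real \<Rightarrow> real^'n^'n \<Rightarrow> real \<Rightarrow> real^('v::finite \<times> 'n)^('v \<times> 'n)" where
  "dil_net \<mu> G0 s = kron (mat 1) (dil \<mu> G0 s)"

definition weight_net :: "real^'n^'n \<Rightarrow> real^('v::finite \<times> 'n)^('v \<times> 'n)" where
  "weight_net Pa = kron (mat 1) Pa"

definition node_norm :: "real \<Rightarrow> real^'n^'n \<Rightarrow> real^'n^'n \<Rightarrow> real^'n \<Rightarrow> real" where
  "node_norm \<mu> G0 Pa = hom_norm (weighted_norm Pa) (dil \<mu> G0)"

definition net_norm :: "real \<Rightarrow> real^'n^'n \<Rightarrow> real^'n^'n \<Rightarrow> real^('v::finite \<times> 'n) \<Rightarrow> real" where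
  "net_norm \<mu> G0 Pa = hom_norm (weighted_norm (weight_net Pa)) (dil_net \<mu> G0)"


section \<open>Plant, observer and error equation\<close>

definition plant_rhs ::
  "real^'n^'n \<Rightarrow> real^'m^'n \<Rightarrow> (real \<Rightarrow> real^'n \<Rightarrow> real^'n) \<Rightarrow> (real \<Rightarrow> real^'m) \<Rightarrow>
   real \<Rightarrow> real^'n \<Rightarrow> real^'n" where
  "plant_rhs A B \<gamma> u t x = A *v x + B *v u t + \<gamma> t x"

text \<open>Since \<open>ln 0 = 0\<close> in HOL, \<open>inj_gain \<mu> G0 0\<close> is the identity; it is only ever applied to
  \<open>H\<^sub>i \<omega>\<^sub>i\<close>, so the injection term vanishes at \<open>\<omega>\<^sub>i = 0\<close>, as it must.\<close>

definition inj_gain :: "real \<Rightarrow> real^'n^'n \<Rightarrow> real \<Rightarrow> real^'n^'n" where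
  "inj_gain \<mu> G0 w = mexp ((\<mu> * ln w) *\<^sub>R (G0 + mat 1))"

text \<open>Stacked right-hand side of the observers, driven by the stacked output \<open>y\<close>.\<close>

definition observer_rhs ::
  "real^'n^'n \<Rightarrow> real^'m^'n \<Rightarrow> real^'n^'p \<Rightarrow> ('p::finite \<Rightarrow> 'v::finite) \<Rightarrow> ('v \<times> 'v) set \<Rightarrow>
   real^'n^'n \<Rightarrow> real^'n^'n \<Rightarrow> real^'p^'n \<Rightarrow> real \<Rightarrow> real \<Rightarrow>
   (real \<Rightarrow> real^'n \<Rightarrow> real^'n) \<Rightarrow> (real \<Rightarrow> real^'m) \<Rightarrow> (real \<Rightarrow> real^'p) \<Rightarrow>
   real \<Rightarrow> real^('v \<times> 'n) \<Rightarrow> real^('v \<times> 'n)" where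
  "observer_rhs A B C own E G0 Pa H \<nu> \<mu> \<gamma> u y t xh = stack (\<lambda>i.
     let \<omega>i = local_out own i (C *v blk xh i - y t);
         \<theta>i = (\<Sum>j\<in>UNIV. adj E i j *\<^sub>R (blk xh j - blk xh i))
     in A *v blk xh i + B *v u t + \<gamma> t (blk xh i)
        + inj_gain \<mu> G0 (norm \<omega>i) *v (H *v \<omega>i)
        + (\<nu> * node_norm \<mu> G0 Pa \<theta>i powr \<mu>) *\<^sub>R \<theta>i)"

text \<open>The mismatch \<open>\<Gamma>\<close> as a function of the stacked estimates and the plant state.\<close>

definition mismatch ::
  "(real \<Rightarrow> real^'n \<Rightarrow> real^'n) \<Rightarrow> real \<Rightarrow> real^('v::finite \<times> 'n) \<Rightarrow> real^'n \<Rightarrow> real^('v \<times> 'n)"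
  where
  "mismatch \<gamma> t xh x = stack (\<lambda>i. \<gamma> t (blk xh i)) - stack (\<lambda>_. \<gamma> t x)"

definition error_rhs ::
  "real^'n^'n \<Rightarrow> real^'n^'p \<Rightarrow> ('p::finite \<Rightarrow> 'v::finite) \<Rightarrow> ('v \<times> 'v) set \<Rightarrow>
   real^'n^'n \<Rightarrow> real^'n^'n \<Rightarrow> real^'p^'n \<Rightarrow> real \<Rightarrow> real \<Rightarrow>
   (real \<Rightarrow> real^'n \<Rightarrow> real^'n) \<Rightarrow> (real \<Rightarrow> real^'n) \<Rightarrow>
   real \<Rightarrow> real^('v \<times> 'n) \<Rightarrow> real^('v \<times> 'n)" where
  "error_rhs A C own E G0 Pa H \<nu> \<mu> \<gamma> x t e =
     (let \<omega> = out_diag own C *v e;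
          \<theta> = - (kron (laplacian E) (mat 1) *v e)
      in (kron (mat 1) A
          + block_diag (\<lambda>i. inj_gain \<mu> G0 (norm (local_out own i \<omega>)))
              ** gain_diag own H ** out_diag own C
          - \<nu> *\<^sub>R (block_diag (\<lambda>i. (node_norm \<mu> G0 Pa (blk \<theta> i) powr \<mu>) *\<^sub>R mat 1)
              ** kron (laplacian E) (mat 1))) *v e
         + mismatch \<gamma> t (e + stack (\<lambda>_. x t)) (x t))"

lemma blk_stack [simp]: "blk (stack f) i = f i"
  by (simp add: blk_def stack_def vec_eq_iff)

lemma stack_blk [simp]: "stack (blk e) = e"
  by (simp add: blk_def stack_def vec_eq_iff)

lemma blk_eqI: "(\<And>i. blk e i = blk f i) \<Longrightarrow> e = f"
  by (simp add: blk_def vec_eq_iff)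

lemma blk_add [simp]: "blk (e + f) i = blk e i + blk f i"
  by (simp add: blk_def vec_eq_iff)

lemma blk_diff [simp]: "blk (e - f) i = blk e i - blk f i"
  by (simp add: blk_def vec_eq_iff)

lemma blk_uminus [simp]: "blk (- e) i = - blk e i"
  by (simp add: blk_def vec_eq_iff)

lemma blk_scaleR [simp]: "blk (c *\<^sub>R e) i = c *\<^sub>R blk e i"
  by (simp add: blk_def vec_eq_iff)

lemma blk_block_diag: "blk (block_diag M *v e) i = M i *v blk e i"
proof -
  have "(\<Sum>b\<in>UNIV. (if i = fst b then M (fst b) $ k $ snd b else 0) * e $ b)
        = (\<Sum>l\<in>UNIV. M i $ k $ l * e $ (i, l))" for k
  proof -
    have "(\<Sum>b\<in>UNIV. (if i = fst b then M (fst b) $ k $ snd b else 0) * e $ b)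
        = (\<Sum>j\<in>UNIV. \<Sum>l\<in>UNIV. if i = j then M j $ k $ l * e $ (j, l) else 0)"
      unfolding UNIV_Times_UNIV [symmetric] sum.cartesian_product
      by (rule sum.cong) (auto split: prod.splits)
    also have "\<dots> = (\<Sum>l\<in>UNIV. \<Sum>j\<in>UNIV. if i = j then M j $ k $ l * e $ (j, l) else 0)"
      by (rule sum.swap)
    finally show ?thesis by simp
  qed
  then show ?thesis
    by (simp add: blk_def block_diag_def matrix_vector_mult_def vec_eq_iff cong: if_cong)
qed

lemma kron_mat_1: "kron (mat 1) M = block_diag (\<lambda>_. M)"
  by (simp add: kron_def block_diag_def mat_def vec_eq_iff)

lemma blk_kron_mat_1:
  fixes e :: "real^('v::finite \<times> 'n::finite)"
  shows "blk (kron K (mat 1) *v e) i = (\<Sum>j\<in>UNIV. (K $ i $ j) *\<^sub>R blk e j)"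
proof -
  have "(\<Sum>b\<in>UNIV. K $ i $ fst b * (mat 1 :: real^'n^'n) $ k $ snd b * e $ b)
        = (\<Sum>j\<in>UNIV. K $ i $ j * e $ (j, k))" for k
  proof -
    have "(\<Sum>b\<in>UNIV. K $ i $ fst b * (mat 1 :: real^'n^'n) $ k $ snd b * e $ b)
        = (\<Sum>j\<in>UNIV. \<Sum>l\<in>UNIV. if k = l then K $ i $ j * e $ (j, l) else 0)"
      unfolding UNIV_Times_UNIV [symmetric] sum.cartesian_product
      by (rule sum.cong) (auto simp: mat_def split: prod.splits)
    then show ?thesis by simp
  qed
  then show ?thesis
    by (simp add: blk_def kron_def matrix_vector_mult_def vec_eq_iff)
qed

lemma blk_laplacian:
  "blk (- (kron (laplacian E) (mat 1) *v e)) i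
     = (\<Sum>j\<in>UNIV. adj E i j *\<^sub>R (blk e j - blk e i))"
  if "irrefl E"
proof -
  have 0: "adj E i i = 0"
    using that by (auto simp: adj_def irrefl_def)
  have "(\<Sum>j\<in>UNIV. (laplacian E $ i $ j) *\<^sub>R blk e j)
      = (\<Sum>j\<in>UNIV. (if j = i then (\<Sum>k\<in>UNIV. adj E i k) *\<^sub>R blk e i else 0)
                      - adj E i j *\<^sub>R blk e j)"
    by (rule sum.cong) (auto simp: laplacian_def 0)
  then show ?thesis
    by (simp add: blk_kron_mat_1 sum_subtractf scaleR_diff_right scaleR_left.sum)
qed

lemma local_out_out_diag:
  "local_out own i (out_diag own C *v e) = local_out own i (C *v blk e i)"
proof -
  have "(\<Sum>a\<in>UNIV. (if i = fst a then C $ r $ snd a else 0) * e $ a)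
        = (\<Sum>l\<in>UNIV. C $ r $ l * e $ (i, l))" for r
  proof -
    have "(\<Sum>a\<in>UNIV. (if i = fst a then C $ r $ snd a else 0) * e $ a)
        = (\<Sum>j\<in>UNIV. \<Sum>l\<in>UNIV. if i = j then C $ r $ l * e $ (j, l) else 0)"
      unfolding UNIV_Times_UNIV [symmetric] sum.cartesian_product
      by (rule sum.cong) (auto split: prod.splits)
    also have "\<dots> = (\<Sum>l\<in>UNIV. \<Sum>j\<in>UNIV. if i = j then C $ r $ l * e $ (j, l) else 0)"
      by (rule sum.swap)
    finally show ?thesis by simp
  qed
  then show ?thesis
    by (auto simp: local_out_def out_diag_def blk_def matrix_vector_mult_def vec_eq_iff cong: if_cong)
qed

lemma blk_gain_diag: "blk (gain_diag own H *v w) i = H *v local_out own i w"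
  by (auto simp: blk_def gain_diag_def local_out_def matrix_vector_mult_def vec_eq_iff
      intro!: sum.cong)

text \<open>The difference between the observers and the plant obeys the error equation.\<close>

lemma observer_minus_plant:
  assumes "irrefl E"
  shows "observer_rhs A B C own E G0 Pa H \<nu> \<mu> \<gamma> u (\<lambda>t. C *v x t) t xh
           - stack (\<lambda>_. plant_rhs A B \<gamma> u t (x t))
         = error_rhs A C own E G0 Pa H \<nu> \<mu> \<gamma> x t (xh - stack (\<lambda>_. x t))"
proof (rule blk_eqI)
  fix i
  let ?e = "xh - stack (\<lambda>_. x t)"
  have \<omega>: "local_out own i (out_diag own C *v ?e) = local_out own i (C *v blk xh i - C *v x t)"
    by (simp only: local_out_out_diag blk_diff blk_stack) (simp only: matrix_vector_mult_diff_distrib)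
  have \<theta>: "blk (- (kron (laplacian E) (mat 1) *v ?e)) i
      = (\<Sum>j\<in>UNIV. adj E i j *\<^sub>R (blk xh j - blk xh i))"
    by (simp only: blk_laplacian [OF assms]) simp
  have \<theta>': "blk (kron (laplacian E) (mat 1) *v ?e) i
      = - (\<Sum>j\<in>UNIV. adj E i j *\<^sub>R (blk xh j - blk xh i))"
    using arg_cong [OF \<theta>, of uminus] by (simp only: blk_uminus minus_minus)
  show "blk (observer_rhs A B C own E G0 Pa H \<nu> \<mu> \<gamma> u (\<lambda>t. C *v x t) t xh
           - stack (\<lambda>_. plant_rhs A B \<gamma> u t (x t))) i
      = blk (error_rhs A C own E G0 Pa H \<nu> \<mu> \<gamma> x t ?e) i"
    unfolding error_rhs_def observer_rhs_def Let_def mismatch_def plant_rhs_def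
    by (simp only: matrix_vector_mult_add_rdistrib matrix_vector_mult_diff_rdistrib
          scaleR_matrix_vector_assoc [symmetric] matrix_vector_mul_assoc [symmetric]
          blk_add blk_diff blk_scaleR blk_stack blk_block_diag kron_mat_1 blk_gain_diag \<omega> \<theta> \<theta>'
          matrix_vector_mul_lid)
       (simp add: matrix_vector_mult_diff_distrib)
qed


section \<open>Solutions and stability\<close>

text \<open>Solutions on \<open>[0, b)\<close> are understood in the integrated sense, so that the input need not
  be continuous. For a continuous right-hand side these are the classical solutions.\<close>

definition solves_on ::
  "(real \<Rightarrow> 'a \<Rightarrow> 'a::euclidean_space) \<Rightarrow> ereal \<Rightarrow> (real \<Rightarrow> 'a) \<Rightarrow> bool" where
  "solves_on F b x \<longleftrightarrow>
     0 < b \<and> (\<forall>t\<ge>0. ereal t < b \<longrightarrow> ((\<lambda>s. F s (x s)) has_integral (x t - x 0)) {0..t})"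

definition maximal_solution ::
  "(real \<Rightarrow> 'a \<Rightarrow> 'a::euclidean_space) \<Rightarrow> ereal \<Rightarrow> (real \<Rightarrow> 'a) \<Rightarrow> bool" where
  "maximal_solution F b x \<longleftrightarrow>
     solves_on F b x \<and>
     \<not> (\<exists>b' x'. b < b' \<and> solves_on F b' x' \<and> (\<forall>t\<ge>0. ereal t < b \<longrightarrow> x' t = x t))"

text \<open>A system is given by the set \<open>\<F>\<close> of its right-hand sides, one for each exogenous signal;
  all stability notions are uniform in that signal.\<close>

definition forward_complete :: "(real \<Rightarrow> 'a \<Rightarrow> 'a::euclidean_space) set \<Rightarrow> bool" where
  "forward_complete \<F> \<longleftrightarrow> (\<forall>F\<in>\<F>. \<forall>b x. maximal_solution F b x \<longrightarrow> b = \<infinity>)"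

definition lyapunov_stable :: "(real \<Rightarrow> 'a \<Rightarrow> 'a::euclidean_space) set \<Rightarrow> bool" where
  "lyapunov_stable \<F> \<longleftrightarrow>
     (\<forall>\<epsilon>>0. \<exists>\<delta>>0. \<forall>F\<in>\<F>. \<forall>b x. maximal_solution F b x \<and> norm (x 0) < \<delta> \<longrightarrow>
        (\<forall>t\<ge>0. ereal t < b \<longrightarrow> norm (x t) < \<epsilon>))"

definition locally_bounded :: "('a::euclidean_space \<Rightarrow> real) \<Rightarrow> bool" where
  "locally_bounded T \<longleftrightarrow> (\<forall>x. \<exists>U. open U \<and> x \<in> U \<and> bounded (T ` U))"

text \<open>Global uniform finite-time stability with settling-time function \<open>T\<close>.\<close>

definition finite_time_stable ::
  "(real \<Rightarrow> 'a \<Rightarrow> 'a::euclidean_space) set \<Rightarrow> ('a \<Rightarrow> real) \<Rightarrow> bool" where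
  "finite_time_stable \<F> T \<longleftrightarrow>
     forward_complete \<F> \<and> lyapunov_stable \<F> \<and> locally_bounded T \<and> (\<forall>z. T z \<ge> 0) \<and>
     (\<forall>F\<in>\<F>. \<forall>b x. maximal_solution F b x \<longrightarrow> (\<forall>t\<ge>T (x 0). x t = 0))"

definition nearly_fixed_time_stable ::
  "(real \<Rightarrow> 'a \<Rightarrow> 'a::euclidean_space) set \<Rightarrow> bool" where
  "nearly_fixed_time_stable \<F> \<longleftrightarrow>
     forward_complete \<F> \<and> lyapunov_stable \<F> \<and>
     (\<forall>r>0. \<exists>Tr>0. \<forall>F\<in>\<F>. \<forall>b x. maximal_solution F b x \<longrightarrow> (\<forall>t\<ge>Tr. norm (x t) < r))"

text \<open>The error system: one error equation for each plant trajectory.\<close>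

definition error_system ::
  "real^'n^'n \<Rightarrow> real^'m^'n \<Rightarrow> real^'n^'p \<Rightarrow> ('p::finite \<Rightarrow> 'v::finite) \<Rightarrow> ('v \<times> 'v) set \<Rightarrow>
   real^'n^'n \<Rightarrow> real^'n^'n \<Rightarrow> real^'p^'n \<Rightarrow> real \<Rightarrow> real \<Rightarrow>
   (real \<Rightarrow> real^'n \<Rightarrow> real^'n) \<Rightarrow>
   (real \<Rightarrow> real^('v \<times> 'n) \<Rightarrow> real^('v \<times> 'n)) set" where
  "error_system A B C own E G0 Pa H \<nu> \<mu> \<gamma> =
     {error_rhs A C own E G0 Pa H \<nu> \<mu> \<gamma> x | x u. solves_on (plant_rhs A B \<gamma> u) \<infinity> x}"

end

theory Submission
  imports Defs "HOL-Complex_Analysis.Great_Picard"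
begin

text \<open>
  The Lyapunov form is \<open>q(e) = \<Sum>\<^sub>i \<zeta>\<^sub>i \<parallel>e\<^sub>i\<parallel>\<^sup>2\<close>, with the norm of \<open>P\<^sub>a\<close> at every node. In the linear
  case \<open>\<mu> = 0\<close> the factor \<open>\<zeta>\<^sub>i\<close> cancels against the one in \<open>H\<^sub>i\<close>, so that on the consensus space
  the matrix inequality gives decay at rate \<open>\<rho>\<close>, while \<open>\<zeta>\<^sup>T \<L> = 0\<close> turns the coupling term
  into \<open>- \<nu>/2 \<Sum> \<zeta>\<^sub>i a\<^sub>i\<^sub>j \<parallel>e\<^sub>i - e\<^sub>j\<parallel>\<^sup>2\<close>. By compactness, a large \<open>\<nu>\<close> gives a rate
  arbitrarily close to \<open>\<rho>\<close> on the whole space. The condition on \<open>\<gamma>\<close> holds node by node and costs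
  \<open>\<tau>\<close> up to an error that vanishes with \<open>\<mu>\<close>, and on the unit sphere of \<open>q\<close> the homogeneous
  field and the dilation generator differ from the linear ones by \<open>O(\<mu>)\<close>.

  The homogeneous norm is never differentiated. If \<open>r' = - c e\<^sup>\<mu>\<^sup>r\<close>, then homogeneity makes
  \<open>q(d(- r) e)\<close> decreasing whenever it equals 1, so a solution that starts in the ball of
  homogeneous radius \<open>e\<^sup>r\<close> stays in the shrinking ball. For \<open>\<mu> < 0\<close> its radius vanishes at
  time \<open>e\<^sup>-\<^sup>\<mu>\<^sup>r\<^sup>(\<^sup>0\<^sup>) / (c \<bar>\<mu>\<bar>)\<close>, for \<open>\<mu> > 0\<close> it is at most \<open>(c \<mu> t)\<^sup>-\<^sup>1\<^sup>/\<^sup>\<mu>\<close> for every initial radius.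
  Since the field is not Lipschitz, Peano's theorem supplies the continuation of bounded solutions.
\<close>

section \<open>Peano's theorem and continuation of solutions\<close>

text \<open>The order of the quantifiers shapes the estimates: \<open>\<nu>\<close> is fixed before
  \<open>\<mu>\<close>, and \<open>Pa\<close> before both, while the matrix inequality depends on
  \<open>\<mu>\<close>. Hence \<open>\<nu>\<close> is drawn from the limit of the inequality at
  \<open>\<mu> = 0\<close>; if that limit fails, the hypotheses are contradictory for every small
  \<open>\<mu>\<close>. The homogeneous norm in the settling time weights all nodes equally, whereas
  the scaled gains and the directed coupling call for the weights \<open>\<zeta>\<close>. At the
  initial state the two are compared through \<open>\<zeta> $ i \<le> 1\<close>, which makes the
  \<open>\<zeta>\<close>-ball the larger one. On the unit sphere of \<open>q\<close> a single output
  or coupling term can still vanish, and there the ratio of the nonlinear gain to the linear one is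
  unbounded. The linear term it multiplies compensates, since \<open>s exp s\<close> stays bounded
  as \<open>s\<close> tends to minus infinity, and the deviation is uniformly of order
  \<open>\<mu>\<close>. The rate \<open>\<rho>\<close> is split: \<open>\<rho> / 6\<close> pays for
  a finite \<open>\<nu>\<close>, \<open>\<rho> / 6\<close> for the terms of order
  \<open>\<mu>\<close>, and the rest for \<open>\<tau>\<close> and the rate
  \<open>c = 2 \<rho> / 3 - \<tau>\<close>, which lies strictly above the
  \<open>\<rho> / 3 - \<tau>\<close> of the settling-time bound.\<close>

lemma delayed_solution_exists:
  fixes F :: "real \<Rightarrow> 'a::euclidean_space \<Rightarrow> 'a"
  assumes cont: "continuous_on UNIV (\<lambda>(t, x). F t x)"
    and bd: "\<And>t x. norm (F t x) \<le> M" and "\<delta> > 0"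
  obtains x where "\<And>s t. norm (x t - x s) \<le> M * \<bar>t - s\<bar>"
    and "\<And>t. t \<in> {0..h} \<Longrightarrow> x t = x0 + integral {0..max 0 (t - \<delta>)} (\<lambda>s. F s (x s))"
proof -
  define \<Phi> where "\<Phi> x t = x0 + integral {0..max 0 (t - \<delta>)} (\<lambda>s. F s (x s))" for x t
  define X where "X k = (\<Phi> ^^ k) (\<lambda>_. x0)" for k
  have X_Suc: "X (Suc k) = \<Phi> (X k)" for k
    by (simp add: X_def)
  have "M \<ge> 0"
    using bd norm_ge_zero order_trans by blast
  have contF: "continuous_on S (\<lambda>s. F s (x s))" if "continuous_on UNIV x" for x and S :: "real set"
  proof -
    have "continuous_on S (\<lambda>s. (s, x s))"
      using that by (intro continuous_on_Pair continuous_on_id) (rule continuous_on_subset, auto)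
    from continuous_on_compose2[OF cont this] show ?thesis by simp
  qed
  have lip: "norm (\<Phi> x t - \<Phi> x s) \<le> M * \<bar>t - s\<bar>" if x: "continuous_on UNIV x" for x s t
  proof -
    have *: "norm (\<Phi> x t - \<Phi> x s) \<le> M * \<bar>t - s\<bar>" if "s \<le> t" for s t
    proof -
      let ?a = "max 0 (s - \<delta>)" and ?b = "max 0 (t - \<delta>)"
      have "\<Phi> x t - \<Phi> x s = integral {?a..?b} (\<lambda>s. F s (x s))"
        using Henstock_Kurzweil_Integration.integral_combine[of 0 ?a ?b "\<lambda>s. F s (x s)"] that
        by (simp add: \<Phi>_def integrable_continuous_real contF[OF x] algebra_simps)
      also have "norm \<dots> \<le> M * (?b - ?a)"
        by (rule integral_bound) (use that in \<open>auto simp: contF[OF x] bd\<close>)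
      also have "\<dots> \<le> M * \<bar>t - s\<bar>"
        using \<open>M \<ge> 0\<close> that by (intro mult_left_mono) auto
      finally show ?thesis .
    qed
    show ?thesis
      using *[of s t] *[of t s] by (cases "s \<le> t") (auto simp: norm_minus_commute abs_minus_commute)
  qed
  have contI: "continuous_on UNIV x" if "\<And>s t. norm (x t - x s) \<le> M * \<bar>t - s\<bar>" for x :: "real \<Rightarrow> 'a"
  proof -
    have "M-lipschitz_on UNIV x"
      using that \<open>M \<ge> 0\<close> by (intro lipschitz_onI) (auto simp: dist_norm)
    then show ?thesis
      by (rule lipschitz_on_continuous_on)
  qed
  have lipX: "norm (X k t - X k s) \<le> M * \<bar>t - s\<bar>" for k s t
  proof (induction k arbitrary: s t)
    case 0
    then show ?case using \<open>M \<ge> 0\<close> by (simp add: X_def)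
  next
    case (Suc k)
    then show ?case unfolding X_Suc by (intro lip contI)
  qed
  \<comment> \<open>The right-hand side at \<open>t\<close> sees the iterate only up to
    \<open>t - \<delta>\<close>, so each iteration makes the values final on one more interval of
    length \<open>\<delta>\<close>; finitely many reach \<open>h\<close>.\<close>
  have stab: "X (Suc k) t = X k t" if "t \<le> real k * \<delta>" for k t
    using that
  proof (induction k arbitrary: t)
    case 0
    then show ?case using \<open>\<delta> > 0\<close> by (simp add: X_def \<Phi>_def)
  next
    case (Suc k)
    have "integral {0..max 0 (t - \<delta>)} (\<lambda>s. F s (X (Suc k) s)) = integral {0..max 0 (t - \<delta>)} (\<lambda>s. F s (X k s))"
    proof (rule Henstock_Kurzweil_Integration.integral_cong)
      fix s assume "s \<in> {0..max 0 (t - \<delta>)}"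
      then have "s \<le> real k * \<delta>"
        using Suc.prems \<open>\<delta> > 0\<close> by (auto simp: algebra_simps max_def split: if_splits)
      then show "F s (X (Suc k) s) = F s (X k s)"
        by (simp add: Suc.IH)
    qed
    then show ?case
      by (simp add: X_Suc[of "Suc k"] X_Suc[of k] \<Phi>_def)
  qed
  obtain k where k: "h \<le> real k * \<delta>"
    using reals_Archimedean3[OF \<open>\<delta> > 0\<close>] less_imp_le by blast
  show thesis
  proof
    show "norm (X k t - X k s) \<le> M * \<bar>t - s\<bar>" for s t by (rule lipX)
    show "X k t = x0 + integral {0..max 0 (t - \<delta>)} (\<lambda>s. F s (X k s))" if "t \<in> {0..h}" for t
      using stab[of t k] that k unfolding X_Suc by (simp add: \<Phi>_def)
  qed
qed

text \<open>Tonelli's scheme: the delayed solutions share the Lipschitz constant \<open>M\<close>,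
  so Arzela-Ascoli gives a uniform limit along the delays \<open>1 / (n + 1)\<close>, and the defect
  of the integral equation is at most \<open>M\<close> times the delay.\<close>

lemma peano_bounded:
  fixes F :: "real \<Rightarrow> 'a::euclidean_space \<Rightarrow> 'a"
  assumes cont: "continuous_on UNIV (\<lambda>(t, x). F t x)"
    and bd: "\<And>t x. norm (F t x) \<le> M" and "h > 0"
  obtains z where "continuous_on {0..h} z"
    and "\<And>t. t \<in> {0..h} \<Longrightarrow> ((\<lambda>s. F s (z s)) has_integral (z t - x0)) {0..t}"
proof -
  have "M \<ge> 0"
    using bd norm_ge_zero order_trans by blast
  define \<delta> where "\<delta> n = 1 / real (Suc n)" for n
  have \<delta>: "\<delta> n > 0" for n by (simp add: \<delta>_def)
  have "\<exists>x. (\<forall>s t. norm (x t - x s) \<le> M * \<bar>t - s\<bar>) \<and>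
      (\<forall>t\<in>{0..h}. x t = x0 + integral {0..max 0 (t - \<delta> n)} (\<lambda>s. F s (x s)))" for n
    by (rule delayed_solution_exists[OF cont bd \<delta>[of n], of h x0]) blast
  then obtain x where lip: "\<And>n s t. norm (x n t - x n s) \<le> M * \<bar>t - s\<bar>"
    and x: "\<And>n t. t \<in> {0..h} \<Longrightarrow> x n t = x0 + integral {0..max 0 (t - \<delta> n)} (\<lambda>s. F s (x n s))"
    by metis
  have x_0: "x n 0 = x0" for n
    using x[of 0 n] \<open>h > 0\<close> \<delta>[of n] by simp
  have contx: "continuous_on S (x n)" for n S
  proof -
    have "M-lipschitz_on S (x n)"
      using lip \<open>M \<ge> 0\<close> by (intro lipschitz_onI) (auto simp: dist_norm)
    then show ?thesis
      by (rule lipschitz_on_continuous_on)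
  qed
  have contF: "continuous_on S (\<lambda>s. F s (y s))" if "continuous_on S y" for y and S :: "real set"
  proof -
    have "continuous_on S (\<lambda>s. (s, y s))"
      by (intro continuous_on_Pair continuous_on_id that)
    from continuous_on_compose2[OF cont this] show ?thesis by simp
  qed
  obtain z k where z: "continuous_on {0..h} z" and k: "strict_mono (k :: nat \<Rightarrow> nat)"
    and lim: "\<And>e. 0 < e \<Longrightarrow> \<exists>N. \<forall>n t. n \<ge> N \<and> t \<in> {0..h} \<longrightarrow> norm (x (k n) t - z t) < e"
  proof (rule Arzela_Ascoli[of "{0..h}" x "norm x0 + M * h"])
    show "norm (x n t) \<le> norm x0 + M * h" if "t \<in> {0..h}" for n t
    proof -
      have "norm (x n t - x0) \<le> M * \<bar>t - 0\<bar>" using lip[of n t 0] x_0 by simp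
      also have "\<dots> \<le> M * h" using that \<open>M \<ge> 0\<close> by (intro mult_left_mono) auto
      finally show ?thesis using norm_triangle_sub[of "x n t" x0] by linarith
    qed
    show "\<exists>d>0. \<forall>n t. t \<in> {0..h} \<and> norm (s - t) < d \<longrightarrow> norm (x n s - x n t) < e"
      if "0 < e" for s e :: real
    proof (intro exI conjI allI impI)
      show "0 < e / (M + 1)" using that \<open>M \<ge> 0\<close> by simp
      fix n t assume "t \<in> {0..h} \<and> norm (s - t) < e / (M + 1)"
      then have "\<bar>s - t\<bar> * (M + 1) < e"
        using \<open>M \<ge> 0\<close> by (simp add: pos_less_divide_eq)
      then have "M * \<bar>s - t\<bar> < e"
        by (simp add: algebra_simps)
      then show "norm (x n s - x n t) < e"
        using lip[of n s t] by linarith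
    qed
  qed auto
  have ptw: "(\<lambda>n. x (k n) t) \<longlonglongrightarrow> z t" if "t \<in> {0..h}" for t
    unfolding LIMSEQ_iff using lim that by blast
  have \<delta>0: "(\<lambda>n. \<delta> (k n)) \<longlonglongrightarrow> 0"
    unfolding \<delta>_def using LIMSEQ_subseq_LIMSEQ[OF LIMSEQ_inverse_real_of_nat k]
    by (simp add: o_def inverse_eq_divide)
  have "((\<lambda>s. F s (z s)) has_integral (z t - x0)) {0..t}" if t: "t \<in> {0..h}" for t
  proof -
    have z': "continuous_on {0..t} z"
      using z t by (auto intro: continuous_on_subset)
    have I: "(\<lambda>n. integral {0..t} (\<lambda>s. F s (x (k n) s))) \<longlonglongrightarrow> integral {0..t} (\<lambda>s. F s (z s))"
    proof (rule dominated_convergence(2)[where h = "\<lambda>_. M"])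
      show "(\<lambda>s. F s (x (k n) s)) integrable_on {0..t}" for n
        by (intro integrable_continuous_real contF contx)
      show "(\<lambda>_. M) integrable_on {0..t}"
        by (rule integrable_const_ivl)
      show "(\<lambda>n. F s (x (k n) s)) \<longlonglongrightarrow> F s (z s)" if "s \<in> {0..t}" for s
      proof -
        have "continuous (at (s, z s)) (\<lambda>(t, x). F t x)"
          using cont by (simp add: continuous_on_eq_continuous_at)
        moreover have "(\<lambda>n. (s, x (k n) s)) \<longlonglongrightarrow> (s, z s)"
          using ptw[of s] that t by (intro tendsto_intros) auto
        ultimately have "(\<lambda>n. (\<lambda>(t, x). F t x) (s, x (k n) s)) \<longlonglongrightarrow> (\<lambda>(t, x). F t x) (s, z s)"
          by (rule isCont_tendsto_compose)
        then show ?thesis by simp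
      qed
    qed (rule bd)
    \<comment> \<open>Removing the delay adds only the integral over a last stretch of length at
      most \<open>\<delta> (k n)\<close>.\<close>
    have D: "norm (x (k n) t - x0 - integral {0..t} (\<lambda>s. F s (x (k n) s))) \<le> M * \<delta> (k n)" for n
    proof -
      let ?a = "max 0 (t - \<delta> (k n))"
      have a: "0 \<le> ?a" "?a \<le> t" using \<delta>[of "k n"] t by auto
      have "integral {0..?a} (\<lambda>s. F s (x (k n) s)) + integral {?a..t} (\<lambda>s. F s (x (k n) s))
          = integral {0..t} (\<lambda>s. F s (x (k n) s))"
        by (intro Henstock_Kurzweil_Integration.integral_combine a integrable_continuous_real contF contx)
      then have "x (k n) t - x0 - integral {0..t} (\<lambda>s. F s (x (k n) s))
          = - integral {?a..t} (\<lambda>s. F s (x (k n) s))"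
        using x[OF t, of "k n"] by (simp add: algebra_simps)
      also have "norm \<dots> \<le> M * (t - ?a)"
        unfolding norm_minus_cancel by (intro integral_bound a contF contx bd)
      also have "\<dots> \<le> M * \<delta> (k n)"
        using \<open>M \<ge> 0\<close> by (intro mult_left_mono) auto
      finally show ?thesis .
    qed
    have "(\<lambda>n. x (k n) t - x0 - integral {0..t} (\<lambda>s. F s (x (k n) s))) \<longlonglongrightarrow> 0"
      by (rule Lim_null_comparison[OF always_eventually[OF allI[OF D]]])
        (use tendsto_mult_right_zero[OF \<delta>0, of M] in simp)
    moreover have "(\<lambda>n. x (k n) t - x0 - integral {0..t} (\<lambda>s. F s (x (k n) s)))
        \<longlonglongrightarrow> z t - x0 - integral {0..t} (\<lambda>s. F s (z s))"
      by (intro tendsto_intros ptw t I)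
    ultimately have "z t - x0 - integral {0..t} (\<lambda>s. F s (z s)) = 0"
      using LIMSEQ_unique by blast
    moreover have "(\<lambda>s. F s (z s)) integrable_on {0..t}"
      by (intro integrable_continuous_real contF z')
    ultimately show ?thesis
      by (simp add: has_integral_iff)
  qed
  with z show thesis by (rule that)
qed

text \<open>Reduces to a bounded field by clamping the time to a unit interval and projecting the
  state onto a unit ball. Up to time \<open>min 1 (1 / M)\<close> the solution cannot leave the
  ball, where the modified field is \<open>F\<close> itself.\<close>

lemma peano:
  fixes F :: "real \<Rightarrow> 'a::euclidean_space \<Rightarrow> 'a"
  assumes cont: "continuous_on ({0..} \<times> UNIV) (\<lambda>(t, x). F t x)" and "t0 \<ge> 0"
  obtains h z where "h > 0" "continuous_on {t0..t0 + h} z" "z t0 = x0"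
    and "\<And>t. t \<in> {t0..t0 + h} \<Longrightarrow> ((\<lambda>s. F s (z s)) has_integral (z t - x0)) {t0..t}"
proof -
  define G where "G t x = F (max t0 (min (t0 + 1) (t + t0))) (closest_point (cball x0 1) x)" for t x
  have cp: "closest_point (cball x0 1) x \<in> cball x0 1" for x
    by (intro closest_point_in_set) auto
  have contG: "continuous_on UNIV (\<lambda>(t, x). G t x)"
    unfolding G_def case_prod_unfold
    using \<open>t0 \<ge> 0\<close>
    by (intro continuous_on_compose2[OF cont, unfolded case_prod_unfold, of _ "\<lambda>p. (max t0 (min (t0 + 1) (fst p + t0)), closest_point (cball x0 1) (snd p))", simplified] continuous_intros
         continuous_on_compose2[OF continuous_on_closest_point[of "cball x0 1" UNIV]]) auto
  have "compact ((\<lambda>(t, x). F t x) ` ({t0..t0 + 1} \<times> cball x0 1))"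
    using \<open>t0 \<ge> 0\<close> by (intro compact_continuous_image compact_Times continuous_on_subset[OF cont]) auto
  then have "bounded ((\<lambda>(t, x). F t x) ` ({t0..t0 + 1} \<times> cball x0 1))"
    by (rule compact_imp_bounded)
  then obtain M where M: "M > 0"
      "\<And>p. p \<in> {t0..t0 + 1} \<times> cball x0 1 \<Longrightarrow> norm (case p of (t, x) \<Rightarrow> F t x) \<le> M"
    unfolding bounded_pos by blast
  have bdG: "norm (G t x) \<le> M" for t x
    unfolding G_def
    using M(2)[of "(max t0 (min (t0 + 1) (t + t0)), closest_point (cball x0 1) x)"] cp[of x]
    by (simp del: mem_cball)
  define h where "h = min 1 (1 / M)"
  have h: "h > 0" "h \<le> 1" "M * h \<le> 1" using M(1) by (auto simp: h_def min_def field_simps)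
  obtain w where w: "continuous_on {0..h} w"
    and wI: "\<And>t. t \<in> {0..h} \<Longrightarrow> ((\<lambda>s. G s (w s)) has_integral (w t - x0)) {0..t}"
    using peano_bounded[OF contG bdG h(1)] by metis
  have w0: "w 0 = x0"
    using wI[of 0] h has_integral_null_real[of 0 0] by (auto simp: has_integral_iff)
  have wb: "w t \<in> cball x0 1" if "t \<in> {0..h}" for t
  proof -
    have "norm (w t - x0) = norm (integral {0..t} (\<lambda>s. G s (w s)))"
      using wI[OF that] by (simp add: has_integral_iff)
    also have "\<dots> \<le> M * (t - 0)"
    proof (rule integral_bound)
      have "continuous_on {0..t} w" using w that by (auto intro: continuous_on_subset)
      then have "continuous_on {0..t} (\<lambda>s. (s, w s))"
        by (intro continuous_on_Pair continuous_on_id)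
      from continuous_on_compose2[OF contG this] show "continuous_on {0..t} (\<lambda>s. G s (w s))"
        by simp
    qed (use that bdG in auto)
    also have "\<dots> \<le> M * h" using that M(1) by auto
    also have "\<dots> \<le> 1" by (rule h)
    finally show ?thesis by (simp add: dist_norm norm_minus_commute)
  qed
  show thesis
  proof (rule that[of h "\<lambda>t. w (t - t0)"])
    show "h > 0" by (rule h)
    show "continuous_on {t0..t0 + h} (\<lambda>t. w (t - t0))"
      by (rule continuous_on_compose2[OF w]) (auto intro!: continuous_intros)
    show "w (t0 - t0) = x0" using w0 by simp
    fix t assume t: "t \<in> {t0..t0 + h}"
    have "((\<lambda>s. G s (w s)) has_integral (w (t - t0) - x0)) {0..t - t0}"
      using t by (intro wI) auto
    then have "((\<lambda>s. G s (w s)) has_integral (w (t - t0) - x0)) (cbox 0 (t - t0))"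
      by simp
    from has_integral_affinity'[OF this, of 1 "- t0"]
    have "((\<lambda>s. G (s - t0) (w (s - t0))) has_integral (w (t - t0) - x0)) {t0..t}"
      by (simp add: algebra_simps)
    then show "((\<lambda>s. F s (w (s - t0))) has_integral (w (t - t0) - x0)) {t0..t}"
    proof (rule has_integral_eq[rotated])
      fix s assume s: "s \<in> {t0..t}"
      have "w (s - t0) \<in> cball x0 1" using s t by (intro wb) auto
      then show "G (s - t0) (w (s - t0)) = F s (w (s - t0))"
        using s t h by (simp add: G_def closest_point_self del: mem_cball)
    qed
  qed
qed

section \<open>Regularity and continuation of solutions in the integrated sense\<close>

lemma solves_on_continuous:
  assumes sol: "solves_on F b x" and T: "ereal T < b"
  shows "continuous_on {0..T} x"
proof (cases "T \<ge> 0")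
  case True
  have I: "((\<lambda>s. F s (x s)) has_integral (x t - x 0)) {0..t}" if "t \<in> {0..T}" for t
    using sol that le_less_trans[of "ereal t" "ereal T" b] T by (simp add: solves_on_def)
  have "(\<lambda>s. F s (x s)) integrable_on {0..T}"
    using I[of T] True by auto
  \<comment> \<open>\<open>solves_on\<close> does not ask for continuity; it is inherited from the
    indefinite integral.\<close>
  then have "continuous_on {0..T} (\<lambda>t. x 0 + integral {0..t} (\<lambda>s. F s (x s)))"
    by (intro continuous_intros indefinite_integral_continuous_1)
  then show ?thesis
    by (rule continuous_on_eq) (simp add: integral_unique[OF I])
qed auto

lemma continuous_along_solution:
  assumes cont: "continuous_on ({0..} \<times> UNIV) (\<lambda>(t, x). F t x)" and x: "continuous_on {0..T} x"
  shows "continuous_on {0..T::real} (\<lambda>s. F s (x s))"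
proof -
  have "continuous_on {0..T} (\<lambda>s. (s, x s))"
    by (intro continuous_on_Pair continuous_on_id x)
  from continuous_on_compose2[OF cont this] show ?thesis by (auto simp: image_subset_iff)
qed

lemma solves_on_has_vector_derivative:
  fixes F :: "real \<Rightarrow> 'a::euclidean_space \<Rightarrow> 'a"
  assumes cont: "continuous_on ({0..} \<times> UNIV) (\<lambda>(t, x). F t x)"
    and sol: "solves_on F b x" and T: "ereal T < b" and t: "t \<in> {0..T}"
  shows "(x has_vector_derivative F t (x t)) (at t within {0..T})"
proof -
  have I: "((\<lambda>s. F s (x s)) has_integral (x t - x 0)) {0..t}" if "t \<in> {0..T}" for t
    using sol that le_less_trans[of "ereal t" "ereal T" b] T by (simp add: solves_on_def)
  have "continuous_on {0..T} (\<lambda>s. F s (x s))"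
    by (rule continuous_along_solution[OF cont solves_on_continuous[OF sol T]])
  then have "((\<lambda>t. x 0 + integral {0..t} (\<lambda>s. F s (x s))) has_vector_derivative 0 + F t (x t))
      (at t within {0..T})"
    by (intro has_vector_derivative_add has_vector_derivative_const integral_has_vector_derivative t)
  then show ?thesis
    unfolding add_0
    by (rule has_vector_derivative_transform[OF t, rotated]) (simp_all add: integral_unique[OF I])
qed

text \<open>On the compact set swept up to time \<open>b\<close> the field is bounded, so the
  solution is Lipschitz and has a limit at \<open>b\<close>, from which Peano's theorem restarts it.
  The continuation need not be unique; maximality only excludes that one exists.\<close>

lemma bounded_solution_continuation:
  fixes F :: "real \<Rightarrow> 'a::euclidean_space \<Rightarrow> 'a"
  assumes cont: "continuous_on ({0..} \<times> UNIV) (\<lambda>(t, x). F t x)"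
    and sol: "solves_on F (ereal b) x" and R: "\<And>t. t \<in> {0..<b} \<Longrightarrow> norm (x t) \<le> R"
  shows "\<exists>b' x'. ereal b < b' \<and> solves_on F b' x' \<and> (\<forall>t\<ge>0. ereal t < ereal b \<longrightarrow> x' t = x t)"
proof -
  have "b > 0" using sol by (simp add: solves_on_def)
  have I: "((\<lambda>s. F s (x s)) has_integral (x t - x 0)) {0..t}" if "t \<in> {0..<b}" for t
    using sol that by (auto simp: solves_on_def)
  have cx: "continuous_on {0..t} x" if "t < b" for t
    using solves_on_continuous[OF sol] that by simp
  have "compact ((\<lambda>(t, x). F t x) ` ({0..b} \<times> cball 0 R))"
    by (intro compact_continuous_image compact_Times continuous_on_subset[OF cont]) auto
  then have "bounded ((\<lambda>(t, x). F t x) ` ({0..b} \<times> cball 0 R))"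
    by (rule compact_imp_bounded)
  then obtain M where M: "M > 0"
      "\<And>p. p \<in> {0..b} \<times> cball 0 R \<Longrightarrow> norm (case p of (t, x) \<Rightarrow> F t x) \<le> M"
    unfolding bounded_pos by blast
  have FM: "norm (F s (x s)) \<le> M" if "s \<in> {0..<b}" for s
    using M(2)[of "(s, x s)"] R[OF that] that by auto
  have lip: "norm (x t - x s) \<le> M * (t - s)" if "0 \<le> s" "s \<le> t" "t < b" for s t
  proof -
    have cF: "continuous_on {0..t} (\<lambda>s. F s (x s))"
      by (rule continuous_along_solution[OF cont cx[OF that(3)]])
    have "x t - x s = integral {s..t} (\<lambda>s. F s (x s))"
      using Henstock_Kurzweil_Integration.integral_combine[of 0 s t "\<lambda>s. F s (x s)"] that
        integral_unique[OF I[of s]] integral_unique[OF I[of t]] integrable_continuous_real[OF cF]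
      by (simp add: algebra_simps)
    also have "norm \<dots> \<le> M * (t - s)"
      by (intro integral_bound continuous_on_subset[OF cF] FM) (use that in auto)
    finally show ?thesis .
  qed
  have "M-lipschitz_on {0..<b} x"
  proof (rule lipschitz_onI)
    fix s t assume st: "s \<in> {0..<b}" "t \<in> {0..<b}"
    show "dist (x s) (x t) \<le> M * dist s t"
    proof (cases "s \<le> t")
      case True
      then show ?thesis
        using lip[of s t] st by (simp add: dist_norm norm_minus_commute)
    next
      case False
      then show ?thesis
        using lip[of t s] st by (simp add: dist_norm)
    qed
  qed (use M(1) in simp)
  then obtain y where y: "M-lipschitz_on (closure {0..<b}) y" "\<And>t. t \<in> {0..<b} \<Longrightarrow> y t = x t"
    using lipschitz_extend_closure[of M "{0..<b}" x] by blast
  have cl: "closure {0..<b} = {0..b}" using \<open>b > 0\<close> by simp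
  have cy: "continuous_on {0..b} y"
    using lipschitz_on_continuous_on[OF y(1)] cl by simp
  have cFy: "continuous_on {0..b} (\<lambda>s. F s (y s))"
    by (rule continuous_along_solution[OF cont cy])
  \<comment> \<open>The integral equation is an identity of continuous functions on
    \<open>[0, b)\<close> and passes to the endpoint by density.\<close>
  have "y t - y 0 - integral {0..t} (\<lambda>s. F s (y s)) = 0" if "t \<in> {0..b}" for t
  proof (rule continuous_constant_on_closure[of "{0..<b}"])
    show "continuous_on (closure {0..<b}) (\<lambda>t. y t - y 0 - integral {0..t} (\<lambda>s. F s (y s)))"
      unfolding cl by (intro continuous_intros cy indefinite_integral_continuous_1 integrable_continuous_real cFy)
    show "t \<in> closure {0..<b}" using that cl by simp
    fix s assume s: "s \<in> {0..<b}"
    have "integral {0..s} (\<lambda>s. F s (y s)) = integral {0..s} (\<lambda>s. F s (x s))"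
      using s by (intro Henstock_Kurzweil_Integration.integral_cong) (auto simp: y)
    also have "\<dots> = x s - x 0" using I[OF s] by (rule integral_unique)
    finally show "y s - y 0 - integral {0..s} (\<lambda>s. F s (y s)) = 0"
      using s \<open>b > 0\<close> by (simp add: y)
  qed
  then have Iy: "((\<lambda>s. F s (y s)) has_integral (y t - y 0)) {0..t}" if "t \<in> {0..b}" for t
    using that integrable_continuous_real[OF continuous_on_subset[OF cFy, of "{0..t}"]]
    by (simp add: has_integral_iff)
  obtain h z where h: "h > 0" and z: "z b = y b"
    and Iz: "\<And>t. t \<in> {b..b + h} \<Longrightarrow> ((\<lambda>s. F s (z s)) has_integral (z t - y b)) {b..t}"
    using peano[OF cont, of b "y b"] \<open>b > 0\<close> by (metis less_imp_le)
  define w where "w t = (if t \<le> b then y t else z t)" for t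
  have "((\<lambda>s. F s (w s)) has_integral (w t - w 0)) {0..t}" if "t \<ge> 0" "t < b + h" for t
  proof (cases "t \<le> b")
    case True
    then show ?thesis
      using Iy[of t] that by (auto simp: w_def intro: has_integral_eq[rotated])
  next
    case False
    have 1: "((\<lambda>s. F s (w s)) has_integral (y b - y 0)) {0..b}"
      using Iy[of b] \<open>b > 0\<close> by (auto simp: w_def intro: has_integral_eq[rotated])
    have 2: "((\<lambda>s. F s (w s)) has_integral (z t - y b)) {b..t}"
    proof (rule has_integral_eq[rotated])
      show "((\<lambda>s. F s (z s)) has_integral (z t - y b)) {b..t}"
        using False that by (intro Iz) auto
    qed (use z in \<open>auto simp: w_def\<close>)
    show ?thesis
      using has_integral_combine[OF _ _ 1 2] False \<open>b > 0\<close> by (simp add: w_def)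
  qed
  then have "solves_on F (ereal (b + h)) w"
    using \<open>b > 0\<close> h by (auto simp: solves_on_def)
  moreover have "\<forall>t\<ge>0. ereal t < ereal b \<longrightarrow> w t = x t"
    by (simp add: w_def y)
  ultimately show ?thesis
    using h by (intro exI[of _ "ereal (b + h)"] exI[of _ w]) auto
qed

lemma forward_completeI:
  fixes \<F> :: "(real \<Rightarrow> 'a \<Rightarrow> 'a::euclidean_space) set"
  assumes cont: "\<And>F. F \<in> \<F> \<Longrightarrow> continuous_on ({0..} \<times> UNIV) (\<lambda>(t, x). F t x)"
    and bd: "\<And>F b x. F \<in> \<F> \<Longrightarrow> solves_on F (ereal b) x \<Longrightarrow> \<exists>R. \<forall>t\<in>{0..<b}. norm (x t) \<le> R"
  shows "forward_complete \<F>"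
  unfolding forward_complete_def
proof (intro ballI allI impI)
  fix F b x assume F: "F \<in> \<F>" and max: "maximal_solution F b x"
  show "b = \<infinity>"
  proof (cases b)
    case (real r)
    then have sol: "solves_on F (ereal r) x" using max by (simp add: maximal_solution_def)
    with bd[OF F] obtain R where "\<And>t. t \<in> {0..<r} \<Longrightarrow> norm (x t) \<le> R" by blast
    from bounded_solution_continuation[OF cont[OF F] sol this] show ?thesis
      using max real by (auto simp: maximal_solution_def)
  next
    case MInf
    then show ?thesis using max by (simp add: maximal_solution_def solves_on_def)
  qed
qed

section \<open>The matrix exponential\<close>

lemma mpow_Suc: "mpow M (Suc k) = M ** mpow M k"
  by (simp add: mpow_def)

lemma mpow_commute: "M ** mpow M k = mpow M k ** M"
  by (induction k) (simp_all add: mpow_def matrix_mul_assoc)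

lemma mpow_scaleR: "mpow (s *\<^sub>R M) k = s ^ k *\<^sub>R mpow M k"
  by (induction k) (simp_all add: mpow_def scalar_matrix_assoc matrix_scalar_ac scalar_mult_eq_scaleR[symmetric] flip: scalar_matrix_assoc)

lemma bounded_bilinear_matrix_vector_mult:
  "bounded_bilinear ((*v) :: real^'n^'m \<Rightarrow> real^'n \<Rightarrow> real^'m)"
  unfolding bilinear_conv_bounded_bilinear[symmetric] bilinear_def linear_iff
  by (simp add: algebra_simps scaleR_matrix_vector_assoc matrix_vector_mult_scaleR)

lemma matrix_mult_scaleR_right: "M ** (c *\<^sub>R (X :: real^'k^'n)) = c *\<^sub>R (M ** X)"
  by (simp add: matrix_matrix_mult_def vec_eq_iff sum_distrib_left mult.left_commute)

lemma matrix_mult_scaleR_left: "(c *\<^sub>R M) ** (X :: real^'k^'n) = c *\<^sub>R (M ** X)"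
  by (simp add: matrix_matrix_mult_def vec_eq_iff sum_distrib_left mult.assoc)

lemma matrix_mult_add_left: "(M + M') ** (X :: real^'k^'n) = M ** X + M' ** X"
  by (simp add: matrix_matrix_mult_def vec_eq_iff distrib_right sum.distrib)

lemma bounded_linear_matrix_mult_right: "bounded_linear (\<lambda>X :: real^'k^'n. (M :: real^'n^'m) ** X)"
  unfolding linear_conv_bounded_linear[symmetric] linear_iff
  by (simp add: matrix_add_ldistrib matrix_mult_scaleR_right)

lemma bounded_linear_matrix_mult_left: "bounded_linear (\<lambda>X :: real^'n^'m. X ** (M :: real^'k^'n))"
  unfolding linear_conv_bounded_linear[symmetric] linear_iff
  by (simp add: matrix_mult_add_left matrix_mult_scaleR_left)

section \<open>Termwise differentiation of the exponential series\<close>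

lemma exp_series_summable:
  fixes X :: "nat \<Rightarrow> 'a::euclidean_space"
  assumes "\<And>k. norm (X k) \<le> c * K ^ k"
  shows "summable (\<lambda>k. (s ^ k / fact k) *\<^sub>R X k)"
proof (rule summable_comparison_test')
  show "summable (\<lambda>k. c * ((\<bar>s\<bar> * K) ^ k /\<^sub>R fact k))"
    by (intro summable_mult summable_exp_generic)
  show "norm ((s ^ k / fact k) *\<^sub>R X k) \<le> c * ((\<bar>s\<bar> * K) ^ k /\<^sub>R fact k)" for k
    using mult_left_mono[OF assms[of k], of "\<bar>s\<bar> ^ k / fact k"]
    by (simp add: power_abs power_mult_distrib field_simps)
qed

text \<open>Tested against a basis vector, the series become real power series, which may be
  differentiated term by term; \<open>diffs\<close> shifts the index and cancels one factor of the
  factorial.\<close>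

lemma exp_series_has_vector_derivative:
  fixes X :: "nat \<Rightarrow> 'a::euclidean_space"
  assumes bd: "\<And>k. norm (X k) \<le> c * K ^ k"
  shows "((\<lambda>s. \<Sum>k. (s ^ k / fact k) *\<^sub>R X k) has_vector_derivative
      (\<Sum>k. (s ^ k / fact k) *\<^sub>R X (Suc k))) (at s)"
proof -
  have bd': "norm (X (Suc k)) \<le> (c * K) * K ^ k" for k
    using bd[of "Suc k"] by (simp add: mult_ac)
  have inner_sum: "(\<Sum>k. (s ^ k / fact k) *\<^sub>R Y k) \<bullet> b = (\<Sum>k. (Y k \<bullet> b / fact k) * s ^ k)"
    if "summable (\<lambda>k. (s ^ k / fact k) *\<^sub>R Y k)" for Y :: "nat \<Rightarrow> 'a" and b s
    using bounded_linear.suminf[OF bounded_linear_inner_left that, of b] by (simp add: mult_ac)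
  have "((\<lambda>s. (\<Sum>k. (s ^ k / fact k) *\<^sub>R X k) \<bullet> b) has_vector_derivative
      (\<Sum>k. (s ^ k / fact k) *\<^sub>R X (Suc k)) \<bullet> b) (at s)" for b
  proof -
    have "summable (\<lambda>k. (X k \<bullet> b / fact k) * y ^ k)" for y
      using bounded_linear.summable[OF bounded_linear_inner_left exp_series_summable[OF bd, of y], of b]
      by (simp add: mult_ac)
    then have "((\<lambda>s. \<Sum>k. (X k \<bullet> b / fact k) * s ^ k) has_field_derivative
        (\<Sum>k. diffs (\<lambda>k. X k \<bullet> b / fact k) k * s ^ k)) (at s)"
      by (rule termdiffs_strong_converges_everywhere)
    moreover have "diffs (\<lambda>k. X k \<bullet> b / fact k) k = X (Suc k) \<bullet> b / fact k" for k
      by (simp add: diffs_def field_simps del: of_nat_Suc)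
    ultimately show ?thesis
      unfolding inner_sum[OF exp_series_summable[OF bd]] inner_sum[OF exp_series_summable[OF bd']]
      by (simp add: has_real_derivative_iff_has_vector_derivative)
  qed
  then show ?thesis
    unfolding has_vector_derivative_def
    by (subst has_derivative_componentwise_within) simp
qed

lemma mexp_series: "mexp (s *\<^sub>R M) = (\<Sum>k. (s ^ k / fact k) *\<^sub>R mpow M k)"
  by (simp add: mexp_def mpow_scaleR divide_inverse mult.commute)

text \<open>\<open>K\<close> is a bound of the linear map \<open>X \<mapsto> M ** X\<close> on the
  space of matrices, and \<open>c\<close> is the norm of the identity, which in general is not 1 for
  the Euclidean norm of matrices.\<close>

lemma mpow_norm_bound:
  obtains c K where "\<And>k. norm (mpow (M :: real^'n^'n) k) \<le> c * K ^ k"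
proof -
  obtain K where K: "K > 0" "\<And>X. norm (M ** X :: real^'n^'n) \<le> norm X * K"
    using bounded_linear.pos_bounded[OF bounded_linear_matrix_mult_right[of M]] by blast
  have "norm (mpow M k) \<le> norm (mat 1 :: real^'n^'n) * K ^ k" for k
  proof (induction k)
    case (Suc k)
    then show ?case
      using order_trans[OF K(2)[of "mpow M k"] mult_right_mono[OF Suc, of K]] K(1)
      by (simp add: mpow_Suc mult_ac)
  qed (simp add: mpow_def)
  then show thesis by (rule that)
qed

lemma mexp_has_vector_derivative:
  "((\<lambda>s. mexp (s *\<^sub>R M)) has_vector_derivative M ** mexp (s *\<^sub>R M)) (at s)"
proof -
  obtain c K where bd: "\<And>k. norm (mpow M k) \<le> c * K ^ k" by (rule mpow_norm_bound[of M]) blast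
  have "M ** mexp (s *\<^sub>R M) = (\<Sum>k. (s ^ k / fact k) *\<^sub>R mpow M (Suc k))"
    unfolding mexp_series
    using bounded_linear.suminf[OF bounded_linear_matrix_mult_right exp_series_summable[OF bd], of M s]
    by (simp add: mpow_Suc matrix_mult_scaleR_right)
  then show ?thesis
    unfolding mexp_series using exp_series_has_vector_derivative[OF bd] by simp
qed

lemma mexp_commute: "M ** mexp (s *\<^sub>R M) = mexp (s *\<^sub>R M) ** M"
proof -
  obtain c K where bd: "\<And>k. norm (mpow M k) \<le> c * K ^ k" by (rule mpow_norm_bound[of M]) blast
  note S = exp_series_summable[OF bd]
  show ?thesis
    unfolding mexp_series
    using bounded_linear.suminf[OF bounded_linear_matrix_mult_right[of M] S[of s]]
      bounded_linear.suminf[OF bounded_linear_matrix_mult_left[of M] S[of s]]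
    by (simp add: matrix_mult_scaleR_right matrix_mult_scaleR_left mpow_commute)
qed

lemma mexp_0 [simp]: "mexp 0 = mat 1"
proof -
  have "mexp (0 *\<^sub>R (0 :: real^'a^'a)) = (\<Sum>k. if k = 0 then mat 1 else 0)"
    unfolding mexp_series by (intro suminf_cong) (simp add: mpow_def)
  also have "\<dots> = mat 1"
    using suminf_finite[of "{0 :: nat}" "\<lambda>k. if k = 0 then mat 1 :: real^'a^'a else 0"] by simp
  finally show ?thesis by simp
qed

section \<open>The flow of a linear differential equation\<close>

lemma mexp_mult_vec_has_vector_derivative:
  "((\<lambda>s. mexp (s *\<^sub>R M) *v v) has_vector_derivative M *v (mexp (s *\<^sub>R M) *v v)) (at s)"
  using bounded_bilinear.has_vector_derivative[OF bounded_bilinear_matrix_vector_mult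
      mexp_has_vector_derivative[of M s] has_vector_derivative_const[of v]]
  by (simp add: matrix_vector_mul_assoc)

text \<open>Uniqueness for linear equations: because \<open>M\<close> commutes with its exponential,
  the left-hand side has derivative zero. The inverse, the group law and the intertwining relation
  below all come from it.\<close>

lemma mexp_uminus_cancel_ode:
  assumes "\<And>s. (\<phi> has_vector_derivative M *v \<phi> s) (at s)"
  shows "mexp (- (s *\<^sub>R M)) *v \<phi> s = \<phi> 0"
proof -
  let ?\<psi> = "\<lambda>s. mexp (- (s *\<^sub>R M)) *v \<phi> s"
  have "(?\<psi> has_vector_derivative 0) (at s)" for s
  proof -
    have "((\<lambda>s. mexp (s *\<^sub>R (- M))) has_vector_derivative (- M) ** mexp (s *\<^sub>R (- M))) (at s)"
      by (rule mexp_has_vector_derivative)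
    from bounded_bilinear.has_vector_derivative[OF bounded_bilinear_matrix_vector_mult this assms[of s]]
    have "((\<lambda>s. mexp (s *\<^sub>R (- M)) *v \<phi> s) has_vector_derivative
        mexp (s *\<^sub>R (- M)) *v (M *v \<phi> s) + ((- M) ** mexp (s *\<^sub>R (- M))) *v \<phi> s) (at s)" .
    moreover have "((- M) ** mexp (s *\<^sub>R (- M))) *v \<phi> s = - (mexp (s *\<^sub>R (- M)) *v (M *v \<phi> s))"
      unfolding mexp_commute
      using matrix_vector_mult_scaleR[of "mexp (s *\<^sub>R (- M))" "-1" "M *v \<phi> s"]
        scaleR_matrix_vector_assoc[of "-1" M "\<phi> s"]
      by (simp flip: matrix_vector_mul_assoc)
    ultimately show ?thesis by simp
  qed
  then obtain c where "\<And>s. ?\<psi> s = c"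
    using has_vector_derivative_zero_constant[of UNIV ?\<psi>] by auto
  from this[of s] this[of 0] show ?thesis by simp
qed

lemma mexp_uminus_left: "mexp (- (s *\<^sub>R M)) *v (mexp (s *\<^sub>R M) *v v) = v"
  using mexp_uminus_cancel_ode[where \<phi> = "\<lambda>s. mexp (s *\<^sub>R M) *v v",
      OF mexp_mult_vec_has_vector_derivative, of s] by simp

lemma mexp_uminus_right: "mexp (s *\<^sub>R M) *v (mexp (- (s *\<^sub>R M)) *v v) = v"
  using mexp_uminus_left[of "- s" M v] by simp

lemma linear_ode_solution:
  assumes "\<And>s. (\<phi> has_vector_derivative M *v \<phi> s) (at s)"
  shows "\<phi> s = mexp (s *\<^sub>R M) *v \<phi> 0"
  using mexp_uminus_right[of s M "\<phi> s"] mexp_uminus_cancel_ode[OF assms, of s] by simp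

lemma mexp_add: "mexp ((s + t) *\<^sub>R M) *v v = mexp (s *\<^sub>R M) *v (mexp (t *\<^sub>R M) *v v)"
proof -
  have "((\<lambda>s. mexp ((s + t) *\<^sub>R M) *v v) has_vector_derivative M *v (mexp ((s + t) *\<^sub>R M) *v v)) (at s)" for s
  proof -
    have "((\<lambda>s. s + t) has_vector_derivative 1) (at s)"
      by (auto intro!: derivative_eq_intros)
    from vector_diff_chain_at[OF this mexp_mult_vec_has_vector_derivative[of M v]]
    show ?thesis by (simp add: o_def)
  qed
  from linear_ode_solution[OF this, of s] show ?thesis by simp
qed

text \<open>The two sides solve the same linear equation in \<open>s\<close>.\<close>

lemma mexp_intertwine:
  fixes A :: "real^'n^'m"
  assumes "A ** G = G' ** A + \<mu> *\<^sub>R A"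
  shows "A *v (mexp (s *\<^sub>R G) *v v) = exp (\<mu> * s) *\<^sub>R (mexp (s *\<^sub>R G') *v (A *v v))"
proof -
  let ?\<phi> = "\<lambda>s. exp (- \<mu> * s) *\<^sub>R (A *v (mexp (s *\<^sub>R G) *v v))"
  have "(?\<phi> has_vector_derivative G' *v ?\<phi> s) (at s)" for s
  proof -
    have AG: "A *v (G *v w) = G' *v (A *v w) + \<mu> *\<^sub>R (A *v w)" for w
      using arg_cong[OF assms, of "\<lambda>X. X *v w"]
      by (simp add: matrix_vector_mul_assoc matrix_vector_mult_add_rdistrib scaleR_matrix_vector_assoc)
    have "((\<lambda>s. A *v (mexp (s *\<^sub>R G) *v v)) has_vector_derivative
        A *v (G *v (mexp (s *\<^sub>R G) *v v))) (at s)"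
      by (rule bounded_linear.has_vector_derivative[OF matrix_vector_mul_bounded_linear
          mexp_mult_vec_has_vector_derivative])
    moreover have "((\<lambda>s. exp (- \<mu> * s)) has_real_derivative - \<mu> * exp (- \<mu> * s)) (at s)"
      by (auto intro!: derivative_eq_intros)
    ultimately have "(?\<phi> has_vector_derivative exp (- \<mu> * s) *\<^sub>R (A *v (G *v (mexp (s *\<^sub>R G) *v v)))
        + (- \<mu> * exp (- \<mu> * s)) *\<^sub>R (A *v (mexp (s *\<^sub>R G) *v v))) (at s)"
      using has_vector_derivative_scaleR by blast
    then show ?thesis
      by (simp add: AG scaleR_add_right matrix_vector_mult_scaleR mult.commute)
  qed
  from linear_ode_solution[OF this, of s]
  have "exp (- \<mu> * s) *\<^sub>R (A *v (mexp (s *\<^sub>R G) *v v)) = mexp (s *\<^sub>R G') *v (A *v v)" by simp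
  from arg_cong[OF this, of "\<lambda>x. exp (\<mu> * s) *\<^sub>R x"] show ?thesis
    by (simp flip: exp_add)
qed

section \<open>Weighted inner products and canonical homogeneous norms\<close>

definition wip :: "real^'n^'n \<Rightarrow> real^'n \<Rightarrow> real^'n \<Rightarrow> real" where
  "wip P v w = v \<bullet> (P *v w)"

lemma bounded_bilinear_wip: "bounded_bilinear (wip P)"
  unfolding bilinear_conv_bounded_bilinear[symmetric] bilinear_def linear_iff wip_def
  by (simp add: inner_add_left inner_add_right matrix_vector_right_distrib matrix_vector_mult_scaleR)

lemmas wip_bilin = bounded_bilinear.add_left[OF bounded_bilinear_wip]
  bounded_bilinear.add_right[OF bounded_bilinear_wip]
  bounded_bilinear.diff_left[OF bounded_bilinear_wip]
  bounded_bilinear.diff_right[OF bounded_bilinear_wip]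
  bounded_bilinear.minus_left[OF bounded_bilinear_wip]
  bounded_bilinear.minus_right[OF bounded_bilinear_wip]
  bounded_bilinear.scaleR_left[OF bounded_bilinear_wip]
  bounded_bilinear.scaleR_right[OF bounded_bilinear_wip]
  bounded_bilinear.zero_left[OF bounded_bilinear_wip]
  bounded_bilinear.zero_right[OF bounded_bilinear_wip]
  bounded_bilinear.sum_left[OF bounded_bilinear_wip]
  bounded_bilinear.sum_right[OF bounded_bilinear_wip]

lemma continuous_on_wip [continuous_intros]:
  "continuous_on S f \<Longrightarrow> continuous_on S g \<Longrightarrow> continuous_on S (\<lambda>x. wip P (f x) (g x))"
  by (rule bounded_bilinear.continuous_on[OF bounded_bilinear_wip])

lemma weighted_norm_wip: "weighted_norm P v = sqrt (wip P v v)"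
  by (simp add: weighted_norm_def wip_def)

text \<open>Translates the matrix inequalities into bounds on \<open>wip P v (M *v v)\<close>, the
  form in which derivatives of the weighted norm along a flow appear.\<close>

lemma wip_adjoint_form: "v \<bullet> ((P ** M + transpose M ** P) *v v) = 2 * wip P v (M *v v)"
  if "transpose P = P"
proof -
  have "v \<bullet> ((transpose M ** P) *v v) = (P *v v) \<bullet> (M *v v)"
    by (metis dot_lmul_matrix inner_commute matrix_vector_mul_assoc transpose_matrix_vector)
  also have "\<dots> = v \<bullet> (P *v (M *v v))"
    by (metis dot_lmul_matrix that transpose_matrix_vector)
  finally show ?thesis
    by (simp add: wip_def matrix_vector_mult_add_rdistrib inner_add_right matrix_vector_mul_assoc)
qed

context
  fixes P :: "real^'n^'n"
  assumes P: "pos_def P"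
begin

lemma pos_def_transpose: "transpose P = P"
  using P by (simp add: pos_def_on_def transpose_def vec_eq_iff)

lemma wip_commute: "wip P v w = wip P w v"
  by (metis pos_def_transpose dot_lmul_matrix inner_commute transpose_matrix_vector wip_def)

lemma wip_pos: "v \<noteq> 0 \<Longrightarrow> wip P v v > 0"
  using P by (simp add: pos_def_on_def wip_def)

lemma wip_nonneg: "wip P v v \<ge> 0"
  using wip_pos[of v] by (cases "v = 0") (auto simp: wip_bilin)

lemma wip_eq_0_iff: "wip P v v = 0 \<longleftrightarrow> v = 0"
  using wip_pos[of v] by (cases "v = 0") (auto simp: wip_bilin)

lemma weighted_norm_nonneg: "weighted_norm P v \<ge> 0"
  by (simp add: weighted_norm_wip wip_nonneg)

lemma weighted_norm_square: "(weighted_norm P v)\<^sup>2 = wip P v v"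
  by (simp add: weighted_norm_wip wip_nonneg)

lemma weighted_norm_pos: "v \<noteq> 0 \<Longrightarrow> weighted_norm P v > 0"
  by (simp add: weighted_norm_wip wip_pos)

lemma weighted_norm_scaleR: "weighted_norm P (c *\<^sub>R v) = \<bar>c\<bar> * weighted_norm P v"
  by (simp add: weighted_norm_wip wip_bilin real_sqrt_mult flip: mult.assoc)

lemma wip_Cauchy_Schwarz: "\<bar>wip P v w\<bar> \<le> weighted_norm P v * weighted_norm P w"
proof (cases "w = 0")
  case True
  then show ?thesis by (simp add: wip_bilin weighted_norm_wip)
next
  case False
  define t where "t = wip P v w / wip P w w"
  have w: "wip P w w > 0" using False by (rule wip_pos)
  have "0 \<le> wip P (v - t *\<^sub>R w) (v - t *\<^sub>R w)" by (rule wip_nonneg)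
  also have "\<dots> = wip P v v - 2 * t * wip P v w + t * t * wip P w w"
    by (simp add: wip_bilin wip_commute[of w v] algebra_simps)
  also have "\<dots> = wip P v v - (wip P v w)\<^sup>2 / wip P w w"
    using w by (simp add: t_def power2_eq_square field_simps)
  finally have "(wip P v w)\<^sup>2 \<le> wip P v v * wip P w w"
    using w by (simp add: field_simps)
  then have "sqrt ((wip P v w)\<^sup>2) \<le> sqrt (wip P v v * wip P w w)"
    by (rule real_sqrt_le_mono)
  then show ?thesis by (simp add: weighted_norm_wip real_sqrt_mult)
qed

lemma weighted_norm_le_norm: obtains c where "c > 0" "\<And>v. weighted_norm P v \<le> c * norm v"
proof -
  obtain K where K: "K > 0" "\<And>v w. norm (wip P v w) \<le> norm v * norm w * K"
    using bounded_bilinear.pos_bounded[OF bounded_bilinear_wip] by blast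
  have "weighted_norm P v \<le> sqrt K * norm v" for v
  proof -
    have "sqrt (wip P v v) \<le> sqrt ((norm v)\<^sup>2 * K)"
      using K(2)[of v v] by (intro real_sqrt_le_mono) (simp add: power2_eq_square)
    then show ?thesis by (simp add: weighted_norm_wip real_sqrt_mult mult.commute)
  qed
  then show thesis using that[of "sqrt K"] K(1) by simp
qed

lemma norm_le_weighted_norm: obtains c where "c > 0" "\<And>v. norm v \<le> c * weighted_norm P v"
proof -
  have "continuous_on (sphere 0 1) (weighted_norm P)"
    unfolding weighted_norm_wip[abs_def] by (intro continuous_intros)
  moreover have "sphere (0 :: real^'n) 1 \<noteq> {}" by simp
  ultimately obtain u where u: "u \<in> sphere 0 1" "\<And>v. v \<in> sphere 0 1 \<Longrightarrow> weighted_norm P u \<le> weighted_norm P v"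
    using continuous_attains_inf[OF compact_sphere] by metis
  have pos: "weighted_norm P u > 0" using u(1) by (intro weighted_norm_pos) auto
  have "norm v \<le> (1 / weighted_norm P u) * weighted_norm P v" for v
  proof (cases "v = 0")
    case False
    have "weighted_norm P u \<le> weighted_norm P ((1 / norm v) *\<^sub>R v)"
      using False by (intro u(2)) simp
    then show ?thesis using False pos by (simp add: weighted_norm_scaleR field_simps)
  qed (simp add: weighted_norm_nonneg pos less_imp_le)
  then show thesis using that[of "1 / weighted_norm P u"] pos by simp
qed

lemma wip_matrix_bound: obtains c where "c > 0" "\<And>v. \<bar>wip P v (M *v v)\<bar> \<le> c * wip P v v"
proof -
  obtain K where K: "K > 0" "\<And>v w. norm (wip (P ** M) v w) \<le> norm v * norm w * K"
    using bounded_bilinear.pos_bounded[OF bounded_bilinear_wip] by blast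
  obtain c where c: "c > 0" "\<And>v. norm v \<le> c * weighted_norm P v" by (rule norm_le_weighted_norm) blast
  have "\<bar>wip P v (M *v v)\<bar> \<le> (c\<^sup>2 * K) * wip P v v" for v
  proof -
    have "\<bar>wip P v (M *v v)\<bar> \<le> (norm v)\<^sup>2 * K"
      using K(2)[of v v] by (simp add: wip_def matrix_vector_mul_assoc power2_eq_square)
    also have "\<dots> \<le> (c * weighted_norm P v)\<^sup>2 * K"
      using c(2) K(1) by (intro mult_right_mono power_mono) auto
    finally show ?thesis by (simp add: power_mult_distrib weighted_norm_square mult_ac)
  qed
  then show thesis using that[of "c\<^sup>2 * K"] c K(1) by simp
qed

section \<open>Growth of the weighted norm along a linear flow\<close>

lemma wip_flow_has_derivative:
  "((\<lambda>s. wip P (mexp (s *\<^sub>R M) *v v) (mexp (s *\<^sub>R M) *v v)) has_real_derivative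
    2 * wip P (mexp (s *\<^sub>R M) *v v) (M *v (mexp (s *\<^sub>R M) *v v))) (at s)"
  using bounded_bilinear.has_vector_derivative[OF bounded_bilinear_wip[of P]
      mexp_mult_vec_has_vector_derivative[of M v s] mexp_mult_vec_has_vector_derivative[of M v s]]
    wip_commute[of "M *v (mexp (s *\<^sub>R M) *v v)" "mexp (s *\<^sub>R M) *v v"]
  by (simp add: has_real_derivative_iff_has_vector_derivative)

text \<open>Gronwall's argument for the squared norm, whose derivative is at most
  \<open>2 (a + k)\<close> times itself. The two-sided hypothesis serves negative \<open>s\<close>,
  where the estimate is applied to \<open>- M\<close> and \<open>- a\<close>.\<close>

lemma weighted_norm_mexp_upper:
  assumes M: "\<And>v. \<bar>wip P v (M *v v) - a * wip P v v\<bar> \<le> k * wip P v v"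
  shows "weighted_norm P (mexp (s *\<^sub>R M) *v v) \<le> exp (a * s + k * \<bar>s\<bar>) * weighted_norm P v"
proof -
  have *: "weighted_norm P (mexp (s *\<^sub>R M) *v v) \<le> exp ((a + k) * s) * weighted_norm P v"
    if "s \<ge> 0" and M: "\<And>v. wip P v (M *v v) \<le> (a + k) * wip P v v" for a s M
  proof -
    let ?w = "\<lambda>s. wip P (mexp (s *\<^sub>R M) *v v) (mexp (s *\<^sub>R M) *v v)"
    define c where "c = 2 * (a + k)"
    have "exp (- (c * s)) * ?w s \<le> exp (- (c * 0)) * ?w 0"
    proof (rule DERIV_nonpos_imp_nonincreasing[OF \<open>s \<ge> 0\<close>])
      fix r
      have "((\<lambda>s. exp (- (c * s)) * ?w s) has_real_derivative
          exp (- (c * r)) * (2 * wip P (mexp (r *\<^sub>R M) *v v) (M *v (mexp (r *\<^sub>R M) *v v)) - c * ?w r)) (at r)"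
        by (auto intro!: derivative_eq_intros wip_flow_has_derivative simp: algebra_simps)
      moreover have "exp (- (c * r)) * (2 * wip P (mexp (r *\<^sub>R M) *v v) (M *v (mexp (r *\<^sub>R M) *v v)) - c * ?w r) \<le> 0"
        using M[of "mexp (r *\<^sub>R M) *v v"] by (intro mult_nonneg_nonpos) (auto simp: c_def algebra_simps)
      ultimately show "\<exists>y. ((\<lambda>s. exp (- (c * s)) * ?w s) has_real_derivative y) (at r) \<and> y \<le> 0"
        by blast
    qed
    then have "?w s \<le> exp (c * s) * wip P v v"
      by (simp add: exp_minus field_simps)
    then have "?w s \<le> exp (2 * ((a + k) * s)) * wip P v v"
      by (simp only: c_def mult.assoc)
    then have "?w s \<le> (exp ((a + k) * s))\<^sup>2 * wip P v v"
      by (simp add: exp_double)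
    from real_sqrt_le_mono[OF this] show ?thesis
      by (simp add: weighted_norm_wip real_sqrt_mult)
  qed
  show ?thesis
  proof (cases "s \<ge> 0")
    case True
    have "wip P v (M *v v) \<le> (a + k) * wip P v v" for v
      using M[of v] by (simp add: algebra_simps)
    from *[OF True this] True show ?thesis by (simp add: algebra_simps)
  next
    case False
    have "wip P v (- M *v v) \<le> (- a + k) * wip P v v" for v
    proof -
      have "wip P v (- M *v v) = - wip P v (M *v v)"
        using scaleR_matrix_vector_assoc[of "-1" M v] by (simp add: wip_bilin flip: wip_bilin(6))
      then show ?thesis
        using M[of v] by (simp add: algebra_simps)
    qed
    from *[of "- s" "- M" "- a", OF _ this] False show ?thesis by (simp add: algebra_simps)
  qed
qed

text \<open>The upper bound for the reversed flow, which carries the moved vector back to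
  \<open>v\<close>.\<close>

lemma weighted_norm_mexp_lower:
  assumes M: "\<And>v. \<bar>wip P v (M *v v) - a * wip P v v\<bar> \<le> k * wip P v v"
  shows "exp (a * s - k * \<bar>s\<bar>) * weighted_norm P v \<le> weighted_norm P (mexp (s *\<^sub>R M) *v v)"
proof -
  have "weighted_norm P v \<le> exp (- a * s + k * \<bar>s\<bar>) * weighted_norm P (mexp (s *\<^sub>R M) *v v)"
    using weighted_norm_mexp_upper[OF M, of "- s" "mexp (s *\<^sub>R M) *v v"] by (simp add: mexp_uminus_left)
  then have "exp (a * s - k * \<bar>s\<bar>) * weighted_norm P v
      \<le> exp (a * s - k * \<bar>s\<bar>) * (exp (- a * s + k * \<bar>s\<bar>) * weighted_norm P (mexp (s *\<^sub>R M) *v v))"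
    by (intro mult_left_mono) auto
  also have "\<dots> = weighted_norm P (mexp (s *\<^sub>R M) *v v)"
    by (simp flip: mult.assoc exp_add)
  finally show ?thesis .
qed

end

text \<open>\<open>hom_norm\<close> is a definite description, so existence and uniqueness of the
  level come before any use. Growth at rate at least 1/2 gives strict monotonicity, hence
  uniqueness, and drives the norm across 1, hence existence.\<close>

lemma hom_norm_normalises:
  assumes "x \<noteq> 0" and pos: "\<And>s. nrm (d s *v x) > 0"
    and mono: "\<And>s t. s < t \<Longrightarrow> exp ((t - s) / 2) * nrm (d s *v x) \<le> nrm (d t *v x)"
    and cont: "continuous_on UNIV (\<lambda>s. nrm (d s *v x))"
  shows "hom_norm nrm d x > 0" "nrm (d (- ln (hom_norm nrm d x)) *v x) = 1"
    and "\<And>s. nrm (d (- s) *v x) = 1 \<Longrightarrow> hom_norm nrm d x = exp s"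
proof -
  define \<psi> where "\<psi> s = nrm (d (- s) *v x)" for s
  have dec: "exp ((t - s) / 2) * \<psi> t \<le> \<psi> s" if "s < t" for s t
    using mono[of "- t" "- s"] that by (simp add: \<psi>_def)
  have \<psi>_pos: "\<psi> s > 0" for s by (simp add: \<psi>_def pos)
  have strict: "\<psi> t < \<psi> s" if "s < t" for s t
  proof -
    have "1 * \<psi> t < exp ((t - s) / 2) * \<psi> t"
      using that \<psi>_pos by (intro mult_strict_right_mono) auto
    then show ?thesis using dec[OF that] by simp
  qed
  \<comment> \<open>Over a time \<open>T\<close> the guaranteed factor \<open>exp (T / 2)\<close>
    outweighs both \<open>\<psi> 0\<close> and its inverse, so 1 is crossed in
    \<open>{- T..T}\<close>; the summand 1 keeps \<open>T\<close> positive when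
    \<open>\<psi> 0 = 1\<close>.\<close>
  define T where "T = 2 * \<bar>ln (\<psi> 0)\<bar> + 1"
  have "T > 0" by (simp add: T_def)
  have T: "ln (\<psi> 0) \<le> T / 2" "- ln (\<psi> 0) \<le> T / 2"
    using abs_ge_self[of "ln (\<psi> 0)"] abs_ge_minus_self[of "ln (\<psi> 0)"] by (simp_all add: T_def add_divide_distrib)
  have p: "\<psi> 0 = exp (ln (\<psi> 0))" using \<psi>_pos by simp
  have "exp (T / 2) * \<psi> T \<le> exp (T / 2)"
  proof -
    have "exp (T / 2) * \<psi> T \<le> exp (ln (\<psi> 0))" using dec[of 0 T] \<open>T > 0\<close> p by simp
    also have "\<dots> \<le> exp (T / 2)" unfolding exp_le_cancel_iff by (rule T)
    finally show ?thesis .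
  qed
  then have T1: "\<psi> T \<le> 1" by simp
  have "1 \<le> exp (T / 2 + ln (\<psi> 0))" unfolding one_le_exp_iff using T(2) by linarith
  also have "\<dots> \<le> \<psi> (- T)" using dec[of "- T" 0] \<open>T > 0\<close> \<psi>_pos by (simp add: exp_add)
  finally have T2: "\<psi> (- T) \<ge> 1" .
  have cont_\<psi>: "continuous_on {- T..T} \<psi>"
    unfolding \<psi>_def by (intro continuous_on_compose2[OF cont, of _ uminus] continuous_intros) auto
  have "\<exists>x\<ge>- T. x \<le> T \<and> \<psi> x = 1"
    by (rule IVT2'[OF T1 T2 _ cont_\<psi>]) (use \<open>T > 0\<close> in simp)
  then obtain s0 where s0: "\<psi> s0 = 1" by blast
  have uniq: "s = s0" if "\<psi> s = 1" for s
    using strict[of s s0] strict[of s0 s] that s0 by (cases s s0 rule: linorder_cases) auto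
  have "(THE s. \<psi> s = 1) = s0"
    by (rule the_equality) (rule s0, rule uniq)
  then have h: "hom_norm nrm d x = exp s0"
    using \<open>x \<noteq> 0\<close> by (simp add: hom_norm_def \<psi>_def)
  show "hom_norm nrm d x > 0" by (simp add: h)
  show "nrm (d (- ln (hom_norm nrm d x)) *v x) = 1" using s0 by (simp add: h \<psi>_def)
  show "hom_norm nrm d x = exp s" if "nrm (d (- s) *v x) = 1" for s
    unfolding h using uniq[of s] that by (simp add: \<psi>_def)
qed

lemma continuous_on_mexp: "continuous_on S (\<lambda>s. mexp (s *\<^sub>R M))"
  by (intro continuous_at_imp_continuous_on ballI has_vector_derivative_continuous[OF mexp_has_vector_derivative])

lemma continuous_on_mexp_mult_vec:
  fixes f :: "'a::topological_space \<Rightarrow> real"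
  assumes "continuous_on S f" "continuous_on S g"
  shows "continuous_on S (\<lambda>x. mexp (f x *\<^sub>R M) *v g x)"
  by (rule bounded_bilinear.continuous_on[OF bounded_bilinear_matrix_vector_mult
        continuous_on_compose2[OF continuous_on_mexp[of UNIV] assms(1)] assms(2)]) simp

section \<open>Distance of a matrix exponential from the identity\<close>

lemma weighted_norm_mat_1: "weighted_norm (mat 1) v = norm v"
  by (simp add: weighted_norm_def norm_eq_sqrt_inner)

lemma pos_def_mat_1: "pos_def (mat 1 :: real^'n^'n)"
  unfolding pos_def_on_def by simp (auto simp: mat_def)

lemma norm_mexp_le:
  assumes M: "\<And>v. norm (M *v v) \<le> K * norm v"
  shows "norm (mexp (s *\<^sub>R M) *v v) \<le> exp (K * \<bar>s\<bar>) * norm v"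
proof -
  have "\<bar>wip (mat 1) v (M *v v) - 0 * wip (mat 1) v v\<bar> \<le> K * wip (mat 1) v v" for v
  proof -
    have "\<bar>v \<bullet> (M *v v)\<bar> \<le> norm v * norm (M *v v)" by (rule Cauchy_Schwarz_ineq2)
    also have "\<dots> \<le> norm v * (K * norm v)" by (intro mult_left_mono M) simp
    finally show ?thesis by (simp add: wip_def power2_norm_eq_inner[symmetric] power2_eq_square mult_ac)
  qed
  from weighted_norm_mexp_upper[OF pos_def_mat_1 this, of s v] show ?thesis
    by (simp add: weighted_norm_mat_1)
qed

text \<open>Mean value inequality along the flow. The factor \<open>\<bar>s\<bar>\<close> makes the
  deviation of the injection gain small with \<open>\<mu>\<close>, since there the time is
  \<open>\<mu>\<close> times a logarithm.\<close>

lemma norm_mexp_diff_le: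
  assumes M: "\<And>v. norm (M *v v) \<le> K * norm v" and "K \<ge> 0"
  shows "norm (mexp (s *\<^sub>R M) *v v - v) \<le> K * \<bar>s\<bar> * exp (K * \<bar>s\<bar>) * norm v"
proof -
  have "norm (mexp (s *\<^sub>R M) *v v - mexp (0 *\<^sub>R M) *v v) \<le> (K * (exp (K * \<bar>s\<bar>) * norm v)) * norm (s - 0)"
  proof (rule differentiable_bound[of "{- \<bar>s\<bar>..\<bar>s\<bar>}"])
    fix r assume r: "r \<in> {- \<bar>s\<bar>..\<bar>s\<bar>}"
    show "((\<lambda>s. mexp (s *\<^sub>R M) *v v) has_derivative (\<lambda>h. h *\<^sub>R (M *v (mexp (r *\<^sub>R M) *v v)))) (at r within {- \<bar>s\<bar>..\<bar>s\<bar>})"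
      by (rule mexp_mult_vec_has_vector_derivative[unfolded has_vector_derivative_def,
            THEN has_derivative_at_withinI])
    have "norm (M *v (mexp (r *\<^sub>R M) *v v)) \<le> K * (exp (K * \<bar>s\<bar>) * norm v)"
    proof -
      have "norm (mexp (r *\<^sub>R M) *v v) \<le> exp (K * \<bar>r\<bar>) * norm v" by (rule norm_mexp_le[OF M])
      also have "\<dots> \<le> exp (K * \<bar>s\<bar>) * norm v"
        using r \<open>K \<ge> 0\<close> by (intro mult_right_mono) (auto intro!: mult_left_mono)
      finally show ?thesis
        using M[of "mexp (r *\<^sub>R M) *v v"] \<open>K \<ge> 0\<close> by (meson mult_left_mono order_trans)
    qed
    then show "onorm (\<lambda>h. h *\<^sub>R (M *v (mexp (r *\<^sub>R M) *v v))) \<le> K * (exp (K * \<bar>s\<bar>) * norm v)"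
      by (intro onorm_le) (simp add: mult.commute mult_left_mono)
  qed auto
  then show ?thesis by (simp add: mult_ac)
qed

lemma exp_minus_one_le: "exp x - 1 \<le> x * exp (x :: real)"
proof -
  have "exp x * (1 - x) \<le> exp x * exp (- x)"
    using exp_ge_add_one_self[of "- x"] by (intro mult_left_mono) auto
  then show ?thesis by (simp add: exp_minus algebra_simps)
qed

lemma abs_exp_minus_one_le: "\<bar>exp x - 1\<bar> \<le> \<bar>x\<bar> * exp \<bar>x :: real\<bar>"
proof (cases "x \<ge> 0")
  case True
  then show ?thesis using exp_minus_one_le[of x] by simp
next
  case False
  then have "1 - exp x \<le> \<bar>x\<bar>"
    using exp_ge_add_one_self[of x] by linarith
  moreover have "\<bar>x\<bar> * 1 \<le> \<bar>x\<bar> * exp \<bar>x\<bar>"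
    by (intro mult_left_mono) auto
  moreover have "\<bar>exp x - 1\<bar> = 1 - exp x" using False by simp
  ultimately show ?thesis by linarith
qed

text \<open>The two summands belong to the two signs of \<open>s\<close> in
  \<open>\<bar>s\<bar> exp (\<epsilon> \<bar>s\<bar>) exp s\<close>: for negative \<open>s\<close>
  and \<open>\<epsilon> \<le> 1/2\<close> this is at most
  \<open>\<bar>s\<bar> exp (- \<bar>s\<bar> / 2) \<le> 2\<close>, and on \<open>[0, S]\<close> the
  exponents add up to at most \<open>2 \<bar>S\<bar>\<close>.\<close>

definition log_bound :: "real \<Rightarrow> real" where
  "log_bound S = 2 + \<bar>S\<bar> * exp (2 * \<bar>S\<bar>)"

lemma log_bound_pos: "log_bound S > 0"
  unfolding log_bound_def by (intro add_pos_nonneg) auto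

text \<open>The error of replacing an exponent close to 1 by 1 is small uniformly down to \<open>e\<^sup>s = 0\<close>.\<close>

lemma log_boundI:
  assumes "\<epsilon> \<le> 1 / 2" "s \<le> S" "\<epsilon> \<ge> 0"
  shows "\<bar>s\<bar> * exp (\<epsilon> * \<bar>s\<bar>) * exp s \<le> log_bound S"
proof (cases "s \<ge> 0")
  case True
  have "\<epsilon> * \<bar>s\<bar> + s \<le> 2 * \<bar>S\<bar>"
    using assms True mult_right_mono[of \<epsilon> "1/2" "\<bar>s\<bar>"] by linarith
  then have "\<bar>s\<bar> * exp (\<epsilon> * \<bar>s\<bar> + s) \<le> \<bar>S\<bar> * exp (2 * \<bar>S\<bar>)"
    using assms True by (intro mult_mono) auto
  then show ?thesis by (simp add: log_bound_def exp_add mult.assoc)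
next
  case False
  define x where "x = \<bar>s\<bar>"
  have x: "x \<ge> 0" "s = - x" using False by (auto simp: x_def)
  have "\<epsilon> * x \<le> x / 2" using assms x mult_right_mono[of \<epsilon> "1/2" x] by simp
  then have "exp (\<epsilon> * x + s) \<le> exp (- (x / 2))" using x by simp
  then have "x * exp (\<epsilon> * x + s) \<le> x * exp (- (x / 2))" using x by (intro mult_left_mono) auto
  also have "\<dots> \<le> (2 * exp (x / 2)) * exp (- (x / 2))"
  proof (rule mult_right_mono)
    show "x \<le> 2 * exp (x / 2)" using exp_ge_add_one_self[of "x / 2"] by linarith
  qed simp
  also have "\<dots> = 2" by (simp flip: exp_add)
  also have "\<dots> \<le> log_bound S" by (simp add: log_bound_def)
  finally show ?thesis by (simp add: x_def exp_add mult.assoc)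
qed

text \<open>\<open>mu_kappa\<close> keeps the generator within 1/2 of the identity, as quadratic
  forms relative to \<open>Pa\<close>, so the dilation expands at rates between 1/2 and 3/2. This
  makes it monotone and measures how far it is from the uniform dilation
  \<open>exp s\<close>.\<close>

locale weighted_dilation =
  fixes Pa G0 :: "real^'n^'n" and \<mu> \<kappa> :: real
  assumes Pa: "pos_def Pa"
    and G0_bound: "\<And>v. \<bar>wip Pa v (G0 *v v)\<bar> \<le> \<kappa> * wip Pa v v"
    and mu_kappa: "\<bar>\<mu>\<bar> * \<kappa> \<le> 1 / 2" and kappa: "\<kappa> \<ge> 0"
begin

abbreviation N :: "real^'n \<Rightarrow> real" where "N \<equiv> weighted_norm Pa"
abbreviation D :: "real \<Rightarrow> real^'n^'n" where "D \<equiv> dil \<mu> G0"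
abbreviation hn :: "real^'n \<Rightarrow> real" where "hn \<equiv> node_norm \<mu> G0 Pa"
abbreviation k :: real where "k \<equiv> \<bar>\<mu>\<bar> * \<kappa>"

lemma k_nonneg: "k \<ge> 0"
  using kappa by simp

lemma dil_gen_mult: "dil_gen \<mu> G0 *v v = \<mu> *\<^sub>R (G0 *v v) + v"
  by (simp add: dil_gen_def matrix_vector_mult_add_rdistrib scaleR_matrix_vector_assoc)

lemma dil_gen_bound: "\<bar>wip Pa v (dil_gen \<mu> G0 *v v) - 1 * wip Pa v v\<bar> \<le> k * wip Pa v v"
  using mult_left_mono[OF G0_bound[of v], of "\<bar>\<mu>\<bar>"]
  by (simp add: dil_gen_mult wip_bilin abs_mult mult.assoc)

lemma dil_upper: "N (D s *v v) \<le> exp (s + k * \<bar>s\<bar>) * N v"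
  using weighted_norm_mexp_upper[OF Pa dil_gen_bound, of s v] by (simp add: dil_def)

lemma dil_lower: "exp (s - k * \<bar>s\<bar>) * N v \<le> N (D s *v v)"
  using weighted_norm_mexp_lower[OF Pa dil_gen_bound, of s v] by (simp add: dil_def)

lemma dil_add: "D (s + t) *v v = D s *v (D t *v v)"
  by (simp only: dil_def mexp_add)

lemma dil_0 [simp]: "D 0 = mat 1"
  by (simp add: dil_def)

lemma dil_cancel [simp]: "D (- s) *v (D s *v v) = v" "D s *v (D (- s) *v v) = v"
  by (simp_all flip: dil_add)

lemma dil_eq_0_iff [simp]: "D s *v v = 0 \<longleftrightarrow> v = 0"
  by (metis dil_cancel(1) matrix_vector_mult_0_right)

lemma continuous_on_dil:
  fixes f :: "'a::topological_space \<Rightarrow> real"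
  shows "continuous_on S f \<Longrightarrow> continuous_on S g \<Longrightarrow> continuous_on S (\<lambda>x. D (f x) *v g x)"
  unfolding dil_def by (rule continuous_on_mexp_mult_vec)

lemma continuous_on_N: "continuous_on S f \<Longrightarrow> continuous_on S (\<lambda>x. N (f x))"
  unfolding weighted_norm_wip by (intro continuous_intros)

lemma dil_strict_mono:
  assumes "s < t" shows "exp ((t - s) / 2) * N (D s *v v) \<le> N (D t *v v)"
proof -
  have "k * d \<le> 1 / 2 * d" if "d > 0" for d
    by (intro mult_right_mono mu_kappa) (use that in simp)
  then have *: "d / 2 \<le> d - k * \<bar>d\<bar>" if "d > 0" for d
    using that by fastforce
  have "(t - s) / 2 \<le> (t - s) - k * \<bar>t - s\<bar>"
    by (rule *) (use assms in simp)
  then have "exp ((t - s) / 2) * N (D s *v v) \<le> exp ((t - s) - k * \<bar>t - s\<bar>) * N (D s *v v)"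
    by (intro mult_right_mono weighted_norm_nonneg Pa) simp
  also have "\<dots> \<le> N (D (t - s) *v (D s *v v))" by (rule dil_lower)
  also have "\<dots> = N (D t *v v)" by (simp flip: dil_add)
  finally show ?thesis .
qed

lemma node_norm_0 [simp]: "hn 0 = 0"
  by (simp add: node_norm_def hom_norm_def)

lemma node_norm_normalises:
  assumes "v \<noteq> 0"
  shows node_norm_pos: "hn v > 0" and node_norm_unit: "N (D (- ln (hn v)) *v v) = 1"
    and node_norm_unique: "\<And>s. N (D (- s) *v v) = 1 \<Longrightarrow> hn v = exp s"
proof -
  have c: "continuous_on UNIV (\<lambda>s. N (D s *v v))"
    by (rule continuous_on_N, rule continuous_on_dil) (rule continuous_on_id, rule continuous_on_const)
  have p: "N (D s *v v) > 0" for s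
    using assms by (intro weighted_norm_pos[OF Pa]) simp
  show "hn v > 0" "N (D (- ln (hn v)) *v v) = 1" "\<And>s. N (D (- s) *v v) = 1 \<Longrightarrow> hn v = exp s"
    unfolding node_norm_def
    by (rule hom_norm_normalises[of v N D, OF assms p dil_strict_mono c]; assumption)+
qed

lemma node_norm_dil: "hn (D s *v v) = exp s * hn v"
proof (cases "v = 0")
  case False
  have "N (D (- (s + ln (hn v))) *v (D s *v v)) = 1"
    using node_norm_unit[OF False] by (simp flip: dil_add)
  then have "hn (D s *v v) = exp (s + ln (hn v))"
    using False by (intro node_norm_unique) auto
  then show ?thesis using node_norm_pos[OF False] by (simp add: exp_add)
qed (simp add: matrix_vector_mult_0_right)

text \<open>\<open>v\<close> is the dilation by \<open>ln (hn v)\<close> of a unit vector, so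
  \<open>dil_lower\<close> and \<open>dil_upper\<close> compare the two norms on the logarithmic
  scale with relative error \<open>k\<close>, which is of order \<open>\<mu>\<close>;
  \<open>k \<le> 1/2\<close> turns this into a bound by \<open>N v\<close> alone.\<close>

lemma ln_node_norm_bounds:
  assumes "v \<noteq> 0"
  shows "\<bar>ln (hn v) - ln (N v)\<bar> \<le> k * \<bar>ln (hn v)\<bar>" "\<bar>ln (hn v)\<bar> \<le> 2 * \<bar>ln (N v)\<bar>"
proof -
  define \<sigma> where "\<sigma> = ln (hn v)"
  have u: "N (D (- \<sigma>) *v v) = 1" using node_norm_unit[OF assms] by (simp add: \<sigma>_def)
  have v: "N v > 0" using assms by (rule weighted_norm_pos[OF Pa])
  have "exp (\<sigma> - k * \<bar>\<sigma>\<bar>) \<le> N v" "N v \<le> exp (\<sigma> + k * \<bar>\<sigma>\<bar>)"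
    using dil_lower[of \<sigma> "D (- \<sigma>) *v v"] dil_upper[of \<sigma> "D (- \<sigma>) *v v"] u by simp_all
  then have "\<sigma> - k * \<bar>\<sigma>\<bar> \<le> ln (N v)" "ln (N v) \<le> \<sigma> + k * \<bar>\<sigma>\<bar>"
    using v ln_le_cancel_iff[of "N v" "exp (\<sigma> + k * \<bar>\<sigma>\<bar>)"] by (simp_all add: ln_ge_iff)
  then show 1: "\<bar>ln (hn v) - ln (N v)\<bar> \<le> k * \<bar>ln (hn v)\<bar>"
    by (simp add: \<sigma>_def abs_le_iff)
  show "\<bar>ln (hn v)\<bar> \<le> 2 * \<bar>ln (N v)\<bar>"
    using 1 mult_right_mono[OF mu_kappa, of "\<bar>ln (hn v)\<bar>"] by linarith
qed

text \<open>Dilating \<open>v0\<close> by \<open>- \<sigma> - e\<close> and by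
  \<open>- \<sigma> + e\<close> gives norms strictly on either side of 1. This persists near
  \<open>v0\<close>, and monotonicity traps \<open>ln (hn v)\<close> within \<open>e\<close> of
  \<open>\<sigma>\<close>.\<close>

lemma continuous_on_node_norm: "continuous_on (- {0}) hn"
proof (rule continuous_at_imp_continuous_on, rule ballI)
  fix v0 :: "real^'n" assume "v0 \<in> - {0}"
  then have v0: "v0 \<noteq> 0" by simp
  define \<sigma> where "\<sigma> = ln (hn v0)"
  have unit: "N (D (- \<sigma>) *v v0) = 1" using node_norm_unit[OF v0] by (simp add: \<sigma>_def)
  have "((\<lambda>v. ln (hn v)) \<longlongrightarrow> \<sigma>) (at v0)"
  proof (rule tendstoI)
    fix e :: real assume "e > 0"
    have lim: "((\<lambda>v. N (D s *v v)) \<longlongrightarrow> N (D s *v v0)) (at v0)" for s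
      using continuous_on_N[OF continuous_on_dil[OF continuous_on_const continuous_on_id], of UNIV s]
      by (simp add: continuous_on_eq_continuous_at isCont_def)
    have 1: "N (D (- \<sigma> - e) *v v0) < 1"
    proof -
      have "1 * N (D (- \<sigma> - e) *v v0) < exp (e / 2) * N (D (- \<sigma> - e) *v v0)"
        using v0 \<open>e > 0\<close> by (intro mult_strict_right_mono weighted_norm_pos Pa) auto
      also have "\<dots> \<le> 1" using dil_strict_mono[of "- \<sigma> - e" "- \<sigma>" v0] unit \<open>e > 0\<close> by simp
      finally show ?thesis by simp
    qed
    have 2: "N (D (- \<sigma> + e) *v v0) > 1"
    proof -
      have "1 < exp (e / 2) * N (D (- \<sigma>) *v v0)" using \<open>e > 0\<close> by (simp add: unit)
      also have "\<dots> \<le> N (D (- \<sigma> + e) *v v0)" using dil_strict_mono[of "- \<sigma>" "- \<sigma> + e" v0] \<open>e > 0\<close> by simp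
      finally show ?thesis .
    qed
    have "\<forall>\<^sub>F v in at v0. v \<noteq> 0"
      using v0 tendsto_imp_eventually_ne[OF tendsto_ident_at, of v0 0 UNIV] by simp
    then show "\<forall>\<^sub>F v in at v0. dist (ln (hn v)) \<sigma> < e"
      using order_tendstoD(2)[OF lim 1] order_tendstoD(1)[OF lim 2]
    proof eventually_elim
      case (elim v)
      have unit': "N (D (- ln (hn v)) *v v) = 1" using elim(1) by (rule node_norm_unit)
      have mono: "N (D s *v v) \<le> N (D t *v v)" if "s \<le> t" for s t
      proof (cases "s = t")
        case False
        have "1 * N (D s *v v) \<le> exp ((t - s) / 2) * N (D s *v v)"
          using that by (intro mult_right_mono weighted_norm_nonneg Pa) auto
        then show ?thesis using dil_strict_mono[of s t v] False that by simp
      qed simp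
      have "- \<sigma> - e < - ln (hn v)" using mono[of "- ln (hn v)" "- \<sigma> - e"] elim unit' by linarith
      moreover have "- ln (hn v) < - \<sigma> + e" using mono[of "- \<sigma> + e" "- ln (hn v)"] elim unit' by linarith
      ultimately show ?case by (simp add: dist_real_def abs_less_iff)
    qed
  qed
  then have "((\<lambda>v. exp (ln (hn v))) \<longlongrightarrow> exp \<sigma>) (at v0)" by (rule tendsto_exp)
  moreover have "\<forall>\<^sub>F v in at v0. exp (ln (hn v)) = hn v"
    using tendsto_imp_eventually_ne[OF tendsto_ident_at v0, of UNIV]
    by eventually_elim (simp add: node_norm_pos)
  ultimately have "(hn \<longlongrightarrow> exp \<sigma>) (at v0)" by (simp cong: tendsto_cong)
  then show "isCont hn v0" using node_norm_pos[OF v0] by (simp add: isCont_def \<sigma>_def)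
qed

text \<open>Compares the coupling term with its value at \<open>\<mu> = 0\<close>. The factor
  \<open>hn v powr \<mu> - 1\<close> may blow up at 0, but only like a small power of
  \<open>N v\<close>, which the factor \<open>v\<close> absorbs; so the error is of order
  \<open>\<mu>\<close> down to \<open>v = 0\<close>.\<close>

lemma node_norm_powr_deviation:
  assumes "\<bar>\<mu>\<bar> \<le> 1 / 4" and "N v \<le> exp S"
  shows "N ((hn v powr \<mu>) *\<^sub>R v - v) \<le> 2 * \<bar>\<mu>\<bar> * log_bound S"
proof (cases "v = 0")
  case True
  then show ?thesis using log_bound_pos[of S] by (simp add: weighted_norm_def)
next
  case False
  define s where "s = ln (N v)"
  define \<sigma> where "\<sigma> = ln (hn v)"
  have pos: "N v > 0" using False by (rule weighted_norm_pos[OF Pa])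
  have Nv: "N v = exp s" using pos by (simp add: s_def)
  have "\<bar>\<mu> * \<sigma>\<bar> \<le> 2 * \<bar>\<mu>\<bar> * \<bar>s\<bar>"
    using mult_left_mono[OF ln_node_norm_bounds(2)[OF False], of "\<bar>\<mu>\<bar>"] by (simp add: s_def \<sigma>_def abs_mult mult_ac)
  then have "\<bar>\<mu> * \<sigma>\<bar> * exp \<bar>\<mu> * \<sigma>\<bar> \<le> (2 * \<bar>\<mu>\<bar> * \<bar>s\<bar>) * exp (2 * \<bar>\<mu>\<bar> * \<bar>s\<bar>)"
    by (intro mult_mono) auto
  then have "\<bar>exp (\<mu> * \<sigma>) - 1\<bar> \<le> (2 * \<bar>\<mu>\<bar> * \<bar>s\<bar>) * exp (2 * \<bar>\<mu>\<bar> * \<bar>s\<bar>)"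
    using abs_exp_minus_one_le[of "\<mu> * \<sigma>"] by linarith
  then have "\<bar>exp (\<mu> * \<sigma>) - 1\<bar> * exp s \<le> (2 * \<bar>\<mu>\<bar> * \<bar>s\<bar>) * exp (2 * \<bar>\<mu>\<bar> * \<bar>s\<bar>) * exp s"
    by (intro mult_right_mono) auto
  also have "\<dots> = 2 * \<bar>\<mu>\<bar> * (\<bar>s\<bar> * exp (2 * \<bar>\<mu>\<bar> * \<bar>s\<bar>) * exp s)" by simp
  also have "\<dots> \<le> 2 * \<bar>\<mu>\<bar> * log_bound S"
    using assms Nv by (intro mult_left_mono log_boundI) auto
  also have "\<bar>exp (\<mu> * \<sigma>) - 1\<bar> * exp s = N ((hn v powr \<mu>) *\<^sub>R v - v)"
  proof -
    have "(hn v powr \<mu>) *\<^sub>R v - v = (exp (\<mu> * \<sigma>) - 1) *\<^sub>R v"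
      using node_norm_pos[OF False] by (simp add: powr_def \<sigma>_def algebra_simps)
    then show ?thesis by (simp add: weighted_norm_scaleR[OF Pa] Nv)
  qed
  finally show ?thesis .
qed

text \<open>The exponent is what the condition on \<open>\<gamma>\<close> yields at a node of level
  \<open>ln (hn v)\<close> once it is dilated back to level 0: \<open>1 + \<mu>\<close> is the
  degree and \<open>k\<close> the distortion by the dilation. Replacing \<open>ln (hn v)\<close> by
  \<open>ln (N v)\<close> costs another \<open>k\<close>.\<close>

lemma node_perturbation_bound:
  assumes "2 * (\<bar>\<mu>\<bar> + 2 * k) \<le> 1 / 2" and "N v \<le> exp S" "\<tau> \<ge> 0" "v \<noteq> 0"
  shows "\<tau> * exp (ln (hn v) + \<mu> * ln (hn v) + k * \<bar>ln (hn v)\<bar>)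
    \<le> \<tau> * (N v + 2 * (\<bar>\<mu>\<bar> + 2 * k) * log_bound S)"
proof -
  define s where "s = ln (N v)"
  define \<sigma> where "\<sigma> = ln (hn v)"
  define \<epsilon> where "\<epsilon> = 2 * (\<bar>\<mu>\<bar> + 2 * k)"
  have "\<epsilon> \<ge> 0" using k_nonneg by (simp add: \<epsilon>_def)
  have pos: "N v > 0" using \<open>v \<noteq> 0\<close> by (rule weighted_norm_pos[OF Pa])
  have Nv: "N v = exp s" using pos by (simp add: s_def)
  have "\<sigma> + \<mu> * \<sigma> + k * \<bar>\<sigma>\<bar> \<le> s + (\<bar>\<mu>\<bar> + 2 * k) * \<bar>\<sigma>\<bar>"
    using ln_node_norm_bounds(1)[OF \<open>v \<noteq> 0\<close>] abs_ge_self[of "\<mu> * \<sigma>"]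
    by (simp add: s_def \<sigma>_def abs_mult algebra_simps)
  also have "\<dots> \<le> s + (\<bar>\<mu>\<bar> + 2 * k) * (2 * \<bar>s\<bar>)"
    using ln_node_norm_bounds(2)[OF \<open>v \<noteq> 0\<close>] k_nonneg
    by (intro add_left_mono mult_left_mono) (auto simp: s_def \<sigma>_def)
  finally have "exp (\<sigma> + \<mu> * \<sigma> + k * \<bar>\<sigma>\<bar>) \<le> exp (s + \<epsilon> * \<bar>s\<bar>)"
    by (simp add: \<epsilon>_def mult_ac)
  also have "\<dots> = exp s + (exp (\<epsilon> * \<bar>s\<bar>) - 1) * exp s"
    by (simp add: exp_add algebra_simps)
  also have "\<dots> \<le> exp s + ((\<epsilon> * \<bar>s\<bar>) * exp (\<epsilon> * \<bar>s\<bar>)) * exp s"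
    by (intro add_left_mono mult_right_mono exp_minus_one_le) auto
  also have "\<dots> = exp s + \<epsilon> * (\<bar>s\<bar> * exp (\<epsilon> * \<bar>s\<bar>) * exp s)" by simp
  also have "\<dots> \<le> exp s + \<epsilon> * log_bound S"
    using assms Nv \<open>\<epsilon> \<ge> 0\<close> by (intro add_left_mono mult_left_mono log_boundI) (auto simp: \<epsilon>_def)
  finally show ?thesis
    using \<open>\<tau> \<ge> 0\<close> unfolding \<sigma>_def \<epsilon>_def Nv by (rule mult_left_mono)
qed

text \<open>At 0, \<open>\<bar>\<mu>\<bar> \<le> 1/4\<close> and \<open>ln_node_norm_bounds\<close>
  bound the scalar factor by the power -1/2 of \<open>N v\<close>, so the term has at most the size
  of \<open>sqrt (N v)\<close>.\<close>

lemma continuous_on_node_norm_powr: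
  assumes "\<bar>\<mu>\<bar> \<le> 1 / 4"
  shows "continuous_on UNIV (\<lambda>v. (hn v powr \<mu>) *\<^sub>R v)"
proof (rule continuous_at_imp_continuous_on, rule ballI)
  fix v0 :: "real^'n"
  show "isCont (\<lambda>v. (hn v powr \<mu>) *\<^sub>R v) v0"
  proof (cases "v0 = 0")
    case False
    have "isCont hn v0"
      using continuous_on_node_norm False continuous_on_eq_continuous_at[of "- {0}" hn]
      by (simp add: open_Compl)
    then show ?thesis
      using node_norm_pos[OF False] by (intro continuous_intros) auto
  next
    case True
    obtain c where c: "c > 0" "\<And>v. norm v \<le> c * N v" by (rule norm_le_weighted_norm[OF Pa]) blast
    have "((\<lambda>v. (hn v powr \<mu>) *\<^sub>R v) \<longlongrightarrow> 0) (at 0)"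
    proof (rule Lim_null_comparison)
      have "isCont (\<lambda>v. c * sqrt (N v)) 0"
        by (intro continuous_intros continuous_on_interior[OF continuous_on_N[OF continuous_on_id], of _ UNIV]) simp
      then show "((\<lambda>v. c * sqrt (N v)) \<longlongrightarrow> 0) (at 0)"
        by (simp add: isCont_def weighted_norm_def)
      have "isCont N 0"
        by (intro continuous_on_interior[OF continuous_on_N[OF continuous_on_id], of _ UNIV]) simp
      then have "(N \<longlongrightarrow> 0) (at 0)" by (simp add: isCont_def weighted_norm_def)
      then have "\<forall>\<^sub>F v in at 0. N v < 1" by (rule order_tendstoD) simp
      moreover have "\<forall>\<^sub>F v in at 0. v \<noteq> (0 :: real^'n)" by (simp add: eventually_at_filter)
      ultimately show "\<forall>\<^sub>F v in at 0. norm ((hn v powr \<mu>) *\<^sub>R v) \<le> c * sqrt (N v)"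
      proof eventually_elim
        case (elim v)
        define s where "s = ln (N v)"
        have Nv: "N v = exp s" using weighted_norm_pos[OF Pa elim(2)] by (simp add: s_def)
        have "s < 0" using elim(1) by (simp add: Nv)
        have "hn v powr \<mu> \<le> exp (\<bar>\<mu>\<bar> * \<bar>ln (hn v)\<bar>)"
          using node_norm_pos[OF elim(2)] abs_ge_self[of "\<mu> * ln (hn v)"] by (simp add: powr_def abs_mult)
        also have "\<bar>\<mu>\<bar> * \<bar>ln (hn v)\<bar> \<le> (1 / 4) * (2 * \<bar>s\<bar>)"
          using assms ln_node_norm_bounds(2)[OF elim(2)] by (intro mult_mono) (auto simp: s_def)
        finally have "hn v powr \<mu> \<le> exp (\<bar>s\<bar> / 2)" by simp
        then have "(hn v powr \<mu>) * norm v \<le> exp (\<bar>s\<bar> / 2) * (c * N v)"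
          by (intro mult_mono c) auto
        also have "\<dots> = c * exp (s / 2)"
          using \<open>s < 0\<close> by (simp add: Nv flip: exp_add)
        also have "exp (s / 2) = sqrt (N v)"
          by (intro real_sqrt_unique[symmetric]) (simp_all add: Nv flip: exp_double)
        finally show ?case by simp
      qed
    qed
    then show ?thesis by (simp add: True isCont_def)
  qed
qed

end

section \<open>Stacked errors\<close>

lemma inner_blk: "e \<bullet> f = (\<Sum>i\<in>UNIV. blk e i \<bullet> blk f i)"
  for e f :: "real^('v::finite \<times> 'n::finite)"
  by (simp add: inner_vec_def blk_def sum.cartesian_product UNIV_Times_UNIV[symmetric] case_prod_unfold
      del: UNIV_Times_UNIV)

lemma norm_blk: "(norm e)\<^sup>2 = (\<Sum>i\<in>UNIV. (norm (blk e i))\<^sup>2)"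
  for e :: "real^('v::finite \<times> 'n::finite)"
  by (simp add: power2_norm_eq_inner inner_blk)

lemma norm_blk_le: "norm (blk e i) \<le> norm e"
  for e :: "real^('v::finite \<times> 'n::finite)"
proof -
  have "(norm (blk e i))\<^sup>2 \<le> (norm e)\<^sup>2"
    unfolding norm_blk[of e] by (intro member_le_sum) auto
  then show ?thesis by (simp add: power2_le_iff_abs_le)
qed

lemma norm_le_blk:
  fixes e :: "real^('v::finite \<times> 'n::finite)"
  assumes "\<And>i. norm (blk e i) \<le> c"
  shows "norm e \<le> real CARD('v) * c"
proof -
  have "c \<ge> 0" using assms[of undefined] norm_ge_zero order_trans by blast
  have "(norm e)\<^sup>2 \<le> (\<Sum>i\<in>(UNIV :: 'v set). c\<^sup>2)"
    unfolding norm_blk by (intro sum_mono power_mono assms) auto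
  also have "\<dots> = real CARD('v) * c\<^sup>2" by simp
  also have "\<dots> \<le> (real CARD('v) * c)\<^sup>2"
  proof -
    have "1 \<le> real CARD('v)" "0 \<le> real CARD('v) * c\<^sup>2" by (simp_all add: Suc_leI)
    from mult_right_mono[OF this] show ?thesis
      by (simp add: power2_eq_square mult_ac)
  qed
  finally show ?thesis
    using \<open>c \<ge> 0\<close> by (simp add: power2_le_iff_abs_le)
qed

lemma bounded_linear_blk: "bounded_linear (\<lambda>e. blk e i)"
  unfolding linear_conv_bounded_linear[symmetric] linear_iff by simp

lemmas continuous_on_blk [continuous_intros] =
  bounded_linear.continuous_on[OF bounded_linear_blk]

lemma blk_0 [simp]: "blk 0 i = 0"
  by (simp add: blk_def vec_eq_iff)

lemma wip_weight_net:
  "wip (weight_net Pa) e f = (\<Sum>i\<in>UNIV. wip Pa (blk e i) (blk f i))"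
  for e f :: "real^('v::finite \<times> 'n::finite)"
  by (simp add: wip_def weight_net_def kron_mat_1 inner_blk blk_block_diag)

lemma blk_dil_net: "blk (dil_net \<mu> G0 s *v e) i = dil \<mu> G0 s *v blk e i"
  by (simp add: dil_net_def kron_mat_1 blk_block_diag)

lemma blk_mismatch: "blk (mismatch \<gamma> t xh x) i = \<gamma> t (blk xh i) - \<gamma> t x"
  by (simp add: mismatch_def)

context weighted_dilation
begin

abbreviation NN :: "real^('v::finite \<times> 'n) \<Rightarrow> real" where "NN \<equiv> weighted_norm (weight_net Pa)"
abbreviation nn :: "real^('v::finite \<times> 'n) \<Rightarrow> real" where "nn \<equiv> net_norm \<mu> G0 Pa"

lemma NN_blk: "NN e = sqrt (\<Sum>i\<in>UNIV. (N (blk e i))\<^sup>2)"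
  unfolding weighted_norm_square[OF Pa] by (simp add: weighted_norm_wip wip_weight_net)

lemma NN_nonneg: "NN e \<ge> 0"
  unfolding NN_blk by (intro real_sqrt_ge_zero sum_nonneg) simp

lemma NN_pos: "e \<noteq> 0 \<Longrightarrow> NN e > 0"
proof -
  assume "e \<noteq> 0"
  then obtain i where "blk e i \<noteq> 0" using blk_eqI[of e 0] by auto
  then have "0 < (N (blk e i))\<^sup>2" using weighted_norm_pos[OF Pa, of "blk e i"] by simp
  also have "\<dots> \<le> (\<Sum>i\<in>UNIV. (N (blk e i))\<^sup>2)" by (intro member_le_sum) auto
  finally show "NN e > 0" by (simp add: NN_blk)
qed

lemma N_blk_le_NN: "N (blk e i) \<le> NN e"
proof -
  have "(N (blk e i))\<^sup>2 \<le> (\<Sum>i\<in>UNIV. (N (blk e i))\<^sup>2)" by (intro member_le_sum) auto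
  then have "sqrt ((N (blk e i))\<^sup>2) \<le> NN e" unfolding NN_blk by (rule real_sqrt_le_mono)
  then show ?thesis using weighted_norm_nonneg[OF Pa] by simp
qed

lemma dil_net_strict_mono:
  assumes "s < t"
  shows "exp ((t - s) / 2) * NN (dil_net \<mu> G0 s *v e) \<le> NN (dil_net \<mu> G0 t *v e)"
proof -
  have "(exp ((t - s) / 2))\<^sup>2 * (\<Sum>i\<in>UNIV. (N (D s *v blk e i))\<^sup>2) \<le> (\<Sum>i\<in>UNIV. (N (D t *v blk e i))\<^sup>2)"
    unfolding sum_distrib_left power_mult_distrib[symmetric]
    by (intro sum_mono power_mono dil_strict_mono assms mult_nonneg_nonneg weighted_norm_nonneg Pa) simp
  from real_sqrt_le_mono[OF this] show ?thesis
    by (simp add: NN_blk blk_dil_net real_sqrt_mult)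
qed

lemma dil_net_eq_0_iff: "dil_net \<mu> G0 s *v e = 0 \<longleftrightarrow> e = 0"
proof
  assume *: "dil_net \<mu> G0 s *v e = 0"
  show "e = 0"
  proof (rule blk_eqI)
    fix i
    have "D s *v blk e i = 0" using * by (simp flip: blk_dil_net)
    then show "blk e i = blk 0 i" by simp
  qed
qed simp

lemma net_norm_normalises:
  assumes "e \<noteq> 0"
  shows net_norm_pos: "nn e > 0" and net_norm_unit: "NN (dil_net \<mu> G0 (- ln (nn e)) *v e) = 1"
proof -
  have "continuous_on UNIV (\<lambda>s. wip Pa (D s *v blk e i) (D s *v blk e i))" for i
    by (intro continuous_on_wip continuous_on_dil continuous_on_id continuous_on_const)
  then have c: "continuous_on UNIV (\<lambda>s. NN (dil_net \<mu> G0 s *v e))"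
    unfolding weighted_norm_wip wip_weight_net blk_dil_net by (intro continuous_on_real_sqrt continuous_on_sum)
  have p: "NN (dil_net \<mu> G0 s *v e) > 0" for s
    using assms by (intro NN_pos) (simp add: dil_net_eq_0_iff)
  note h = hom_norm_normalises[of e NN "dil_net \<mu> G0", OF assms p dil_net_strict_mono c]
  show "nn e > 0" unfolding net_norm_def by (rule h(1))
  show "NN (dil_net \<mu> G0 (- ln (nn e)) *v e) = 1" unfolding net_norm_def by (rule h(2))
qed

lemma net_norm_0 [simp]: "nn 0 = 0"
  by (simp add: net_norm_def hom_norm_def)

lemma net_norm_nonneg: "nn e \<ge> 0"
  using net_norm_pos[of e] by (cases "e = 0") auto

text \<open>Above level 1 the dilation back to the unit sphere contracts at rate at least 1/2,
  whence \<open>nn e \<le> (NN e)\<^sup>2\<close>. This serves the local boundedness of the settling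
  time.\<close>

lemma net_norm_bounded:
  obtains V where "\<And>e :: real^('v::finite \<times> 'n). norm e \<le> R \<Longrightarrow> nn e \<le> V"
proof -
  obtain c where c: "c > 0" "\<And>v. N v \<le> c * norm v" by (rule weighted_norm_le_norm[OF Pa]) blast
  define b where "b = max 1 (real CARD('v) * (c * R)\<^sup>2)"
  have "nn e \<le> b" if e: "norm e \<le> R" for e :: "real^('v::finite \<times> 'n)"
  proof (cases "nn e \<le> 1")
    case False
    then have "e \<noteq> 0" by auto
    have "0 \<le> R" using e norm_ge_zero order_trans by blast
    have "exp (ln (nn e) / 2) * NN (dil_net \<mu> G0 (- ln (nn e)) *v e) \<le> NN (dil_net \<mu> G0 0 *v e)"
      using dil_net_strict_mono[of "- ln (nn e)" 0 e] False by simp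
    then have "exp (ln (nn e) / 2) \<le> NN e"
      using net_norm_unit[OF \<open>e \<noteq> 0\<close>] by (simp add: NN_blk blk_dil_net)
    then have "(exp (ln (nn e) / 2))\<^sup>2 \<le> (NN e)\<^sup>2" by (intro power_mono) auto
    also have "(exp (ln (nn e) / 2))\<^sup>2 = nn e"
      using net_norm_pos[OF \<open>e \<noteq> 0\<close>] by (simp flip: exp_double)
    also have "(NN e)\<^sup>2 = (\<Sum>i\<in>UNIV. (N (blk e i))\<^sup>2)"
      by (simp add: NN_blk sum_nonneg)
    also have "\<dots> \<le> (\<Sum>i\<in>(UNIV :: 'v set). (c * R)\<^sup>2)"
    proof (intro sum_mono power_mono weighted_norm_nonneg Pa)
      fix i
      have "N (blk e i) \<le> c * norm (blk e i)" by (rule c)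
      also have "\<dots> \<le> c * R" using c(1) norm_blk_le[of e i] e by (intro mult_left_mono) auto
      finally show "N (blk e i) \<le> c * R" .
    qed
    also have "\<dots> \<le> b" by (simp add: b_def)
    finally show ?thesis .
  qed (simp add: b_def)
  then show thesis by (rule that)
qed

text \<open>An error supported at one node has the same norms along both dilations, so the two
  definite descriptions pick the same level.\<close>

lemma net_norm_single:
  fixes i :: "'v::finite"
  shows "nn (stack (\<lambda>j. if j = i then v else 0)) = hn v"
proof -
  let ?e = "stack (\<lambda>j. if j = i then v else 0) :: real^('v \<times> 'n)"
  have "NN (dil_net \<mu> G0 s *v ?e) = N (D s *v v)" for s
  proof -
    have "(\<Sum>j\<in>UNIV. (N (D s *v (if j = i then v else 0)))\<^sup>2) = (\<Sum>j\<in>UNIV. if j = i then (N (D s *v v))\<^sup>2 else 0)"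
      by (intro sum.cong) (auto simp: weighted_norm_def)
    then show ?thesis
      by (simp add: NN_blk blk_dil_net weighted_norm_nonneg[OF Pa])
  qed
  moreover have "?e = 0 \<longleftrightarrow> v = 0"
  proof
    assume "?e = 0"
    then have "blk ?e i = 0" by simp
    then show "v = 0" by simp
  qed (simp add: stack_def vec_eq_iff)
  ultimately show ?thesis by (simp add: net_norm_def node_norm_def hom_norm_def)
qed

text \<open>Testing the network condition on an error supported at a single node gives the nodewise
  condition, which is what survives the change from the weight \<open>P\<close> to the weight \<open>\<zeta>\<close>.\<close>

lemma mismatch_bound_nodewise:
  fixes i :: "'v::finite" and \<gamma> :: "real \<Rightarrow> real^'n \<Rightarrow> real^'n"
  assumes hyp: "\<And>(xh :: real^('v \<times> 'n)) x. xh \<noteq> stack (\<lambda>_. x) \<Longrightarrow>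
        NN (dil_net \<mu> G0 (- ln (nn (xh - stack (\<lambda>_. x)))) *v mismatch \<gamma> t xh x)
        \<le> \<tau> * nn (xh - stack (\<lambda>_. x)) powr \<mu>"
    and "v \<noteq> 0"
  shows "N (D (- ln (hn v)) *v (\<gamma> t (v + x) - \<gamma> t x)) \<le> \<tau> * exp (\<mu> * ln (hn v))"
proof -
  let ?e = "stack (\<lambda>j. if j = i then v else 0) :: real^('v \<times> 'n)"
  have ne: "?e + stack (\<lambda>_. x) \<noteq> stack (\<lambda>_. x)"
  proof
    assume "?e + stack (\<lambda>_. x) = stack (\<lambda>_. x)"
    then have "blk ?e i = 0" by simp
    then show False using \<open>v \<noteq> 0\<close> by simp
  qed
  have "N (D (- ln (hn v)) *v (\<gamma> t (v + x) - \<gamma> t x))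
      = N (blk (dil_net \<mu> G0 (- ln (hn v)) *v mismatch \<gamma> t (?e + stack (\<lambda>_. x)) x) i)"
    by (simp add: blk_dil_net blk_mismatch)
  also have "\<dots> \<le> NN (dil_net \<mu> G0 (- ln (hn v)) *v mismatch \<gamma> t (?e + stack (\<lambda>_. x)) x)"
    by (rule N_blk_le_NN)
  also have "\<dots> \<le> \<tau> * hn v powr \<mu>"
    using hyp[OF ne] by (simp add: net_norm_single)
  finally show ?thesis using node_norm_pos[OF \<open>v \<noteq> 0\<close>] by (simp add: powr_def)
qed

end

section \<open>The homogeneous error field\<close>

lemma (in weighted_dilation) weighted_norm_triangle: "N (v + w) \<le> N v + N w"
proof -
  have "(N (v + w))\<^sup>2 = (N v)\<^sup>2 + 2 * wip Pa v w + (N w)\<^sup>2"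
    by (simp add: weighted_norm_square[OF Pa] wip_bilin wip_commute[OF Pa, of w v])
  also have "\<dots> \<le> (N v + N w)\<^sup>2"
    using wip_Cauchy_Schwarz[OF Pa, of v w] by (simp add: power2_sum)
  finally show ?thesis
    by (rule power2_le_imp_le) (intro add_nonneg_nonneg weighted_norm_nonneg Pa)
qed

lemma (in weighted_dilation) weighted_norm_sum: "N (\<Sum>i\<in>I. f i) \<le> (\<Sum>i\<in>I. N (f i))"
proof (induction I rule: infinite_finite_induct)
  case (insert i I)
  then show ?case using weighted_norm_triangle[of "f i" "\<Sum>i\<in>I. f i"] by simp
qed (simp_all add: weighted_norm_def)

lemma (in weighted_dilation) has_vector_derivative_dil:
  assumes "(\<sigma> has_real_derivative \<sigma>') (at t within S)" "(f has_vector_derivative f') (at t within S)"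
  shows "((\<lambda>t. D (\<sigma> t) *v f t) has_vector_derivative
    D (\<sigma> t) *v f' + \<sigma>' *\<^sub>R (dil_gen \<mu> G0 *v (D (\<sigma> t) *v f t))) (at t within S)"
proof -
  have "(\<sigma> has_vector_derivative \<sigma>') (at t within S)"
    using assms(1) by (simp add: has_real_derivative_iff_has_vector_derivative)
  from vector_diff_chain_within[OF this has_vector_derivative_at_within[OF mexp_has_vector_derivative]]
  have "((\<lambda>t. D (\<sigma> t)) has_vector_derivative \<sigma>' *\<^sub>R (dil_gen \<mu> G0 ** D (\<sigma> t))) (at t within S)"
    by (simp add: dil_def o_def)
  from bounded_bilinear.has_vector_derivative[OF bounded_bilinear_matrix_vector_mult this assms(2)]
  show ?thesis by (simp add: matrix_vector_mul_assoc scaleR_matrix_vector_assoc)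
qed

definition consensus :: "('v::finite \<times> 'v) set \<Rightarrow> ('v \<Rightarrow> 'a::real_vector) \<Rightarrow> 'v \<Rightarrow> 'a" where
  "consensus E y i = (\<Sum>j\<in>UNIV. adj E i j *\<^sub>R (y j - y i))"

definition injection :: "real \<Rightarrow> real^'n^'n \<Rightarrow> real^'p^'n \<Rightarrow> real^'p \<Rightarrow> real^'n" where
  "injection \<mu> G0 H w = inj_gain \<mu> G0 (norm w) *v (H *v w)"

text \<open>The error equation without \<open>\<Gamma>\<close>, on families of vectors instead of
  stacked vectors, so that the dilation acts on each node separately.\<close>

definition error_field ::
  "real^'n^'n \<Rightarrow> real^'n^'p \<Rightarrow> ('p::finite \<Rightarrow> 'v::finite) \<Rightarrow> ('v \<times> 'v) set \<Rightarrow>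
   real^'n^'n \<Rightarrow> real^'n^'n \<Rightarrow> real^'p^'n \<Rightarrow> real \<Rightarrow> real \<Rightarrow> ('v \<Rightarrow> real^'n) \<Rightarrow> 'v \<Rightarrow> real^'n" where
  "error_field A C own E G0 Pa H \<nu> \<mu> y i =
     A *v y i + injection \<mu> G0 H (local_out own i (C *v y i))
     + (\<nu> * node_norm \<mu> G0 Pa (consensus E y i) powr \<mu>) *\<^sub>R consensus E y i"

text \<open>The value of \<open>error_field\<close> at \<open>\<mu> = 0\<close>, where the injection
  gain is the identity and the coupling is linear.\<close>

definition linear_error_field ::
  "real^'n^'n \<Rightarrow> real^'n^'p \<Rightarrow> ('p::finite \<Rightarrow> 'v::finite) \<Rightarrow> ('v \<times> 'v) set \<Rightarrow>
   real^'p^'n \<Rightarrow> real \<Rightarrow> ('v \<Rightarrow> real^'n) \<Rightarrow> 'v \<Rightarrow> real^'n" where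
  "linear_error_field A C own E H \<nu> y i =
     A *v y i + H *v local_out own i (C *v y i) + \<nu> *\<^sub>R consensus E y i"

text \<open>\<open>observer_minus_plant\<close> is an algebraic identity for every input, so it can
  be read with zero input; undoing the shift by \<open>x t\<close> leaves the blocks of the
  error.\<close>

lemma blk_error_rhs:
  fixes A :: "real^'n^'n"
  assumes "irrefl E"
  shows "blk (error_rhs A C own E G0 Pa H \<nu> \<mu> \<gamma> x t e) i
    = error_field A C own E G0 Pa H \<nu> \<mu> (blk e) i + (\<gamma> t (blk e i + x t) - \<gamma> t (x t))"
proof -
  have "error_rhs A C own E G0 Pa H \<nu> \<mu> \<gamma> x t (e + stack (\<lambda>_. x t) - stack (\<lambda>_. x t))
     = observer_rhs A (0 :: real^'n^'n) C own E G0 Pa H \<nu> \<mu> \<gamma> (\<lambda>_. 0) (\<lambda>t. C *v x t) t (e + stack (\<lambda>_. x t))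
       - stack (\<lambda>_. plant_rhs A (0 :: real^'n^'n) \<gamma> (\<lambda>_. 0) t (x t))"
    by (rule observer_minus_plant[OF assms, symmetric])
  then show ?thesis
    by (simp add: observer_rhs_def plant_rhs_def Let_def error_field_def injection_def consensus_def
        matrix_vector_right_distrib matrix_vector_mult_diff_distrib)
qed

lemma linear_local_out: "linear (local_out own i)"
  by (simp add: linear_iff local_out_def vec_eq_iff)

lemma norm_local_out_le: "norm (local_out own i w) \<le> norm w"
  unfolding norm_vec_def L2_set_def
  by (intro real_sqrt_le_mono sum_mono) (auto simp: local_out_def)

lemma linear_consensus: "linear f \<Longrightarrow> consensus E (\<lambda>i. f (y i)) i = f (consensus E y i)"
  by (simp add: consensus_def linear_sum linear_scale linear_diff)

text \<open>\<open>AG\<close> is the equation of \<open>G0\<close> for \<open>Y0 = 0\<close>. The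
  bounds on \<open>\<bar>\<mu>\<bar>\<close> let both nonlinear gains grow at most like the power
  -1/2 near 0, which makes the field continuous there.\<close>

locale homogeneous_observer = weighted_dilation Pa G0 \<mu> \<kappa>
  for Pa G0 :: "real^'n^'n" and \<mu> \<kappa> :: real +
  fixes A :: "real^'n^'n" and C :: "real^'n^'p" and own :: "'p \<Rightarrow> 'v::finite"
    and E :: "('v \<times> 'v) set" and H :: "real^'p^'n" and \<nu> K h cN :: real
  assumes AG: "A ** G0 = G0 ** A + A" and CG: "C ** G0 = 0"
    and K: "\<And>v. norm ((G0 + mat 1) *v v) \<le> K * norm v" "K \<ge> 0" "\<bar>\<mu>\<bar> * K \<le> 1 / 2"
    and h: "\<And>w. norm (H *v w) \<le> h * norm w" "h \<ge> 0"
    and cN: "\<And>v. weighted_norm Pa v \<le> cN * norm v" "cN \<ge> 0"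
    and mu_small: "\<bar>\<mu>\<bar> \<le> 1 / 4" and nu: "\<nu> \<ge> 0"
begin

abbreviation fld :: "('v \<Rightarrow> real^'n) \<Rightarrow> 'v \<Rightarrow> real^'n" where
  "fld \<equiv> error_field A C own E G0 Pa H \<nu> \<mu>"

abbreviation lin :: "('v \<Rightarrow> real^'n) \<Rightarrow> 'v \<Rightarrow> real^'n" where
  "lin \<equiv> linear_error_field A C own E H \<nu>"

text \<open>By \<open>AG\<close>, \<open>A\<close> fails to commute with the dilation generator only
  by \<open>\<mu> A\<close>.\<close>

lemma A_dil: "A *v (D s *v v) = exp (\<mu> * s) *\<^sub>R (D s *v (A *v v))"
  unfolding dil_def
  by (rule mexp_intertwine) (simp add: dil_gen_def matrix_add_ldistrib matrix_mult_add_left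
      matrix_mult_scaleR_left matrix_mult_scaleR_right AG scaleR_add_right)

lemma C_dil: "C *v (D s *v v) = exp s *\<^sub>R (C *v v)"
proof -
  \<comment> \<open>On outputs the dilation is the scalar \<open>exp s\<close>: in
    \<open>mexp_intertwine\<close> the generator on that side is zero and the degree is 1.\<close>
  have "C ** dil_gen \<mu> G0 = 0 ** C + 1 *\<^sub>R C"
    by (simp add: dil_gen_def matrix_add_ldistrib matrix_mult_scaleR_right CG)
  from mexp_intertwine[OF this, of s v] show ?thesis by (simp add: dil_def)
qed

text \<open>The generator splits into \<open>\<mu> (G0 + 1)\<close>, which generates the injection
  gain, and the scalar \<open>1 - \<mu>\<close>.\<close>

lemma dil_eq_mexp_shift: "D s *v v = exp ((1 - \<mu>) * s) *\<^sub>R (mexp ((\<mu> * s) *\<^sub>R (G0 + mat 1)) *v v)"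
proof -
  have "mat 1 ** dil_gen \<mu> G0 = (\<mu> *\<^sub>R (G0 + mat 1)) ** mat 1 + (1 - \<mu>) *\<^sub>R mat 1"
    by (simp add: dil_gen_def algebra_simps)
  from mexp_intertwine[OF this, of s v] show ?thesis by (simp add: dil_def mult.commute)
qed

lemma injection_0 [simp]: "injection \<mu> G0 H 0 = 0"
  by (simp add: injection_def)

text \<open>Scaling \<open>w\<close> by \<open>exp s\<close> shifts \<open>ln (norm w)\<close> by
  \<open>s\<close>, so the gain picks up the exponential of \<open>\<mu> s (G0 + 1)\<close>;
  \<open>H *v w\<close> contributes \<open>exp s\<close>, and \<open>dil_eq_mexp_shift\<close>
  combines the two.\<close>

lemma injection_dil: "injection \<mu> G0 H (exp s *\<^sub>R w) = exp (\<mu> * s) *\<^sub>R (D s *v injection \<mu> G0 H w)"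
proof (cases "w = 0")
  case False
  have "ln (norm (exp s *\<^sub>R w)) = s + ln (norm w)"
    using False by (simp add: ln_mult)
  then have "injection \<mu> G0 H (exp s *\<^sub>R w) = mexp ((\<mu> * s + \<mu> * ln (norm w)) *\<^sub>R (G0 + mat 1)) *v (exp s *\<^sub>R (H *v w))"
    by (simp add: injection_def inj_gain_def distrib_left matrix_vector_mult_scaleR)
  also have "\<dots> = exp s *\<^sub>R (mexp ((\<mu> * s) *\<^sub>R (G0 + mat 1)) *v injection \<mu> G0 H w)"
    unfolding mexp_add by (simp add: injection_def inj_gain_def matrix_vector_mult_scaleR)
  also have "\<dots> = exp (\<mu> * s) *\<^sub>R (D s *v injection \<mu> G0 H w)"
    by (simp add: dil_eq_mexp_shift algebra_simps flip: exp_add)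
  finally show ?thesis .
qed simp

text \<open>All three terms have degree \<open>\<mu>\<close>; the matrix gain of the injection and
  the exponent of the coupling are made to match the degree of \<open>A\<close>.\<close>

lemma fld_dil: "fld (\<lambda>i. D s *v y i) i = exp (\<mu> * s) *\<^sub>R (D s *v fld y i)"
proof -
  have "consensus E (\<lambda>i. D s *v y i) i = D s *v consensus E y i"
    by (intro linear_consensus matrix_vector_mul_linear)
  moreover have "hn (consensus E y i) \<ge> 0"
    using node_norm_pos[of "consensus E y i"] by (cases "consensus E y i = 0") auto
  then have "(exp s * hn (consensus E y i)) powr \<mu> = exp (\<mu> * s) * hn (consensus E y i) powr \<mu>"
    by (simp add: powr_mult exp_powr_real mult.commute)
  moreover have "local_out own i (exp s *\<^sub>R w) = exp s *\<^sub>R local_out own i w" for w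
    by (rule linear_scale[OF linear_local_out])
  ultimately show ?thesis
    by (simp add: error_field_def A_dil C_dil injection_dil node_norm_dil
        matrix_vector_right_distrib matrix_vector_mult_scaleR scaleR_add_right exp_add mult_ac)
qed

lemma injection_deviation:
  assumes "norm w \<le> exp S"
  shows "norm (injection \<mu> G0 H w - H *v w) \<le> \<bar>\<mu>\<bar> * K * h * log_bound S"
proof (cases "w = 0")
  case True
  then show ?thesis using K h log_bound_pos[of S] by simp
next
  case False
  define s where "s = ln (norm w)"
  have w: "norm w = exp s" using False by (simp add: s_def)
  have "norm (injection \<mu> G0 H w - H *v w)
      \<le> K * \<bar>\<mu> * s\<bar> * exp (K * \<bar>\<mu> * s\<bar>) * norm (H *v w)"
    unfolding injection_def inj_gain_def s_def by (rule norm_mexp_diff_le[OF K(1,2)])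
  also have "\<dots> \<le> K * \<bar>\<mu> * s\<bar> * exp (K * \<bar>\<mu> * s\<bar>) * (h * exp s)"
    using h(1)[of w] K(2) by (intro mult_left_mono) (auto simp: w)
  also have "\<dots> = \<bar>\<mu>\<bar> * K * h * (\<bar>s\<bar> * exp (\<bar>\<mu>\<bar> * K * \<bar>s\<bar>) * exp s)"
    by (simp add: abs_mult mult_ac)
  also have "\<dots> \<le> \<bar>\<mu>\<bar> * K * h * log_bound S"
    using assms K h by (intro mult_left_mono log_boundI) (auto simp: w)
  finally show ?thesis .
qed

lemma fld_deviation:
  assumes "norm (local_out own i (C *v y i)) \<le> exp S1" "N (consensus E y i) \<le> exp S2"
  shows "N (fld y i - lin y i) \<le> \<bar>\<mu>\<bar> * (cN * K * h * log_bound S1 + 2 * \<nu> * log_bound S2)"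
proof -
  let ?w = "local_out own i (C *v y i)" and ?\<theta> = "consensus E y i"
  have "fld y i - lin y i = (injection \<mu> G0 H ?w - H *v ?w) + \<nu> *\<^sub>R ((hn ?\<theta> powr \<mu>) *\<^sub>R ?\<theta> - ?\<theta>)"
    by (simp add: error_field_def linear_error_field_def algebra_simps)
  then have "N (fld y i - lin y i) \<le> N (injection \<mu> G0 H ?w - H *v ?w) + N (\<nu> *\<^sub>R ((hn ?\<theta> powr \<mu>) *\<^sub>R ?\<theta> - ?\<theta>))"
    using weighted_norm_triangle by simp
  also have "N (injection \<mu> G0 H ?w - H *v ?w) \<le> cN * (\<bar>\<mu>\<bar> * K * h * log_bound S1)"
    using cN(1)[of "injection \<mu> G0 H ?w - H *v ?w"]
      mult_left_mono[OF injection_deviation[OF assms(1)] cN(2)] by linarith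
  also have "N (\<nu> *\<^sub>R ((hn ?\<theta> powr \<mu>) *\<^sub>R ?\<theta> - ?\<theta>)) \<le> \<nu> * (2 * \<bar>\<mu>\<bar> * log_bound S2)"
    using mult_left_mono[OF node_norm_powr_deviation[OF mu_small assms(2)] nu] nu
    by (simp add: weighted_norm_scaleR[OF Pa])
  finally show ?thesis by (simp add: algebra_simps)
qed

text \<open>At 0, \<open>\<bar>\<mu>\<bar> * K \<le> 1/2\<close> bounds the gain by the power -1/2
  of \<open>norm w\<close>, so the injection has at most the size of
  \<open>sqrt (norm w)\<close>.\<close>

lemma continuous_on_injection: "continuous_on UNIV (injection \<mu> G0 H)"
proof (rule continuous_at_imp_continuous_on, rule ballI)
  fix w0 :: "real^'p"
  show "isCont (injection \<mu> G0 H) w0"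
  proof (cases "w0 = 0")
    case False
    have "continuous_on (- {0}) (\<lambda>w :: real^'p. mexp ((\<mu> * ln (norm w)) *\<^sub>R (G0 + mat 1)) *v (H *v w))"
      by (intro continuous_on_mexp_mult_vec continuous_intros) auto
    then have "continuous_on (- {0}) (injection \<mu> G0 H)"
      by (simp add: injection_def[abs_def] inj_gain_def)
    then show ?thesis
      using False continuous_on_eq_continuous_at[of "- {0}" "injection \<mu> G0 H"] by (simp add: open_Compl)
  next
    case True
    have "(injection \<mu> G0 H \<longlongrightarrow> 0) (at 0)"
    proof (rule Lim_null_comparison)
      have "isCont (\<lambda>w :: real^'p. h * sqrt (norm w)) 0" by (intro continuous_intros)
      then show "((\<lambda>w :: real^'p. h * sqrt (norm w)) \<longlongrightarrow> 0) (at 0)" by (simp add: isCont_def)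
      have "((\<lambda>w :: real^'p. norm w) \<longlongrightarrow> 0) (at 0)" by (rule tendsto_norm_zero) (rule tendsto_ident_at)
      then have "\<forall>\<^sub>F w :: real^'p in at 0. norm w < 1" by (rule order_tendstoD) simp
      moreover have "\<forall>\<^sub>F w in at 0. w \<noteq> (0 :: real^'p)" by (simp add: eventually_at_filter)
      ultimately show "\<forall>\<^sub>F w in at 0. norm (injection \<mu> G0 H w) \<le> h * sqrt (norm w)"
      proof eventually_elim
        case (elim w)
        define s where "s = ln (norm w)"
        have w: "norm w = exp s" using elim by (simp add: s_def)
        have "s < 0" using elim by (simp add: w)
        have "norm (injection \<mu> G0 H w) \<le> exp (K * \<bar>\<mu> * s\<bar>) * norm (H *v w)"
          unfolding injection_def inj_gain_def s_def by (rule norm_mexp_le[OF K(1)])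
        also have "\<dots> \<le> exp (\<bar>s\<bar> / 2) * (h * exp s)"
        proof (intro mult_mono)
          show "exp (K * \<bar>\<mu> * s\<bar>) \<le> exp (\<bar>s\<bar> / 2)"
            using mult_right_mono[OF K(3), of "\<bar>s\<bar>"] by (simp add: abs_mult mult_ac)
          show "norm (H *v w) \<le> h * exp s" using h(1)[of w] by (simp add: w)
        qed (use h in auto)
        also have "\<dots> = h * exp (s / 2)" using \<open>s < 0\<close> by (simp flip: exp_add)
        also have "exp (s / 2) = sqrt (norm w)"
          by (intro real_sqrt_unique[symmetric]) (simp_all add: w flip: exp_double)
        finally show ?case .
      qed
    qed
    then show ?thesis by (simp add: True isCont_def)
  qed
qed

lemma continuous_on_fld: "continuous_on UNIV (\<lambda>e. fld (blk e) i)"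
proof -
  have 1: "continuous_on UNIV (\<lambda>e. local_out own i (C *v blk e i))"
    by (intro linear_continuous_on_compose[OF _ linear_local_out]
        linear_continuous_on_compose[OF _ matrix_vector_mul_linear] continuous_intros)
  have 2: "continuous_on UNIV (\<lambda>e. consensus E (blk e) i)"
    unfolding consensus_def by (intro continuous_intros)
  have 3: "continuous_on UNIV (\<lambda>e. (hn (consensus E (blk e) i) powr \<mu>) *\<^sub>R consensus E (blk e) i)"
    using continuous_on_compose2[OF continuous_on_node_norm_powr[OF mu_small] 2] by simp
  have 4: "continuous_on UNIV (\<lambda>e. injection \<mu> G0 H (local_out own i (C *v blk e i)))"
    using continuous_on_compose2[OF continuous_on_injection 1] by simp
  have 5: "continuous_on UNIV (\<lambda>e. A *v blk e i)"
    by (intro linear_continuous_on_compose[OF _ matrix_vector_mul_linear] continuous_intros)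
  show ?thesis
    using continuous_on_add[OF continuous_on_add[OF 5 4] continuous_on_scaleR[OF continuous_on_const 3]]
    by (simp add: error_field_def)
qed

end

section \<open>Decay of the linear error field\<close>

lemma left_null_balance:
  assumes "irrefl E" and "\<zeta> v* laplacian E = 0"
  shows "\<zeta> $ j * (\<Sum>k\<in>UNIV. adj E j k) = (\<Sum>i\<in>UNIV. \<zeta> $ i * adj E i j)"
proof -
  have 0: "adj E j j = 0"
    using assms(1) by (auto simp: adj_def irrefl_def)
  have "0 = (\<zeta> v* laplacian E) $ j" using assms(2) by simp
  also have "\<dots> = (\<Sum>i\<in>UNIV. laplacian E $ i $ j * \<zeta> $ i)"
    by (simp add: vector_matrix_mult_def mult.commute)
  also have "\<dots> = (\<Sum>i\<in>UNIV. (if i = j then (\<Sum>k\<in>UNIV. adj E j k) * \<zeta> $ j else 0) - \<zeta> $ i * adj E i j)"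
    by (rule sum.cong) (auto simp: laplacian_def 0)
  also have "\<dots> = (\<Sum>k\<in>UNIV. adj E j k) * \<zeta> $ j - (\<Sum>i\<in>UNIV. \<zeta> $ i * adj E i j)"
    by (simp add: sum_subtractf)
  finally show ?thesis by (simp add: mult.commute)
qed

text \<open>Zeros spread backwards along edges: where \<open>w b = 0\<close>, the balance equates a
  sum of nonnegative terms with 0, so \<open>w a = 0\<close> whenever \<open>(a, b) \<in> E\<close>.
  Strong connectivity carries this to every node.\<close>

lemma balanced_nonneg_zero_or_pos:
  fixes w :: "'v::finite \<Rightarrow> real"
  assumes conn: "strongly_connected E" and nonneg: "\<And>i. w i \<ge> 0"
    and bal: "\<And>j. w j * (\<Sum>k\<in>UNIV. adj E j k) = (\<Sum>i\<in>UNIV. w i * adj E i j)"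
    and "w j = 0"
  shows "w i = 0"
proof -
  have step: "w a = 0" if "(a, b) \<in> E" "w b = 0" for a b
  proof -
    have "(\<Sum>i\<in>UNIV. w i * adj E i b) = 0" using bal[of b] that by simp
    moreover have "w i * adj E i b \<ge> 0" for i using nonneg by (simp add: adj_def)
    ultimately have "w a * adj E a b = 0" by (simp add: sum_nonneg_eq_0_iff)
    then show ?thesis using that by (simp add: adj_def)
  qed
  have "(i, j) \<in> E\<^sup>*" using conn by (simp add: strongly_connected_def)
  then show ?thesis
    using \<open>w j = 0\<close> by (induction rule: converse_rtrancl_induct) (auto intro: step)
qed

text \<open>Summing the balance equations of \<open>\<bar>\<zeta>\<bar>\<close> over all nodes gives equality, so \<open>\<bar>\<zeta>\<bar>\<close> is balanced
  as well, and \<open>\<bar>\<zeta>\<bar> - \<zeta>\<close> is a nonnegative balanced vector.\<close>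

lemma left_null_vector_pos:
  fixes \<zeta> :: "real^'v::finite"
  assumes loops: "irrefl E" and conn: "strongly_connected E"
    and null: "\<zeta> v* laplacian E = 0" and sum: "(\<Sum>i\<in>UNIV. \<zeta> $ i) = 1"
  shows "\<zeta> $ i > 0"
proof -
  note bal = left_null_balance[OF loops null]
  let ?d = "\<lambda>j. \<Sum>k\<in>UNIV. adj E j k"
  have adj: "adj E i j \<ge> 0" for i j by (simp add: adj_def)
  have d: "?d j \<ge> 0" for j by (intro sum_nonneg adj)
  have le: "\<bar>\<zeta> $ j\<bar> * ?d j \<le> (\<Sum>i\<in>UNIV. \<bar>\<zeta> $ i\<bar> * adj E i j)" for j
  proof -
    have "\<bar>\<zeta> $ j\<bar> * ?d j = \<bar>\<Sum>i\<in>UNIV. \<zeta> $ i * adj E i j\<bar>"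
      using d[of j] by (simp flip: bal add: abs_mult)
    also have "\<dots> \<le> (\<Sum>i\<in>UNIV. \<bar>\<zeta> $ i * adj E i j\<bar>)" by (rule sum_abs)
    finally show ?thesis using adj by (simp add: abs_mult)
  qed
  \<comment> \<open>After exchanging the sums both parts have the same total, so the nonnegative
    gaps in \<open>le\<close> add up to 0 and each of them vanishes.\<close>
  have "(\<Sum>j\<in>UNIV. (\<Sum>i\<in>UNIV. \<bar>\<zeta> $ i\<bar> * adj E i j) - \<bar>\<zeta> $ j\<bar> * ?d j) = 0"
    unfolding sum_subtractf by (subst sum.swap) (simp add: sum_distrib_left)
  then have abs_bal: "\<bar>\<zeta> $ j\<bar> * ?d j = (\<Sum>i\<in>UNIV. \<bar>\<zeta> $ i\<bar> * adj E i j)" for j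
    using le by (subst (asm) sum_nonneg_eq_0_iff) auto
  have nonneg: "\<zeta> $ i \<ge> 0" for i
  proof (rule ccontr)
    assume "\<not> \<zeta> $ i \<ge> 0"
    \<comment> \<open>A zero of this balanced vector anywhere would force one at \<open>i\<close>,
      where it is positive. So it has no zero, every \<open>\<zeta> $ j\<close> is nonpositive, and
      they cannot sum to 1.\<close>
    have "(\<bar>\<zeta> $ j\<bar> - \<zeta> $ j) * ?d j = (\<Sum>i\<in>UNIV. (\<bar>\<zeta> $ i\<bar> - \<zeta> $ i) * adj E i j)" for j
      using bal[of j] abs_bal[of j] by (simp add: left_diff_distrib sum_subtractf)
    then have "\<bar>\<zeta> $ i\<bar> - \<zeta> $ i = 0" if "\<bar>\<zeta> $ j\<bar> - \<zeta> $ j = 0" for j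
      using that by (intro balanced_nonneg_zero_or_pos[OF conn, of "\<lambda>i. \<bar>\<zeta> $ i\<bar> - \<zeta> $ i" j i]) auto
    then have "\<bar>\<zeta> $ j\<bar> - \<zeta> $ j \<noteq> 0" for j
      using \<open>\<not> \<zeta> $ i \<ge> 0\<close> by fastforce
    then have "\<zeta> $ j \<le> 0" for j by (metis abs_of_pos diff_self not_le)
    then have "(\<Sum>i\<in>UNIV. \<zeta> $ i) \<le> 0" by (intro sum_nonpos) auto
    then show False using sum by simp
  qed
  show ?thesis
  proof (rule ccontr)
    assume "\<not> \<zeta> $ i > 0"
    then have "\<zeta> $ i = 0" using nonneg[of i] by simp
    then have "\<zeta> $ j = 0" for j
      by (rule balanced_nonneg_zero_or_pos[OF conn nonneg bal])
    then show False using sum by simp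
  qed
qed

text \<open>Polarisation writes twice each product as the difference of the squared norms at
  \<open>j\<close> and at \<open>i\<close> minus the squared norm of \<open>y i - y j\<close>; the
  balance of \<open>\<zeta>\<close> cancels the differences in the weighted sum.\<close>

lemma consensus_energy:
  fixes y :: "'v::finite \<Rightarrow> real^'n"
  assumes P: "pos_def P" and loops: "irrefl E" and null: "\<zeta> v* laplacian E = 0"
  shows "(\<Sum>i\<in>UNIV. \<zeta> $ i * wip P (y i) (consensus E y i))
    = - (\<Sum>i\<in>UNIV. \<Sum>j\<in>UNIV. \<zeta> $ i * adj E i j * wip P (y i - y j) (y i - y j)) / 2"
proof -
  let ?q = "\<lambda>i. wip P (y i) (y i)"
  have bal: "(\<Sum>i\<in>UNIV. \<Sum>j\<in>UNIV. \<zeta> $ i * adj E i j * (?q j - ?q i)) = 0"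
  proof -
    have "(\<Sum>i\<in>UNIV. \<Sum>j\<in>UNIV. \<zeta> $ i * adj E i j * ?q j)
        = (\<Sum>j\<in>UNIV. (\<Sum>i\<in>UNIV. \<zeta> $ i * adj E i j) * ?q j)"
      by (subst sum.swap) (simp add: sum_distrib_right)
    also have "\<dots> = (\<Sum>i\<in>UNIV. \<Sum>j\<in>UNIV. \<zeta> $ i * adj E i j * ?q i)"
      by (simp flip: left_null_balance[OF loops null] add: sum_distrib_right sum_distrib_left mult.assoc)
    finally show ?thesis by (simp add: right_diff_distrib sum_subtractf)
  qed
  have *: "2 * wip P (y i) (y j - y i) = (?q j - ?q i) - wip P (y i - y j) (y i - y j)" for i j
    by (simp add: wip_bilin wip_commute[OF P, of "y j" "y i"])
  have "2 * (\<Sum>i\<in>UNIV. \<zeta> $ i * wip P (y i) (consensus E y i))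
      = (\<Sum>i\<in>UNIV. \<Sum>j\<in>UNIV. \<zeta> $ i * adj E i j * (2 * wip P (y i) (y j - y i)))"
    by (simp add: consensus_def wip_bilin(8,12) sum_distrib_left mult_ac)
  also have "\<dots> = (\<Sum>i\<in>UNIV. \<Sum>j\<in>UNIV. \<zeta> $ i * adj E i j * ((?q j - ?q i) - wip P (y i - y j) (y i - y j)))"
    by (simp only: *)
  also have "\<dots> = (\<Sum>i\<in>UNIV. \<Sum>j\<in>UNIV. \<zeta> $ i * adj E i j * (?q j - ?q i))
      - (\<Sum>i\<in>UNIV. \<Sum>j\<in>UNIV. \<zeta> $ i * adj E i j * wip P (y i - y j) (y i - y j))"
    by (simp only: right_diff_distrib sum_subtractf)
  finally show ?thesis using bal by simp
qed

lemma connected_const: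
  assumes conn: "strongly_connected E" and "\<And>i j. (i, j) \<in> E \<Longrightarrow> y i = y j"
  shows "y i = y j"
proof -
  have "(i, j) \<in> E\<^sup>*" using conn by (simp add: strongly_connected_def)
  then show ?thesis by (induction rule: converse_rtrancl_induct) (auto simp: assms(2))
qed

text \<open>A compactness form of Finsler's lemma: a limit point of violators with growing penalty
  would lie in the zero set of \<open>b\<close> and still violate the bound.\<close>

lemma compact_penalty:
  fixes a b :: "'a::euclidean_space \<Rightarrow> real"
  assumes S: "compact S" and a: "continuous_on S a" and b: "continuous_on S b"
    and nonneg: "\<And>x. x \<in> S \<Longrightarrow> b x \<ge> 0"
    and less: "\<And>x. x \<in> S \<Longrightarrow> b x = 0 \<Longrightarrow> a x < \<alpha>"
  shows "\<exists>\<nu>0>0. \<forall>\<nu>\<ge>\<nu>0. \<forall>x\<in>S. a x - \<nu> * b x < \<alpha>"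
proof (rule ccontr)
  assume neg: "\<not> ?thesis"
  \<comment> \<open>A violation at some larger penalty is also one at \<open>Suc n\<close>, because
    \<open>b\<close> is nonnegative.\<close>
  have "\<exists>x\<in>S. a x - real (Suc n) * b x \<ge> \<alpha>" for n
  proof -
    have "\<not> (\<forall>\<nu>\<ge>real (Suc n). \<forall>x\<in>S. a x - \<nu> * b x < \<alpha>)"
      using neg of_nat_0_less_iff by blast
    then obtain \<nu> x where \<nu>: "\<nu> \<ge> real (Suc n)" "x \<in> S" "a x - \<nu> * b x \<ge> \<alpha>"
      by (auto simp: not_less)
    then show ?thesis
      using mult_right_mono[OF \<nu>(1) nonneg[OF \<nu>(2)]] by (intro bexI[of _ x]) auto
  qed
  then obtain x where x: "\<And>n. x n \<in> S" "\<And>n. a (x n) - real (Suc n) * b (x n) \<ge> \<alpha>"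
    by metis
  obtain l r where l: "l \<in> S" and r: "strict_mono (r :: nat \<Rightarrow> nat)" and lim: "(x \<circ> r) \<longlonglongrightarrow> l"
    using S x(1) unfolding compact_def by blast
  have la: "(\<lambda>n. a (x (r n))) \<longlonglongrightarrow> a l"
    using continuous_on_tendsto_compose[OF a lim l] x(1) by (simp add: o_def)
  have lb: "(\<lambda>n. b (x (r n))) \<longlonglongrightarrow> b l"
    using continuous_on_tendsto_compose[OF b lim l] x(1) by (simp add: o_def)
  have "a (x n) \<ge> \<alpha>" for n
    using x(2)[of n] mult_nonneg_nonneg[OF of_nat_0_le_iff nonneg[OF x(1)[of n]], of "Suc n"] by linarith
  then have "a l \<ge> \<alpha>" using la by (intro LIMSEQ_le_const) auto
  have "b (x (r n)) \<le> (a (x (r n)) - \<alpha>) * inverse (real (Suc (r n)))" for n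
    using x(2)[of "r n"] by (simp add: field_simps)
  moreover have "(\<lambda>n. (a (x (r n)) - \<alpha>) * inverse (real (Suc (r n)))) \<longlonglongrightarrow> (a l - \<alpha>) * 0"
    using LIMSEQ_subseq_LIMSEQ[OF LIMSEQ_inverse_real_of_nat r]
    by (intro tendsto_intros la) (simp add: o_def)
  ultimately have "b l \<le> (a l - \<alpha>) * 0"
    using lb by (intro LIMSEQ_le[of "\<lambda>n. b (x (r n))"]) auto
  then have "b l = 0" using nonneg[OF l] by simp
  from less[OF l this] \<open>a l \<ge> \<alpha>\<close> show False by simp
qed

section \<open>Local gains and the decay rate of the linear field\<close>

lemma sum_local_out: "(\<Sum>i\<in>UNIV. local_out own i w) = w"
  for own :: "'p::finite \<Rightarrow> 'v::finite"
  by (simp add: local_out_def vec_eq_iff sum.If_cases)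

text \<open>Only columns \<open>r\<close> with \<open>own r = i\<close> survive, and there the
  factor \<open>\<zeta> $ i\<close> undoes the division by \<open>\<zeta> $ own r\<close>.\<close>

lemma scaled_gain_local_out:
  fixes own :: "'p::finite \<Rightarrow> 'v::finite"
  assumes "H = (\<chi> k r. M $ k $ r / \<zeta> $ own r)" and "\<zeta> $ i \<noteq> 0"
  shows "\<zeta> $ i *\<^sub>R (H *v local_out own i w) = M *v local_out own i w"
  unfolding vec_eq_iff assms(1) matrix_vector_mult_def
  by (simp add: sum_distrib_left) (intro allI sum.cong, auto simp: local_out_def assms(2))

lemma matrix_inv_cancel: "invertible M \<Longrightarrow> M ** matrix_inv M = mat 1"
  unfolding matrix_inv_def invertible_def by (rule someI2_ex) auto

lemma matrix_inv_cancel_pos_def: "pos_def P \<Longrightarrow> P ** matrix_inv P = mat 1"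
proof -
  assume P: "pos_def P"
  have "v = 0" if "P *v v = 0" for v
    using wip_eq_0_iff[OF P, of v] that by (simp add: wip_def)
  then have "invertible P"
    using matrix_left_invertible_ker invertible_left_inverse by blast
  then show ?thesis by (rule matrix_inv_cancel)
qed

lemma weighted_energy_sphere:
  fixes \<zeta> :: "real^'v::finite" and Pa :: "real^'n^'n"
  assumes P: "pos_def Pa" and pos: "\<And>i. \<zeta> $ i > 0"
  obtains m where "m > 0" "\<And>y i. (\<Sum>i\<in>UNIV. \<zeta> $ i * wip Pa (y i) (y i)) \<le> 1 \<Longrightarrow> weighted_norm Pa (y i) \<le> m"
proof -
  define z where "z = Min (range (($) \<zeta>))"
  have z: "z > 0" "\<And>i. z \<le> \<zeta> $ i" using pos by (auto simp: z_def)
  have "weighted_norm Pa (y i) \<le> 1 / sqrt z" if "(\<Sum>i\<in>UNIV. \<zeta> $ i * wip Pa (y i) (y i)) \<le> 1" for y i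
  proof -
    have "z * wip Pa (y i) (y i) \<le> \<zeta> $ i * wip Pa (y i) (y i)"
      by (intro mult_right_mono z wip_nonneg P)
    also have "\<dots> \<le> (\<Sum>i\<in>UNIV. \<zeta> $ i * wip Pa (y i) (y i))"
      using pos by (intro member_le_sum) (auto intro!: mult_nonneg_nonneg wip_nonneg[OF P] simp: less_imp_le)
    finally have "wip Pa (y i) (y i) \<le> 1 / z" using that z(1) by (simp add: field_simps)
    from real_sqrt_le_mono[OF this] show ?thesis by (simp add: weighted_norm_wip real_sqrt_divide)
  qed
  then show thesis using that[of "1 / sqrt z"] z(1) by simp
qed

text \<open>\<open>lmi\<close> is the matrix inequality in the limit \<open>\<mu> = 0\<close>, where
  its last term is \<open>2 \<rho> Pa\<close>; strictness is lost in the limit and regained by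
  \<open>\<beta> < \<rho>\<close>. The coupling is the penalty of \<open>compact_penalty\<close> and
  vanishes exactly on consensus.\<close>

lemma nominal_decay:
  fixes A Pa :: "real^'n^'n" and C :: "real^'n^'p" and own :: "'p \<Rightarrow> 'v::finite" and \<zeta> :: "real^'v"
  assumes P: "pos_def Pa" and loops: "irrefl E" and conn: "strongly_connected E"
    and null: "\<zeta> v* laplacian E = 0" and sum: "(\<Sum>i\<in>UNIV. \<zeta> $ i) = 1"
    and H: "H = (\<chi> k r. (matrix_inv Pa ** Y) $ k $ r / \<zeta> $ own r)"
    and lmi: "\<And>x. x \<bullet> ((Pa ** A + transpose A ** Pa + Y ** C + transpose C ** transpose Y) *v x)
      \<le> - 2 * \<rho> * wip Pa x x"
    and "\<beta> < \<rho>"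
  shows "\<exists>\<nu>0>0. \<forall>\<nu>\<ge>\<nu>0. \<forall>y. (\<Sum>i\<in>UNIV. \<zeta> $ i * wip Pa (y i) (y i)) = 1 \<longrightarrow>
    (\<Sum>i\<in>UNIV. \<zeta> $ i * wip Pa (y i) (linear_error_field A C own E H \<nu> y i)) < - \<beta>"
proof -
  have pos: "\<zeta> $ i > 0" for i by (rule left_null_vector_pos[OF loops conn null sum])
  let ?q = "\<lambda>y. \<Sum>i\<in>UNIV. \<zeta> $ i * wip Pa (y i) (y i)"
  let ?a = "\<lambda>y. \<Sum>i\<in>UNIV. \<zeta> $ i * wip Pa (y i) (A *v y i + H *v local_out own i (C *v y i))"
  let ?b = "\<lambda>y. (\<Sum>i\<in>UNIV. \<Sum>j\<in>UNIV. \<zeta> $ i * adj E i j * wip Pa (y i - y j) (y i - y j)) / 2"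
  define S where "S = {e :: real^('v \<times> 'n). ?q (blk e) = 1}"
  have cq: "continuous_on UNIV (\<lambda>e. ?q (blk e))"
    by (intro continuous_intros)
  have "closed S"
    using continuous_closed_preimage_constant[OF cq, of 1] by (simp add: S_def)
  moreover have "bounded S"
  proof -
    obtain m where m: "\<And>y i. (\<Sum>i\<in>UNIV. \<zeta> $ i * wip Pa (y i) (y i)) \<le> 1 \<Longrightarrow> weighted_norm Pa (y i) \<le> m"
      by (rule weighted_energy_sphere[OF P pos]) blast
    obtain c where c: "c > 0" "\<And>v. norm v \<le> c * weighted_norm Pa v"
      by (rule norm_le_weighted_norm[OF P]) blast
    have "norm e \<le> real CARD('v) * (c * m)" if "e \<in> S" for e
    proof (rule norm_le_blk)
      fix i
      have "weighted_norm Pa (blk e i) \<le> m" using that by (intro m) (simp add: S_def)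
      then have "c * weighted_norm Pa (blk e i) \<le> c * m" using c(1) by simp
      then show "norm (blk e i) \<le> c * m" using c(2)[of "blk e i"] by linarith
    qed
    then show ?thesis by (rule boundedI)
  qed
  ultimately have "compact S" by (simp add: compact_eq_bounded_closed)
  have nonneg: "\<zeta> $ i * adj E i j * wip Pa v v \<ge> 0" for i j v
    using pos[of i] wip_nonneg[OF P] by (simp add: adj_def)
  have diag: "?a (blk e) < - \<beta>" if e: "e \<in> S" and b: "?b (blk e) = 0" for e
  proof -
    have *: "\<forall>i j. \<zeta> $ i * adj E i j * wip Pa (blk e i - blk e j) (blk e i - blk e j) = 0"
      using b by (simp add: sum_nonneg_eq_0_iff sum_nonneg nonneg)
    have "blk e i = blk e j" if "(i, j) \<in> E" for i j
      using *[rule_format, of i j] that pos[of i] wip_eq_0_iff[OF P] by (simp add: adj_def)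
    note const = connected_const[OF conn this]
    define x where "x = blk e undefined"
    have x: "blk e i = x" for i unfolding x_def by (rule const)
    have q: "wip Pa x x = 1" using e sum by (simp add: S_def x flip: sum_distrib_right)
    have "?a (blk e) = (\<Sum>i\<in>UNIV. \<zeta> $ i * wip Pa x (A *v x)) + wip Pa x (\<Sum>i\<in>UNIV. \<zeta> $ i *\<^sub>R (H *v local_out own i (C *v x)))"
      by (simp add: x wip_bilin(2,8,12) distrib_left sum.distrib)
    \<comment> \<open>On consensus all nodes feed the same \<open>x\<close>, so the weighted local
      gains recombine to the full gain acting on the full output.\<close>
    also have "(\<Sum>i\<in>UNIV. \<zeta> $ i *\<^sub>R (H *v local_out own i (C *v x))) = (matrix_inv Pa ** Y) *v (C *v x)"
      using pos[THEN less_imp_neq, symmetric]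
      by (simp add: scaled_gain_local_out[OF H] sum_local_out
          linear_sum[OF matrix_vector_mul_linear, symmetric])
    also have "wip Pa x \<dots> = x \<bullet> (Y *v (C *v x))"
      by (simp add: wip_def matrix_vector_mul_assoc matrix_mul_assoc matrix_inv_cancel_pos_def[OF P])
    finally have a: "?a (blk e) = wip Pa x (A *v x) + x \<bullet> (Y *v (C *v x))"
      using sum by (simp flip: sum_distrib_right)
    have "x \<bullet> ((transpose C ** transpose Y) *v x) = x \<bullet> (Y *v (C *v x))"
      by (metis dot_lmul_matrix inner_commute matrix_vector_mul_assoc transpose_matrix_vector)
    then have "x \<bullet> ((Pa ** A + transpose A ** Pa + Y ** C + transpose C ** transpose Y) *v x)
        = 2 * wip Pa x (A *v x) + 2 * (x \<bullet> (Y *v (C *v x)))"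
      using wip_adjoint_form[OF pos_def_transpose[OF P], of x A]
      by (simp add: matrix_vector_mult_add_rdistrib inner_add_right matrix_vector_mul_assoc)
    then show ?thesis using lmi[of x] q a \<open>\<beta> < \<rho>\<close> by simp
  qed
  have ca: "continuous_on S (\<lambda>e. ?a (blk e))"
    by (intro continuous_intros linear_continuous_on_compose[OF _ linear_local_out]
        linear_continuous_on_compose[OF _ matrix_vector_mul_linear])
  have cb: "continuous_on S (\<lambda>e. ?b (blk e))"
    by (intro continuous_intros) auto
  obtain \<nu>0 where \<nu>0: "\<nu>0 > 0" "\<And>\<nu> e. \<nu> \<ge> \<nu>0 \<Longrightarrow> e \<in> S \<Longrightarrow> ?a (blk e) - \<nu> * ?b (blk e) < - \<beta>"
    using compact_penalty[OF \<open>compact S\<close> ca cb _ diag] by (auto simp: sum_nonneg nonneg)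
  show ?thesis
  proof (intro exI conjI allI impI)
    show "\<nu>0 > 0" by (rule \<nu>0)
    fix \<nu> :: real and y :: "'v \<Rightarrow> real^'n"
    assume \<nu>: "\<nu> \<ge> \<nu>0" and y: "?q y = 1"
    have "(\<Sum>i\<in>UNIV. \<zeta> $ i * wip Pa (y i) (linear_error_field A C own E H \<nu> y i))
        = ?a y + \<nu> * (\<Sum>i\<in>UNIV. \<zeta> $ i * wip Pa (y i) (consensus E y i))"
      by (simp add: linear_error_field_def wip_bilin(2,8) distrib_left sum.distrib sum_distrib_left mult_ac)
    also have "\<dots> = ?a y - \<nu> * ?b y"
      by (simp add: consensus_energy[OF P loops null])
    also have "\<dots> < - \<beta>"
      using \<nu>0(2)[OF \<nu>, of "stack y"] y by (simp add: S_def)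
    finally show "(\<Sum>i\<in>UNIV. \<zeta> $ i * wip Pa (y i) (linear_error_field A C own E H \<nu> y i)) < - \<beta>" .
  qed
qed

section \<open>Finite-time and nearly fixed-time stability\<close>

text \<open>At the first time with \<open>w = 1\<close> the negative derivative makes
  \<open>w\<close> exceed 1 just before, and the intermediate value theorem yields a still earlier
  such time. The derivative condition concerns positive \<open>s\<close> only, which matches the
  condition on \<open>\<gamma>\<close>.\<close>

lemma barrier:
  fixes w :: "real \<Rightarrow> real"
  assumes cont: "continuous_on {0..T} w" and start: "w 0 < 1"
    and dec: "\<And>s. 0 < s \<Longrightarrow> s \<le> T \<Longrightarrow> w s = 1 \<Longrightarrow> \<exists>d<0. (w has_real_derivative d) (at s within {0..T})"
    and t: "t \<in> {0..T}"
  shows "w t < 1"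
proof (rule ccontr)
  assume "\<not> w t < 1"
  then have wt: "w t \<ge> 1" by simp
  have ct: "continuous_on {0..t} w" using cont t by (auto intro: continuous_on_subset)
  define Z where "Z = {s \<in> {0..t}. w s = 1}"
  have "\<exists>s\<ge>0. s \<le> t \<and> w s = 1"
    by (rule IVT') (use start wt t ct in auto)
  then have "Z \<noteq> {}" by (auto simp: Z_def)
  moreover have "compact Z"
  proof -
    have "closed Z"
      unfolding Z_def using continuous_closed_preimage_constant[OF ct, of 1] by simp
    moreover have "bounded Z"
      by (rule bounded_subset[of "{0..t}"]) (auto simp: Z_def)
    ultimately show ?thesis by (simp add: compact_eq_bounded_closed)
  qed
  ultimately obtain s where s: "s \<in> Z" "\<And>r. r \<in> Z \<Longrightarrow> s \<le> r"
    using compact_attains_inf by metis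
  have "w s = 1" "0 \<le> s" "s \<le> T" "s \<le> t" using s(1) t by (auto simp: Z_def)
  then have "0 < s" using start by (cases "s = 0") auto
  obtain l where "l < 0" "(w has_real_derivative l) (at s within {0..T})"
    using dec[OF \<open>0 < s\<close> \<open>s \<le> T\<close> \<open>w s = 1\<close>] by blast
  then obtain d where d: "d > 0" "\<And>h. h > 0 \<Longrightarrow> s - h \<in> {0..T} \<Longrightarrow> h < d \<Longrightarrow> w s < w (s - h)"
    using has_real_derivative_neg_dec_left by metis
  define h where "h = min (d / 2) (s / 2)"
  have h: "0 < h" "h < d" "h < s" using d(1) \<open>0 < s\<close> by (auto simp: h_def min_def)
  have "w (s - h) > 1" using d(2)[of h] h \<open>w s = 1\<close> \<open>s \<le> T\<close> by simp
  moreover have "continuous_on {0..s - h} w"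
    using ct h \<open>s \<le> t\<close> by (auto intro: continuous_on_subset)
  ultimately have "\<exists>r\<ge>0. r \<le> s - h \<and> w r = 1"
    by (intro IVT') (use start h in auto)
  then obtain r where "0 \<le> r" "r \<le> s - h" "w r = 1" by blast
  then show False using s(2)[of r] h \<open>s \<le> t\<close> by (auto simp: Z_def)
qed

text \<open>Bookkeeping on the unit sphere: against the decay \<open>\<beta>\<close> of the linear
  field, the dilation generator costs \<open>c (1 + k)\<close>, the perturbation
  \<open>\<tau> (1 + \<delta> m)\<close>, and the nonlinear gains \<open>m\<close> times their
  deviation.\<close>

lemma (in homogeneous_observer) energy_decreases:
  fixes \<zeta> :: "real^'v"
  assumes zeta: "\<And>i. \<zeta> $ i \<ge> 0" "(\<Sum>i\<in>UNIV. \<zeta> $ i) = 1"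
    and y: "\<And>i. N (y i) \<le> m" "(\<Sum>i\<in>UNIV. \<zeta> $ i * wip Pa (y i) (y i)) = 1"
    and S: "\<And>i. norm (local_out own i (C *v y i)) \<le> exp S1" "\<And>i. N (consensus E y i) \<le> exp S2"
    and nominal: "(\<Sum>i\<in>UNIV. \<zeta> $ i * wip Pa (y i) (lin y i)) < - \<beta>"
    and p: "\<And>i. N (p i) \<le> \<tau> * (N (y i) + \<delta>)" "\<tau> \<ge> 0" "\<delta> \<ge> 0" and c: "c \<ge> 0"
    and budget: "c * (1 + k) + \<tau> * (1 + \<delta> * m)
      + m * (\<bar>\<mu>\<bar> * (cN * K * h * log_bound S1 + 2 * \<nu> * log_bound S2)) \<le> \<beta>"
  shows "(\<Sum>i\<in>UNIV. \<zeta> $ i * wip Pa (y i) (c *\<^sub>R (dil_gen \<mu> G0 *v y i) + fld y i + p i)) < 0"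
proof -
  define dev where "dev = \<bar>\<mu>\<bar> * (cN * K * h * log_bound S1 + 2 * \<nu> * log_bound S2)"
  have "wip Pa (y i) (c *\<^sub>R (dil_gen \<mu> G0 *v y i) + fld y i + p i)
      \<le> wip Pa (y i) (lin y i) + (c * (1 + k) + \<tau>) * wip Pa (y i) (y i) + (\<tau> * \<delta> * m + m * dev)" for i
  proof -
    have "wip Pa (y i) (dil_gen \<mu> G0 *v y i) \<le> (1 + k) * wip Pa (y i) (y i)"
      using dil_gen_bound[of "y i"] by (simp add: algebra_simps)
    then have 1: "c * wip Pa (y i) (dil_gen \<mu> G0 *v y i) \<le> c * ((1 + k) * wip Pa (y i) (y i))"
      using c by (rule mult_left_mono)
    have "wip Pa (y i) (p i) \<le> N (y i) * N (p i)"
      using wip_Cauchy_Schwarz[OF Pa, of "y i" "p i"] by simp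
    also have "\<dots> \<le> N (y i) * (\<tau> * (N (y i) + \<delta>))"
      by (intro mult_left_mono p weighted_norm_nonneg Pa)
    also have "\<dots> = \<tau> * wip Pa (y i) (y i) + \<tau> * \<delta> * N (y i)"
      by (simp add: weighted_norm_square[OF Pa, symmetric] power2_eq_square algebra_simps)
    also have "\<dots> \<le> \<tau> * wip Pa (y i) (y i) + \<tau> * \<delta> * m"
      using p by (intro add_left_mono mult_left_mono y) auto
    finally have 2: "wip Pa (y i) (p i) \<le> \<tau> * wip Pa (y i) (y i) + \<tau> * \<delta> * m" .
    have "wip Pa (y i) (fld y i - lin y i) \<le> N (y i) * N (fld y i - lin y i)"
      using wip_Cauchy_Schwarz[OF Pa, of "y i" "fld y i - lin y i"] by simp
    also have "\<dots> \<le> m * dev"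
      unfolding dev_def
      using y(1)[of i] weighted_norm_nonneg[OF Pa, of "y i"]
      by (intro mult_mono fld_deviation S y weighted_norm_nonneg Pa) simp
    finally have 3: "wip Pa (y i) (fld y i - lin y i) \<le> m * dev" .
    show ?thesis
      using 1 2 3 by (simp add: wip_bilin algebra_simps)
  qed
  then have "(\<Sum>i\<in>UNIV. \<zeta> $ i * wip Pa (y i) (c *\<^sub>R (dil_gen \<mu> G0 *v y i) + fld y i + p i))
      \<le> (\<Sum>i\<in>UNIV. \<zeta> $ i * (wip Pa (y i) (lin y i) + (c * (1 + k) + \<tau>) * wip Pa (y i) (y i) + (\<tau> * \<delta> * m + m * dev)))"
    by (intro sum_mono mult_left_mono zeta)
  also have "\<dots> = (\<Sum>i\<in>UNIV. \<zeta> $ i * wip Pa (y i) (lin y i))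
      + (c * (1 + k) + \<tau>) * (\<Sum>i\<in>UNIV. \<zeta> $ i * wip Pa (y i) (y i))
      + (\<tau> * \<delta> * m + m * dev) * (\<Sum>i\<in>UNIV. \<zeta> $ i)"
    by (simp add: distrib_left sum.distrib sum_distrib_left mult_ac)
  also have "\<dots> = (\<Sum>i\<in>UNIV. \<zeta> $ i * wip Pa (y i) (lin y i)) + (c * (1 + k) + \<tau> * (1 + \<delta> * m) + m * dev)"
    unfolding y(2) zeta(2) by (simp add: algebra_simps)
  also have "\<dots> < 0" using nominal budget unfolding dev_def by linarith
  finally show ?thesis .
qed

text \<open>\<open>contraction\<close> condenses the choice of constants: under perturbations of the
  size that \<open>\<gamma>\<close> allows, the rescaled error on the unit sphere moves inwards.
  \<open>c\<close> is the rate of the shrinking radius, and the \<open>log_bound\<close> term pays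
  for comparing homogeneous with weighted norms at single nodes.\<close>

locale contracting_observer = homogeneous_observer Pa G0 \<mu> \<kappa> A C own E H \<nu> K h cN
  for Pa G0 :: "real^'n^'n" and \<mu> \<kappa> :: real and A and C :: "real^'n^'p"
    and own :: "'p \<Rightarrow> 'v::finite" and E H \<nu> K h cN +
  fixes B :: "real^'m^'n" and \<zeta> :: "real^'v" and \<gamma> :: "real \<Rightarrow> real^'n \<Rightarrow> real^'n" and c \<tau> m :: real
  assumes loops: "irrefl E"
    and zeta: "\<And>i. \<zeta> $ i > 0" "(\<Sum>i\<in>UNIV. \<zeta> $ i) = 1"
    and m: "\<And>y i. (\<Sum>i\<in>UNIV. \<zeta> $ i * wip Pa (y i) (y i)) \<le> 1 \<Longrightarrow> weighted_norm Pa (y i) \<le> m" "m > 0"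
    and c: "c > 0" and tau: "\<tau> \<ge> 0" and mu: "\<mu> \<noteq> 0" "2 * (\<bar>\<mu>\<bar> + 2 * (\<bar>\<mu>\<bar> * \<kappa>)) \<le> 1 / 2"
    and gamma_cont: "continuous_on UNIV (\<lambda>(t, x). \<gamma> t x)"
    and gamma_bound: "\<And>t (xh :: real^('v \<times> 'n)) x. t > 0 \<Longrightarrow> xh \<noteq> stack (\<lambda>_. x) \<Longrightarrow>
        weighted_norm (weight_net Pa)
          (dil_net \<mu> G0 (- ln (net_norm \<mu> G0 Pa (xh - stack (\<lambda>_. x)))) *v mismatch \<gamma> t xh x)
        \<le> \<tau> * net_norm \<mu> G0 Pa (xh - stack (\<lambda>_. x)) powr \<mu>"
    and contraction: "\<And>y p. (\<Sum>i\<in>UNIV. \<zeta> $ i * wip Pa (y i) (y i)) = 1 \<Longrightarrow>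
        (\<And>i. weighted_norm Pa (p i) \<le> \<tau> * (weighted_norm Pa (y i)
            + 2 * (\<bar>\<mu>\<bar> + 2 * (\<bar>\<mu>\<bar> * \<kappa>)) * log_bound (ln m))) \<Longrightarrow>
        (\<Sum>i\<in>UNIV. \<zeta> $ i * wip Pa (y i)
          (c *\<^sub>R (dil_gen \<mu> G0 *v y i) + error_field A C own E G0 Pa H \<nu> \<mu> y i + p i)) < 0"
begin

abbreviation sys :: "(real \<Rightarrow> real^('v \<times> 'n) \<Rightarrow> real^('v \<times> 'n)) set" where
  "sys \<equiv> error_system A B C own E G0 Pa H \<nu> \<mu> \<gamma>"

definition energy :: "real \<Rightarrow> real^('v \<times> 'n) \<Rightarrow> real" where
  "energy r e = (\<Sum>i\<in>UNIV. \<zeta> $ i * wip Pa (D (- r) *v blk e i) (D (- r) *v blk e i))"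

text \<open>The solution of \<open>r' = - c e\<^sup>\<mu>\<^sup>r\<close> with \<open>r(0) = r0\<close>, that is \<open>R' = - c R\<^sup>1\<^sup>+\<^sup>\<mu>\<close> for \<open>R = e\<^sup>r\<close>;
  it exists as long as the argument of the logarithm is positive.\<close>

definition radius :: "real \<Rightarrow> real \<Rightarrow> real" where
  "radius r0 t = - (ln (exp (- \<mu> * r0) + c * \<mu> * t) / \<mu>)"

lemma radius_0: "radius r0 0 = r0"
  using mu by (simp add: radius_def)

lemma radius_derivative:
  assumes "exp (- \<mu> * r0) + c * \<mu> * t > 0"
  shows "(radius r0 has_real_derivative - (c * exp (\<mu> * radius r0 t))) (at t within S)"
proof -
  have "exp (\<mu> * radius r0 t) = inverse (exp (- \<mu> * r0) + c * \<mu> * t)"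
    using assms mu(1) by (simp add: radius_def exp_minus)
  moreover have "(radius r0 has_real_derivative - (c * \<mu> / (exp (- \<mu> * r0) + c * \<mu> * t) / \<mu>)) (at t within S)"
    unfolding radius_def[abs_def] using assms mu(1)
    by (auto intro!: derivative_eq_intros)
  moreover have "c * \<mu> / (exp (- \<mu> * r0) + c * \<mu> * t) / \<mu> = c * inverse (exp (- \<mu> * r0) + c * \<mu> * t)"
    using mu(1) by (simp add: divide_inverse)
  ultimately show ?thesis by (simp only:)
qed

lemma radius_le:
  assumes "exp (- \<mu> * r0) + c * \<mu> * t > 0" "t \<ge> 0"
  shows "radius r0 t \<le> r0"
proof (cases "\<mu> > 0")
  case True
  have "exp (- \<mu> * r0) \<le> exp (- \<mu> * r0) + c * \<mu> * t" using True c assms by simp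
  from ln_mono[OF this] have "- \<mu> * r0 \<le> ln (exp (- \<mu> * r0) + c * \<mu> * t)" by simp
  then show ?thesis using True by (simp add: radius_def field_simps)
next
  case False
  then have "\<mu> < 0" using mu(1) by simp
  then have "exp (- \<mu> * r0) + c * \<mu> * t \<le> exp (- \<mu> * r0)"
    using c assms by (simp add: mult_nonneg_nonpos mult_nonpos_nonneg)
  from ln_mono[OF this assms(1)] have "ln (exp (- \<mu> * r0) + c * \<mu> * t) \<le> - \<mu> * r0" by simp
  then show ?thesis using \<open>\<mu> < 0\<close> by (simp add: radius_def field_simps)
qed

lemma error_rhs_continuous:
  assumes "F \<in> sys" shows "continuous_on ({0..} \<times> UNIV) (\<lambda>(t, e). F t e)"
proof -
  obtain x u where F: "F = error_rhs A C own E G0 Pa H \<nu> \<mu> \<gamma> x"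
    and x: "solves_on (plant_rhs A B \<gamma> u) \<infinity> x"
    using assms by (auto simp: error_system_def)
  have "continuous_on {0..} x"
    unfolding continuous_on_eq_continuous_within
  proof
    fix t :: real assume t: "t \<in> {0..}"
    have "continuous_on {0..t + 1} x" by (rule solves_on_continuous[OF x]) simp
    then have "continuous (at t within {0..t + 1}) x" using t by (simp add: continuous_on_eq_continuous_within)
    moreover have "at t within {0..t + 1} = at t within {0..}"
      by (rule at_within_nhd[of t "{t - 1<..<t + 1}"]) auto
    ultimately show "continuous (at t within {0..}) x" by simp
  qed
  then have cx: "continuous_on ({0..} \<times> UNIV) (\<lambda>p :: real \<times> (real^('v \<times> 'n)). x (fst p))"
    by (rule continuous_on_compose2) (auto intro: continuous_intros)
  have cg: "continuous_on ({0..} \<times> UNIV) (\<lambda>p :: real \<times> (real^('v \<times> 'n)). \<gamma> (fst p) (f p))"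
    if "continuous_on ({0..} \<times> UNIV) f" for f
  proof -
    have "continuous_on ({0..} \<times> UNIV) (\<lambda>p :: real \<times> (real^('v \<times> 'n)). (fst p, f p))"
      using that by (intro continuous_on_Pair continuous_on_fst continuous_on_id)
    from continuous_on_compose2[OF gamma_cont this] show ?thesis by simp
  qed
  have cs: "continuous_on ({0..} \<times> UNIV) (\<lambda>p :: real \<times> (real^('v \<times> 'n)). snd p)"
    by (intro continuous_intros)
  have "continuous_on ({0..} \<times> UNIV) (\<lambda>p. blk (F (fst p) (snd p)) i)" for i
  proof -
    have "continuous_on ({0..} \<times> UNIV) (\<lambda>p :: real \<times> (real^('v \<times> 'n)). fld (blk (snd p)) i)"
      using continuous_on_compose2[OF continuous_on_fld cs] by simp
    then show ?thesis
      unfolding F blk_error_rhs[OF loops]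
      by (intro continuous_on_add continuous_on_diff cg cx continuous_on_blk cs)
  qed
  then have "continuous_on ({0..} \<times> UNIV) (\<lambda>p. \<chi> a. blk (F (fst p) (snd p)) (fst a) $ snd a)"
    by (intro continuous_on_vec_lambda continuous_on_component)
  then show ?thesis by (simp add: blk_def case_prod_unfold)
qed

text \<open>In the frame dilated by the radius, homogeneity pulls \<open>exp (\<mu> r)\<close> out
  of the field, and the equation for \<open>r\<close> gives the generator term the same factor. What
  remains is the expression in \<open>contraction\<close>, so \<open>barrier\<close>
  applies.\<close>

lemma energy_invariant:
  assumes F: "F \<in> sys" and sol: "solves_on F b e" and t: "t \<ge> 0" "ereal t < b"
    and arg: "exp (- \<mu> * r0) + c * \<mu> * t > 0" and start: "energy r0 (e 0) < 1"
  shows "energy (radius r0 t) (e t) < 1"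
proof -
  obtain x where F_eq: "F = error_rhs A C own E G0 Pa H \<nu> \<mu> \<gamma> x"
    using F by (auto simp: error_system_def)
  \<comment> \<open>The argument is affine in the time, so positivity at 0 and at \<open>t\<close>
    gives it in between.\<close>
  have arg': "exp (- \<mu> * r0) + c * \<mu> * s > 0" if "s \<in> {0..t}" for s
  proof (cases "\<mu> > 0")
    case True
    then show ?thesis using that c by (intro add_pos_nonneg) auto
  next
    case False
    have "c * \<mu> * t \<le> c * \<mu> * s"
      using False that c by (intro mult_left_mono_neg) (auto simp: mult_nonneg_nonpos)
    then show ?thesis using arg by linarith
  qed
  define y where "y i s = D (- radius r0 s) *v blk (e s) i" for i s
  define \<Gamma> where "\<Gamma> i s = \<gamma> s (blk (e s) i + x s) - \<gamma> s (x s)" for i s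
  \<comment> \<open>\<open>\<Gamma>\<close> carried to the dilated frame and divided by the common
    factor \<open>exp (\<mu> r)\<close>.\<close>
  define p where "p i s = exp (- \<mu> * radius r0 s) *\<^sub>R (D (- radius r0 s) *v \<Gamma> i s)" for i s
  let ?w = "\<lambda>s. \<Sum>i\<in>UNIV. \<zeta> $ i * wip Pa (y i s) (y i s)"
  have y_deriv: "(y i has_vector_derivative exp (\<mu> * radius r0 s) *\<^sub>R
      (c *\<^sub>R (dil_gen \<mu> G0 *v y i s) + fld (\<lambda>i. y i s) i + p i s)) (at s within {0..t})"
    if s: "s \<in> {0..t}" for i s
  proof -
    let ?r = "radius r0 s"
    have "(e has_vector_derivative F s (e s)) (at s within {0..t})"
      by (rule solves_on_has_vector_derivative[OF error_rhs_continuous[OF F] sol t(2) s])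
    from bounded_linear.has_vector_derivative[OF bounded_linear_blk this]
    have e': "((\<lambda>s. blk (e s) i) has_vector_derivative (fld (blk (e s)) i + \<Gamma> i s)) (at s within {0..t})"
      by (simp add: F_eq blk_error_rhs[OF loops] \<Gamma>_def)
    have r': "((\<lambda>s. - radius r0 s) has_real_derivative c * exp (\<mu> * ?r)) (at s within {0..t})"
      using DERIV_minus[OF radius_derivative[OF arg'[OF s]]] by simp
    have "blk (e s) = (\<lambda>i. D ?r *v y i s)"
      by (simp add: y_def)
    then have "D (- ?r) *v fld (blk (e s)) i = exp (\<mu> * ?r) *\<^sub>R fld (\<lambda>i. y i s) i"
      by (simp add: fld_dil matrix_vector_mult_scaleR)
    moreover have "D (- ?r) *v \<Gamma> i s = exp (\<mu> * ?r) *\<^sub>R p i s"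
      by (simp add: p_def flip: exp_add)
    ultimately show ?thesis
      using has_vector_derivative_dil[OF r' e']
      by (simp add: y_def[abs_def, symmetric] y_def[symmetric] matrix_vector_right_distrib scaleR_add_right add_ac mult.commute)
  qed
  \<comment> \<open>The nodewise condition speaks at the level \<open>\<sigma>\<close> of the node,
    the frame at the common level \<open>r\<close>; the dilation by \<open>\<sigma> - r\<close>
    between them brings in the term with \<open>k\<close>.\<close>
  have p_bound: "N (p i s) \<le> \<tau> * (N (y i s) + 2 * (\<bar>\<mu>\<bar> + 2 * k) * log_bound (ln m))"
    if "0 < s" "?w s = 1" for i s
  proof (cases "y i s = 0")
    case True
    then have "blk (e s) i = 0" by (simp add: y_def)
    then have "p i s = 0" by (simp add: p_def \<Gamma>_def)
    moreover have "2 * (\<bar>\<mu>\<bar> + 2 * k) * log_bound (ln m) \<ge> 0"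
      using k_nonneg log_bound_pos[of "ln m"] by simp
    ultimately show ?thesis using tau True by (simp add: weighted_norm_def)
  next
    case False
    let ?r = "radius r0 s"
    have e: "blk (e s) i \<noteq> 0" using False by (simp add: y_def)
    define \<sigma> where "\<sigma> = ln (hn (blk (e s) i))"
    have \<sigma>: "ln (hn (y i s)) = \<sigma> - ?r"
      using node_norm_pos[OF e] by (simp add: y_def node_norm_dil ln_mult \<sigma>_def)
    have "N (D (- \<sigma>) *v \<Gamma> i s) \<le> \<tau> * exp (\<mu> * \<sigma>)"
      unfolding \<sigma>_def \<Gamma>_def by (rule mismatch_bound_nodewise[OF gamma_bound e]) (rule \<open>0 < s\<close>)
    note \<Gamma> = this
    have "N (D (- ?r) *v \<Gamma> i s) \<le> exp ((\<sigma> - ?r) + k * \<bar>\<sigma> - ?r\<bar>) * N (D (- \<sigma>) *v \<Gamma> i s)"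
      using dil_upper[of "\<sigma> - ?r" "D (- \<sigma>) *v \<Gamma> i s"] by (simp flip: dil_add)
    also have "\<dots> \<le> exp ((\<sigma> - ?r) + k * \<bar>\<sigma> - ?r\<bar>) * (\<tau> * exp (\<mu> * \<sigma>))"
      by (intro mult_left_mono \<Gamma>) auto
    finally have "exp (- \<mu> * ?r) * N (D (- ?r) *v \<Gamma> i s)
        \<le> exp (- \<mu> * ?r) * (exp ((\<sigma> - ?r) + k * \<bar>\<sigma> - ?r\<bar>) * (\<tau> * exp (\<mu> * \<sigma>)))"
      by (intro mult_left_mono) auto
    also have "\<dots> = \<tau> * exp (\<sigma> - ?r + \<mu> * (\<sigma> - ?r) + k * \<bar>\<sigma> - ?r\<bar>)"
      by (simp add: right_diff_distrib exp_add exp_diff exp_minus field_simps)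
    also have "\<dots> \<le> \<tau> * (N (y i s) + 2 * (\<bar>\<mu>\<bar> + 2 * k) * log_bound (ln m))"
      unfolding \<sigma>[symmetric]
      using m(1)[of "\<lambda>i. y i s" i] that m(2)
      by (intro node_perturbation_bound mu tau False) simp
    finally show ?thesis by (simp add: p_def weighted_norm_scaleR[OF Pa])
  qed
  have w_deriv: "(?w has_real_derivative 2 * exp (\<mu> * radius r0 s) * (\<Sum>i\<in>UNIV. \<zeta> $ i * wip Pa (y i s)
      (c *\<^sub>R (dil_gen \<mu> G0 *v y i s) + fld (\<lambda>i. y i s) i + p i s))) (at s within {0..t})"
    if s: "s \<in> {0..t}" for s
  proof -
    let ?v = "\<lambda>i. c *\<^sub>R (dil_gen \<mu> G0 *v y i s) + fld (\<lambda>i. y i s) i + p i s"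
    have "((\<lambda>s. wip Pa (y i s) (y i s)) has_real_derivative
        2 * exp (\<mu> * radius r0 s) * wip Pa (y i s) (?v i)) (at s within {0..t})" for i
      using bounded_bilinear.has_vector_derivative[OF bounded_bilinear_wip[of Pa] y_deriv[OF s, of i] y_deriv[OF s, of i]]
        wip_commute[OF Pa, of "?v i" "y i s"]
      by (simp add: has_real_derivative_iff_has_vector_derivative wip_bilin(7,8) mult.assoc)
    from DERIV_sum[of UNIV, OF DERIV_cmult[OF this]] show ?thesis
      by (simp add: sum_distrib_left mult_ac)
  qed
  have "?w t < 1"
  proof (rule barrier[of t ?w])
    show "continuous_on {0..t} ?w"
      by (rule DERIV_continuous_on[OF w_deriv])
    show "?w 0 < 1" using start by (simp add: energy_def y_def radius_0)
    show "t \<in> {0..t}" using t by simp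
    fix s assume s: "0 < s" "s \<le> t" "?w s = 1"
    have "(\<Sum>i\<in>UNIV. \<zeta> $ i * wip Pa (y i s)
      (c *\<^sub>R (dil_gen \<mu> G0 *v y i s) + fld (\<lambda>i. y i s) i + p i s)) < 0"
      by (rule contraction[OF s(3) p_bound[OF s(1,3)]])
    then have neg: "2 * exp (\<mu> * radius r0 s) * (\<Sum>i\<in>UNIV. \<zeta> $ i * wip Pa (y i s)
      (c *\<^sub>R (dil_gen \<mu> G0 *v y i s) + fld (\<lambda>i. y i s) i + p i s)) < 0"
      by (intro mult_pos_neg) auto
    show "\<exists>d<0. (?w has_real_derivative d) (at s within {0..t})"
      using neg w_deriv[of s] s(1,2) by (meson atLeastAtMost_iff less_imp_le)
  qed
  then show ?thesis by (simp add: energy_def y_def)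
qed

section \<open>Energy levels against norms of the error\<close>

lemma energy_small:
  assumes "e = 0 \<or> ln (nn e) < r" shows "energy r e < 1"
proof (cases "e = 0")
  case True
  then show ?thesis by (simp add: energy_def wip_bilin)
next
  case False
  \<comment> \<open>Weights at most 1 put the energy below the squared network norm; here the
    homogeneous norm of the settling time meets the weights \<open>\<zeta>\<close>.\<close>
  have le1: "\<zeta> $ i \<le> 1" for i
    using member_le_sum[of i UNIV "($) \<zeta>"] zeta by (auto simp: less_imp_le)
  have "energy r e \<le> (\<Sum>i\<in>UNIV. (N (D (- r) *v blk e i))\<^sup>2)"
    unfolding energy_def weighted_norm_square[OF Pa]
    using le1 by (intro sum_mono mult_left_le_one_le wip_nonneg Pa) (auto simp: zeta less_imp_le)
  also have "\<dots> = (NN (dil_net \<mu> G0 (- r) *v e))\<^sup>2"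
    by (simp add: NN_blk blk_dil_net sum_nonneg)
  also have "\<dots> < 1\<^sup>2"
  proof (rule power_strict_mono)
    have "1 * NN (dil_net \<mu> G0 (- r) *v e) < exp ((- ln (nn e) - - r) / 2) * NN (dil_net \<mu> G0 (- r) *v e)"
      using assms False by (intro mult_strict_right_mono NN_pos) (auto simp: dil_net_eq_0_iff)
    also have "\<dots> \<le> NN (dil_net \<mu> G0 (- ln (nn e)) *v e)"
      using assms False by (intro dil_net_strict_mono) auto
    finally show "NN (dil_net \<mu> G0 (- r) *v e) < 1" using net_norm_unit[OF False] by simp
  qed (auto simp: NN_nonneg)
  finally show ?thesis by simp
qed

lemma energy_small_near_0: "\<exists>\<delta>>0. \<forall>e. norm e < \<delta> \<longrightarrow> energy r e < 1"
proof -
  have "continuous_on UNIV (energy r)"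
    unfolding energy_def[abs_def]
    by (intro continuous_intros linear_continuous_on_compose[OF _ matrix_vector_mul_linear])
  then have "isCont (energy r) 0" by (simp add: continuous_on_eq_continuous_at)
  moreover have "energy r 0 = 0" by (simp add: energy_def wip_bilin)
  ultimately obtain d where "d > 0" "\<And>e. norm e < d \<Longrightarrow> \<bar>energy r e\<bar> < 1"
    unfolding continuous_at_eps_delta by (metis dist_0_norm dist_real_def diff_zero dist_commute zero_less_one)
  then show ?thesis by (metis abs_less_iff)
qed

lemma energy_mono:
  assumes "r \<le> r'" shows "energy r' e \<le> energy r e"
  unfolding energy_def weighted_norm_square[OF Pa, symmetric]
proof (intro sum_mono mult_left_mono power_mono weighted_norm_nonneg Pa)
  fix i
  show "N (D (- r') *v blk e i) \<le> N (D (- r) *v blk e i)"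
  proof (cases "r = r'")
    case False
    have "1 * N (D (- r') *v blk e i) \<le> exp ((- r - - r') / 2) * N (D (- r') *v blk e i)"
      using assms by (intro mult_right_mono weighted_norm_nonneg Pa) auto
    also have "\<dots> \<le> N (D (- r) *v blk e i)"
      using assms False by (intro dil_strict_mono) auto
    finally show ?thesis by simp
  qed simp
qed (simp add: zeta less_imp_le)

lemma energy_norm_bound:
  obtains M where "M > 0" "\<And>r r' e. energy r e \<le> 1 \<Longrightarrow> r \<le> r' \<Longrightarrow> norm e \<le> M * exp (max (r' / 2) (2 * r'))"
proof -
  obtain a where a: "a > 0" "\<And>v. norm v \<le> a * N v" by (rule norm_le_weighted_norm[OF Pa]) blast
  define M where "M = real CARD('v) * (a * m)"
  have "norm e \<le> M * exp (max (r' / 2) (2 * r'))" if e: "energy r e \<le> 1" and r: "r \<le> r'" for r r' e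
  proof -
    have "energy r' e \<le> 1" using energy_mono[OF r, of e] e by simp
    then have y: "N (D (- r') *v blk e i) \<le> m" for i
      unfolding energy_def by (rule m)
    have "norm (blk e i) \<le> a * (exp (max (r' / 2) (2 * r')) * m)" for i
    proof -
      have "k * \<bar>r'\<bar> \<le> 1 / 2 * \<bar>r'\<bar>" by (intro mult_right_mono mu_kappa) simp
      \<comment> \<open>The left side is at most \<open>r' / 2\<close> for negative and
        \<open>3 r' / 2\<close> for nonnegative \<open>r'\<close>; the maximum covers both
        signs.\<close>
      then have "r' + k * \<bar>r'\<bar> \<le> max (r' / 2) (2 * r')" by (cases "r' \<ge> 0") auto
      have "N (blk e i) = N (D r' *v (D (- r') *v blk e i))" by simp
      also have "\<dots> \<le> exp (r' + k * \<bar>r'\<bar>) * N (D (- r') *v blk e i)" by (rule dil_upper)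
      also have "\<dots> \<le> exp (max (r' / 2) (2 * r')) * m"
        using \<open>r' + k * \<bar>r'\<bar> \<le> max (r' / 2) (2 * r')\<close> by (intro mult_mono y weighted_norm_nonneg Pa) auto
      finally have "a * N (blk e i) \<le> a * (exp (max (r' / 2) (2 * r')) * m)" using a(1) by simp
      then show ?thesis using a(2)[of "blk e i"] by linarith
    qed
    from norm_le_blk[OF this] show ?thesis by (simp add: M_def mult_ac)
  qed
  moreover have "M > 0" using a m by (simp add: M_def)
  ultimately show thesis using that by blast
qed

text \<open>The radius started at \<open>r0\<close> may run out before \<open>t\<close>. Enlarging
  the start to \<open>r1\<close>, whose radius runs out exactly at \<open>t\<close>, keeps
  \<open>e 0\<close> inside the ball, and \<open>s\<close> tending to \<open>t\<close> from the left
  gives the claim. As \<open>t\<close> is any late time, the error also stays at 0.\<close>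

lemma vanishes_after:
  assumes "\<mu> < 0" and F: "F \<in> sys" and sol: "solves_on F b e" and t: "t > 0" "ereal t < b"
    and start: "energy r0 (e 0) < 1" and late: "exp (- \<mu> * r0) \<le> c * - \<mu> * t"
  shows "e t = 0"
proof -
  define r1 where "r1 = ln (c * - \<mu> * t) / - \<mu>"
  have pos: "c * - \<mu> * t > 0" using c \<open>\<mu> < 0\<close> t by (intro mult_pos_pos) auto
  have r1: "exp (- \<mu> * r1) = c * - \<mu> * t"
    using pos \<open>\<mu> < 0\<close> by (simp add: r1_def)
  have "exp (- \<mu> * r0) \<le> exp (- \<mu> * r1)" using late unfolding r1 .
  then have "r0 \<le> r1" using \<open>\<mu> < 0\<close> by simp
  then have start': "energy r1 (e 0) < 1" using energy_mono[of r0 r1 "e 0"] start by simp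
  obtain M where M: "M > 0" "\<And>r r' e. energy r e \<le> 1 \<Longrightarrow> r \<le> r' \<Longrightarrow> norm e \<le> M * exp (max (r' / 2) (2 * r'))"
    by (rule energy_norm_bound) blast
  \<comment> \<open>This is \<open>exp (- \<mu> * radius r1 s)\<close>, which is linear in
    \<open>s\<close> with its zero at \<open>t\<close>.\<close>
  define x where "x s = c * - \<mu> * (t - s)" for s
  have x0: "(x \<longlongrightarrow> 0) (at_left t)"
  proof -
    have "(x \<longlongrightarrow> x t) (at_left t)" unfolding x_def by (intro tendsto_intros)
    then show ?thesis by (simp add: x_def)
  qed
  have bound: "norm (e s) \<le> M * x s powr (1 / (2 * - \<mu>))" if s: "0 \<le> s" "s < t" "x s < 1" for s
  proof -
    have xs: "x s = exp (- \<mu> * r1) + c * \<mu> * s" unfolding r1 by (simp add: x_def algebra_simps)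
    have "x s > 0" using s c \<open>\<mu> < 0\<close> unfolding x_def by (intro mult_pos_pos) auto
    have "ereal s < b" using s t less_trans[of "ereal s" "ereal t" b] by simp
    with energy_invariant[OF F sol _ _ _ start', of s] \<open>x s > 0\<close> s
    have "energy (radius r1 s) (e s) \<le> 1" unfolding xs by simp
    from M(2)[OF this order_refl]
    have "norm (e s) \<le> M * exp (max (radius r1 s / 2) (2 * radius r1 s))" .
    moreover have "radius r1 s = ln (x s) / - \<mu>" by (simp add: radius_def xs)
    moreover have "ln (x s) / - \<mu> \<le> 0"
      using \<open>\<mu> < 0\<close> \<open>x s > 0\<close> s by (intro divide_nonpos_pos) auto
    moreover have "max (r / 2) (2 * r) = r / 2" if "r \<le> 0" for r :: real using that by simp
    ultimately have "norm (e s) \<le> M * exp (ln (x s) / - \<mu> / 2)" by metis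
    then show ?thesis using \<open>x s > 0\<close> by (simp add: powr_def mult.commute)
  qed
  have "((\<lambda>s. norm (e s)) \<longlongrightarrow> 0) (at_left t)"
  proof (rule tendsto_sandwich[OF _ _ tendsto_const])
    have "\<forall>\<^sub>F s in at_left t. x s < 1" by (rule order_tendstoD[OF x0]) simp
    moreover have "\<forall>\<^sub>F s in at_left t. s \<in> {0<..<t}"
      using t by (intro eventually_at_leftI[of 0]) auto
    ultimately show "\<forall>\<^sub>F s in at_left t. norm (e s) \<le> M * x s powr (1 / (2 * - \<mu>))"
    proof eventually_elim
      case (elim s)
      then show ?case by (intro bound) auto
    qed
    have "\<forall>\<^sub>F s in at_left t. s \<in> {0<..<t}"
      using t by (intro eventually_at_leftI[of 0]) auto
    then have "\<forall>\<^sub>F s in at_left t. 0 \<le> x s"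
      by eventually_elim (use c \<open>\<mu> < 0\<close> in \<open>auto simp: x_def mult_nonneg_nonpos mult_nonpos_nonneg\<close>)
    then have "((\<lambda>s. x s powr (1 / (2 * - \<mu>))) \<longlongrightarrow> 0) (at_left t)"
      using \<open>\<mu> < 0\<close> by (intro tendsto_zero_powrI[OF x0 tendsto_const]) (auto simp: divide_simps)
    from tendsto_mult_right_zero[OF this, of M]
    show "((\<lambda>s. M * x s powr (1 / (2 * - \<mu>))) \<longlongrightarrow> 0) (at_left t)" .
  qed simp
  moreover have "((\<lambda>s. norm (e s)) \<longlongrightarrow> norm (e t)) (at_left t)"
  proof -
    have "continuous_on {0..t} e" by (rule solves_on_continuous[OF sol t(2)])
    then have "(e \<longlongrightarrow> e t) (at t within {0..t})" using t by (simp add: continuous_on)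
    moreover have "at t within {0..t} = at_left t" using t by (intro at_within_Icc_at_left)
    ultimately show ?thesis by (intro tendsto_norm) simp
  qed
  ultimately have "norm (e t) = 0"
    using tendsto_unique[OF trivial_limit_at_left_real] by metis
  then show ?thesis by simp
qed

section \<open>Completeness and stability of the error system\<close>

lemma bounded_on_finite_interval:
  assumes F: "F \<in> sys" and sol: "solves_on F (ereal b) e"
  shows "\<exists>R. \<forall>t\<in>{0..<b}. norm (e t) \<le> R"
proof -
  obtain M where M: "M > 0" "\<And>r r' e. energy r e \<le> 1 \<Longrightarrow> r \<le> r' \<Longrightarrow> norm e \<le> M * exp (max (r' / 2) (2 * r'))"
    by (rule energy_norm_bound) blast
  have "b > 0" using sol by (simp add: solves_on_def)
  \<comment> \<open>The first entry leaves strict room above the level of \<open>e 0\<close>. For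
    negative \<open>\<mu>\<close> the radius must also outlast the interval, and the second entry
    makes \<open>exp (- \<mu> * r0)\<close> exceed \<open>c * - \<mu> * b\<close>.\<close>
  define r0 where "r0 = max (ln (nn (e 0)) + 1) (if \<mu> < 0 then ln (c * - \<mu> * b + 1) / - \<mu> else 0)"
  have start: "energy r0 (e 0) < 1" by (rule energy_small) (simp add: r0_def less_max_iff_disj)
  have arg: "exp (- \<mu> * r0) + c * \<mu> * t > 0" if t: "t \<in> {0..<b}" for t
  proof (cases "\<mu> < 0")
    case True
    have "c * - \<mu> * b > 0" using c True \<open>b > 0\<close> by (intro mult_pos_pos) auto
    have "ln (c * - \<mu> * b + 1) / - \<mu> \<le> r0" using True by (simp add: r0_def)
    then have "ln (c * - \<mu> * b + 1) \<le> - \<mu> * r0" using True by (simp add: field_simps)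
    then have "exp (ln (c * - \<mu> * b + 1)) \<le> exp (- \<mu> * r0)" by (simp only: exp_le_cancel_iff)
    moreover have "exp (ln (c * - \<mu> * b + 1)) = c * - \<mu> * b + 1"
      using \<open>c * - \<mu> * b > 0\<close> by (intro exp_ln) linarith
    moreover have "c * - \<mu> * t \<le> c * - \<mu> * b" using True c t by (intro mult_left_mono) (auto simp: mult_nonneg_nonpos)
    ultimately show ?thesis by linarith
  next
    case False
    then show ?thesis using c t by (intro add_pos_nonneg) auto
  qed
  have "norm (e t) \<le> M * exp (max (r0 / 2) (2 * r0))" if t: "t \<in> {0..<b}" for t
  proof (rule M(2))
    show "energy (radius r0 t) (e t) \<le> 1"
      using energy_invariant[OF F sol _ _ arg[OF t] start] t by simp
    show "radius r0 t \<le> r0" using arg[OF t] t by (intro radius_le) auto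
  qed
  then show ?thesis by blast
qed

lemma error_system_forward_complete: "forward_complete sys"
  by (rule forward_completeI[OF error_rhs_continuous bounded_on_finite_interval])

lemma error_system_lyapunov_stable: "lyapunov_stable sys"
  unfolding lyapunov_stable_def
proof (intro allI impI)
  fix \<epsilon> :: real assume "\<epsilon> > 0"
  obtain M where M: "M > 0" "\<And>r r' e. energy r e \<le> 1 \<Longrightarrow> r \<le> r' \<Longrightarrow> norm e \<le> M * exp (max (r' / 2) (2 * r'))"
    by (rule energy_norm_bound) blast
  \<comment> \<open>A level whose ball lies within norm \<open>\<epsilon> / 2\<close>: for
    \<open>r0 \<le> 0\<close> the maximum in the bound is \<open>r0 / 2\<close>.\<close>
  define r0 where "r0 = min 0 (2 * ln (\<epsilon> / (2 * M)))"
  have "exp (max (r0 / 2) (2 * r0)) \<le> exp (ln (\<epsilon> / (2 * M)))"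
    by (simp add: r0_def)
  then have "M * exp (max (r0 / 2) (2 * r0)) \<le> \<epsilon> / 2"
    using M(1) \<open>\<epsilon> > 0\<close> by (simp add: field_simps)
  then have small: "M * exp (max (r0 / 2) (2 * r0)) < \<epsilon>" using \<open>\<epsilon> > 0\<close> by simp
  obtain d where d: "d > 0" "\<And>e. norm e < d \<Longrightarrow> energy r0 e < 1"
    using energy_small_near_0 by blast
  show "\<exists>\<delta>>0. \<forall>F\<in>sys. \<forall>b x. maximal_solution F b x \<and> norm (x 0) < \<delta> \<longrightarrow>
      (\<forall>t\<ge>0. ereal t < b \<longrightarrow> norm (x t) < \<epsilon>)"
  proof (intro exI conjI ballI allI impI)
    show "d > 0" by (rule d)
    fix F b e t assume F: "F \<in> sys" and e: "maximal_solution F b e \<and> norm (e 0) < d"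
      and t: "t \<ge> 0" "ereal t < b"
    have sol: "solves_on F b e" using e by (simp add: maximal_solution_def)
    have start: "energy r0 (e 0) < 1" using d e by simp
    show "norm (e t) < \<epsilon>"
    proof (cases "exp (- \<mu> * r0) + c * \<mu> * t > 0")
      case True
      have "norm (e t) \<le> M * exp (max (r0 / 2) (2 * r0))"
        using energy_invariant[OF F sol t True start] radius_le[OF True t(1)] by (intro M(2)) auto
      then show ?thesis using small by simp
    next
      \<comment> \<open>The radius has run out, which happens only for negative
        \<open>\<mu>\<close>, and by then the error is 0.\<close>
      case False
      have "\<mu> < 0"
      proof (rule ccontr)
        assume "\<not> \<mu> < 0"
        then have "c * \<mu> * t \<ge> 0" using c t by simp
        then show False using False by (smt (verit) exp_gt_zero)
      qed
      moreover have "t > 0" using t False by (cases "t = 0") auto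
      moreover have "exp (- \<mu> * r0) \<le> c * - \<mu> * t" using False by simp
      ultimately have "e t = 0" using vanishes_after[OF _ F sol _ t(2) start] by blast
      then show ?thesis using \<open>\<epsilon> > 0\<close> by simp
    qed
  qed
qed

text \<open>A rate \<open>q\<close> strictly below \<open>c\<close> leaves the room that
  \<open>energy_small\<close> asks for between the level of \<open>e 0\<close> and the level whose
  radius runs out at \<open>t\<close>.\<close>

lemma error_system_finite_time_stable:
  assumes "\<mu> < 0" and q: "0 < q" "q < c"
  shows "finite_time_stable sys (\<lambda>e. nn e powr (- \<mu>) / (q * - \<mu>))"
proof -
  let ?T = "\<lambda>e :: real^('v \<times> 'n). nn e powr (- \<mu>) / (q * - \<mu>)"
  have qmu: "q * - \<mu> > 0" using q \<open>\<mu> < 0\<close> by (simp add: mult_neg_neg mult_pos_neg)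
  have "locally_bounded ?T"
    unfolding locally_bounded_def
  proof
    fix e :: "real^('v \<times> 'n)"
    obtain V where V: "\<And>e' :: real^('v \<times> 'n). norm e' \<le> norm e + 1 \<Longrightarrow> nn e' \<le> V"
      by (rule net_norm_bounded[of "norm e + 1"]) blast
    have "\<bar>?T e'\<bar> \<le> V powr (- \<mu>) / (q * - \<mu>)" if "e' \<in> ball e 1" for e'
    proof -
      have "norm e' \<le> norm e + 1"
        using that norm_triangle_sub[of e' e] by (simp add: dist_norm norm_minus_commute)
      then have "nn e' powr (- \<mu>) \<le> V powr (- \<mu>)"
        using \<open>\<mu> < 0\<close> by (intro powr_mono2 V net_norm_nonneg) auto
      then have "?T e' \<le> V powr (- \<mu>) / (q * - \<mu>)"
        using qmu by (intro divide_right_mono) auto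
      moreover have "?T e' \<ge> 0" using qmu by (intro divide_nonneg_pos) auto
      ultimately show ?thesis by (simp only: abs_of_nonneg)
    qed
    then have "bounded (?T ` ball e 1)" by (intro boundedI) auto
    then show "\<exists>U. open U \<and> e \<in> U \<and> bounded (?T ` U)"
      by (intro exI[of _ "ball e 1"]) auto
  qed
  moreover have "e t = 0" if F: "F \<in> sys" and max: "maximal_solution F b e" and t: "t \<ge> ?T (e 0)" for F b e t
  proof -
    have sol: "solves_on F b e" using max by (simp add: maximal_solution_def)
    have "b = \<infinity>" using error_system_forward_complete F max by (auto simp: forward_complete_def)
    have "?T (e 0) \<ge> 0" using qmu by (intro divide_nonneg_pos) auto
    then have "t \<ge> 0" using t by simp
    show ?thesis
    proof (cases "t = 0")
      \<comment> \<open>No time has passed here: the settling time is 0 only for a zero initial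
        error.\<close>
      case True
      have "nn (e 0) powr (- \<mu>) \<le> 0"
        using t qmu by (simp add: True field_simps)
      then have "nn (e 0) = 0" by (simp add: powr_def split: if_splits)
      then show ?thesis using net_norm_pos[of "e 0"] True by (cases "e 0 = 0") auto
    next
      case False
      then have "t > 0" using \<open>t \<ge> 0\<close> by simp
      define r0 where "r0 = ln (c * - \<mu> * t) / - \<mu>"
      have pos: "c * - \<mu> * t > 0" using c \<open>\<mu> < 0\<close> \<open>t > 0\<close> by (intro mult_pos_pos) auto
      have r0: "exp (- \<mu> * r0) = c * - \<mu> * t"
        using pos \<open>\<mu> < 0\<close> by (simp add: r0_def)
      have "e 0 = 0 \<or> ln (nn (e 0)) < r0"
      proof (cases "e 0 = 0")
        case False
        have "nn (e 0) powr (- \<mu>) \<le> t * (q * - \<mu>)"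
          using t qmu by (simp only: pos_divide_le_eq)
        also have "\<dots> < c * - \<mu> * t"
        proof -
          have "q * (- \<mu> * t) < c * (- \<mu> * t)"
            using q \<open>\<mu> < 0\<close> \<open>t > 0\<close> by (intro mult_strict_right_mono) (auto simp: mult_neg_pos)
          then show ?thesis by (simp add: mult_ac)
        qed
        finally have "exp (- \<mu> * ln (nn (e 0))) < exp (- \<mu> * r0)"
          unfolding r0 using net_norm_pos[OF False] by (simp add: powr_def)
        then show ?thesis using \<open>\<mu> < 0\<close> by simp
      qed simp
      then have "energy r0 (e 0) < 1" by (rule energy_small)
      then show ?thesis
        using vanishes_after[OF \<open>\<mu> < 0\<close> F sol \<open>t > 0\<close>, of r0] r0 \<open>b = \<infinity>\<close> by simp
    qed
  qed
  moreover have "?T e \<ge> 0" for e using qmu by (intro divide_nonneg_pos) auto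
  ultimately show ?thesis
    unfolding finite_time_stable_def
    using error_system_forward_complete error_system_lyapunov_stable by blast
qed

text \<open>For positive \<open>\<mu>\<close>, \<open>exp (- \<mu> * radius r0 t)\<close> is at
  least \<open>c * \<mu> * t\<close> whatever \<open>r0\<close> is; \<open>T\<close> is the time at
  which this alone brings the level down to \<open>r1\<close>.\<close>

lemma error_system_nearly_fixed_time_stable:
  assumes "\<mu> > 0" shows "nearly_fixed_time_stable sys"
  unfolding nearly_fixed_time_stable_def
proof (intro conjI error_system_forward_complete error_system_lyapunov_stable allI impI)
  fix \<epsilon> :: real assume "\<epsilon> > 0"
  obtain M where M: "M > 0" "\<And>r r' e. energy r e \<le> 1 \<Longrightarrow> r \<le> r' \<Longrightarrow> norm e \<le> M * exp (max (r' / 2) (2 * r'))"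
    by (rule energy_norm_bound) blast
  define r1 where "r1 = min 0 (2 * ln (\<epsilon> / (2 * M)))"
  have "exp (max (r1 / 2) (2 * r1)) \<le> exp (ln (\<epsilon> / (2 * M)))"
    by (simp add: r1_def)
  then have "M * exp (max (r1 / 2) (2 * r1)) \<le> \<epsilon> / 2"
    using M(1) \<open>\<epsilon> > 0\<close> by (simp add: field_simps)
  then have small: "M * exp (max (r1 / 2) (2 * r1)) < \<epsilon>" using \<open>\<epsilon> > 0\<close> by simp
  define T where "T = exp (- \<mu> * r1) / (c * \<mu>)"
  have "T > 0" using c assms by (simp add: T_def)
  have "norm (e t) < \<epsilon>" if F: "F \<in> sys" and max: "maximal_solution F b e" and t: "t \<ge> T" for F b e t
  proof -
    have sol: "solves_on F b e" using max by (simp add: maximal_solution_def)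
    have "b = \<infinity>" using error_system_forward_complete F max by (auto simp: forward_complete_def)
    have "t > 0" using t \<open>T > 0\<close> by simp
    define r0 where "r0 = ln (nn (e 0)) + 1"
    have start: "energy r0 (e 0) < 1" by (rule energy_small) (simp add: r0_def)
    have arg: "exp (- \<mu> * r1) \<le> exp (- \<mu> * r0) + c * \<mu> * t"
    proof -
      have "exp (- \<mu> * r1) \<le> c * \<mu> * t"
        using t c assms by (simp add: T_def field_simps)
      then show ?thesis using exp_ge_zero[of "- \<mu> * r0"] by linarith
    qed
    then have pos: "exp (- \<mu> * r0) + c * \<mu> * t > 0" using exp_gt_zero[of "- \<mu> * r1"] by linarith
    have "- \<mu> * r1 \<le> ln (exp (- \<mu> * r0) + c * \<mu> * t)"
      using ln_mono[OF arg] by simp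
    then have "radius r0 t \<le> r1" using assms by (simp add: radius_def field_simps)
    moreover have "energy (radius r0 t) (e t) \<le> 1"
      using energy_invariant[OF F sol _ _ pos start] \<open>t > 0\<close> \<open>b = \<infinity>\<close> by simp
    ultimately have "norm (e t) \<le> M * exp (max (r1 / 2) (2 * r1))" by (intro M(2))
    then show ?thesis using small by simp
  qed
  then show "\<exists>Tr>0. \<forall>F\<in>sys. \<forall>b x. maximal_solution F b x \<longrightarrow> (\<forall>t\<ge>Tr. norm (x t) < \<epsilon>)"
    using \<open>T > 0\<close> by blast
qed

end

text \<open>Tested at \<open>x\<close>, the form of the matrix inequality tends to
  \<open>x \<bullet> (M *v x) + 2 \<rho> wip Pa x x\<close> as \<open>\<mu>\<close> tends to 0, and
  a positive limit excludes negative definiteness for all small \<open>\<mu>\<close>. The summand 1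
  in \<open>q\<close> keeps the quotient \<open>\<mu>0\<close> defined.\<close>

lemma lmi_limit:
  fixes Pa G0 M :: "real^'n^'n"
  assumes P: "pos_def Pa" and "\<rho> > 0" and x: "x \<bullet> (M *v x) > - 2 * \<rho> * wip Pa x x"
  shows "\<exists>\<mu>0>0. \<forall>\<mu>. \<bar>\<mu>\<bar> < \<mu>0 \<longrightarrow>
    \<not> neg_def (M + \<rho> *\<^sub>R (Pa ** dil_gen \<mu> G0 + transpose (dil_gen \<mu> G0) ** Pa))"
proof -
  define gap where "gap = x \<bullet> (M *v x) + 2 * \<rho> * wip Pa x x"
  define q where "q = \<bar>wip Pa x (G0 *v x)\<bar> + 1"
  have "q > 0" by (simp add: q_def)
  define \<mu>0 where "\<mu>0 = gap / (2 * \<rho> * q)"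
  have "gap > 0" using x by (simp add: gap_def)
  then have "\<mu>0 > 0" using \<open>\<rho> > 0\<close> \<open>q > 0\<close> by (simp add: \<mu>0_def)
  have "x \<noteq> 0" using x by (auto simp: wip_bilin)
  have False if "\<bar>\<mu>\<bar> < \<mu>0"
      and neg: "neg_def (M + \<rho> *\<^sub>R (Pa ** dil_gen \<mu> G0 + transpose (dil_gen \<mu> G0) ** Pa))" for \<mu>
  proof -
    let ?S = "Pa ** dil_gen \<mu> G0 + transpose (dil_gen \<mu> G0) ** Pa"
    have "x \<bullet> (- (M + \<rho> *\<^sub>R ?S) *v x) > 0"
      using neg \<open>x \<noteq> 0\<close> by (simp add: pos_def_on_def)
    also have "- (M + \<rho> *\<^sub>R ?S) *v x = - (M *v x) - \<rho> *\<^sub>R (?S *v x)"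
      using scaleR_matrix_vector_assoc[of "-1" "M + \<rho> *\<^sub>R ?S" x]
      by (simp add: matrix_vector_mult_add_rdistrib flip: scaleR_matrix_vector_assoc)
    finally have "x \<bullet> (M *v x) + \<rho> * (x \<bullet> (?S *v x)) < 0"
      by (simp add: inner_diff_right)
    then have "x \<bullet> (M *v x) + \<rho> * (2 * wip Pa x (dil_gen \<mu> G0 *v x)) < 0"
      unfolding wip_adjoint_form[OF pos_def_transpose[OF P]] .
    then have "gap < 2 * \<rho> * (- \<mu> * wip Pa x (G0 *v x))"
      by (simp add: gap_def dil_gen_def matrix_vector_mult_add_rdistrib wip_bilin algebra_simps
          flip: scaleR_matrix_vector_assoc)
    also have "\<dots> \<le> 2 * \<rho> * (\<mu>0 * q)"
    proof (intro mult_left_mono)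
      have "- \<mu> * wip Pa x (G0 *v x) \<le> \<bar>\<mu>\<bar> * \<bar>wip Pa x (G0 *v x)\<bar>"
        using abs_ge_self[of "- \<mu> * wip Pa x (G0 *v x)"] by (simp add: abs_mult)
      also have "\<dots> \<le> \<mu>0 * q"
        using that by (intro mult_mono) (auto simp: q_def)
      finally show "- \<mu> * wip Pa x (G0 *v x) \<le> \<mu>0 * q" .
    qed (use \<open>\<rho> > 0\<close> in simp)
    also have "\<dots> = gap" using \<open>\<rho> > 0\<close> \<open>q > 0\<close> by (simp add: \<mu>0_def)
    finally show False by simp
  qed
  then show ?thesis using \<open>\<mu>0 > 0\<close> by blast
qed

lemma matrix_norm_bound:
  obtains K where "K > 0" "\<And>v. norm ((M :: real^'n^'m) *v v) \<le> K * norm v"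
  using bounded_linear.pos_bounded[OF matrix_vector_mul_bounded_linear[of M]] by (metis mult.commute)

theorem theorem5:
  fixes A :: "real^'n^'n" and B :: "real^'m^'n" and C :: "real^'n^'p"
    and own :: "'p \<Rightarrow> 'v::finite" and E :: "('v \<times> 'v) set"
    and \<zeta> :: "real^'v" and T \<Delta> :: "real^'v^'v" and o1 :: 'v
    and G0 :: "real^'n^'n" and Y0 L0 :: "real^'p^'n"
    and \<rho> :: real and Pa :: "real^'n^'n" and Y H :: "real^'p^'n"
  assumes obs: "observable A C"
    and no_loops: "irrefl E"
    and conn: "strongly_connected E"
    and zeta: "\<zeta> v* laplacian E = 0" "(\<Sum>i\<in>UNIV. \<zeta> $ i) = 1"
    and T: "invertible T" "column o1 T = (\<chi> i. 1)" "row o1 (matrix_inv T) = \<zeta>"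
    and Delta: "matrix_inv T ** laplacian E ** T
                  = (\<chi> i j. if i = o1 \<or> j = o1 then 0 else \<Delta> $ i $ j)"
    and G0: "G0 ** A - A ** G0 + Y0 ** C = - A" "C ** G0 = 0" "invertible (mat 1 + G0)"
    and L0_def: "L0 = matrix_inv (mat 1 + G0) ** Y0"
    and nil: "nilpotent_mat (A + L0 ** C)"
    and L0: "L0 = 0"
    and rho: "\<rho> > 0"
    and H_def: "H = (\<chi> k r. (matrix_inv Pa ** Y) $ k $ r / \<zeta> $ own r)"
  shows "\<exists>\<nu>0>0. \<forall>\<nu>\<ge>\<nu>0. \<exists>\<mu>0>0. \<forall>\<mu> \<gamma> \<tau>.
     \<bar>\<mu>\<bar> < \<mu>0 \<and> \<mu> > - 1 / real (obs_index A C) \<and>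
     pos_def Pa \<and>
     pos_def_on {a. fst a \<noteq> o1} (kron (transpose \<Delta> + \<Delta>) Pa) \<and>
     pos_def (Pa ** dil_gen \<mu> G0 + transpose (dil_gen \<mu> G0) ** Pa) \<and>
     neg_def (Pa ** A + transpose A ** Pa + Y ** C + transpose C ** transpose Y
        + \<rho> *\<^sub>R (Pa ** dil_gen \<mu> G0 + transpose (dil_gen \<mu> G0) ** Pa)) \<and>
     continuous_on UNIV (\<lambda>(t, x). \<gamma> t x) \<and>
     0 < \<tau> \<and> \<tau> < \<rho> / 3 \<and>
     (\<forall>t>0. \<forall>(xh :: real^('v \<times> 'n)) x. xh \<noteq> stack (\<lambda>_. x) \<longrightarrow>
        weighted_norm (weight_net Pa)
          (dil_net \<mu> G0 (- ln (net_norm \<mu> G0 Pa (xh - stack (\<lambda>_. x)))) *v mismatch \<gamma> t xh x)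
        \<le> \<tau> * net_norm \<mu> G0 Pa (xh - stack (\<lambda>_. x)) powr \<mu>)
     \<longrightarrow>
     (\<mu> < 0 \<longrightarrow>
        (\<exists>Ts. finite_time_stable (error_system A B C own E G0 Pa H \<nu> \<mu> \<gamma>) Ts \<and>
           (\<forall>e0. Ts e0 \<le> 3 / (\<mu> * (3 * \<tau> - \<rho>)) * net_norm \<mu> G0 Pa e0 powr (- \<mu>)))) \<and>
     (\<mu> > 0 \<longrightarrow>
        nearly_fixed_time_stable (error_system A B C own E G0 Pa H \<nu> \<mu> \<gamma>))"
proof -
  let ?M = "Pa ** A + transpose A ** Pa + Y ** C + transpose C ** transpose Y"
  show ?thesis
  \<comment> \<open>\<open>\<nu>\<close> has to be found before \<open>\<mu>\<close>, so the
    distinction is made on the non-strict inequality at \<open>\<mu> = 0\<close>; where it fails,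
    small \<open>\<mu>\<close> contradict the hypotheses and any \<open>\<nu>\<close> will
    do.\<close>
  proof (cases "pos_def Pa \<and> (\<forall>x. x \<bullet> (?M *v x) \<le> - 2 * \<rho> * wip Pa x x)")
    case False
    have "\<exists>\<mu>0>0. \<forall>\<mu>. \<bar>\<mu>\<bar> < \<mu>0 \<longrightarrow> \<not> (pos_def Pa \<and>
        neg_def (?M + \<rho> *\<^sub>R (Pa ** dil_gen \<mu> G0 + transpose (dil_gen \<mu> G0) ** Pa)))"
    proof (cases "pos_def Pa")
      case True
      with False obtain x where "x \<bullet> (?M *v x) > - 2 * \<rho> * wip Pa x x" by (auto simp: not_le)
      from lmi_limit[OF True rho this] show ?thesis by blast
    qed (auto intro: exI[of _ 1])
    then obtain \<mu>0 where "\<mu>0 > 0" "\<And>\<mu>. \<bar>\<mu>\<bar> < \<mu>0 \<Longrightarrow> \<not> (pos_def Pa \<and>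
        neg_def (?M + \<rho> *\<^sub>R (Pa ** dil_gen \<mu> G0 + transpose (dil_gen \<mu> G0) ** Pa)))"
      by blast
    then show ?thesis by (intro exI[of _ 1]) (auto intro!: exI[of _ \<mu>0])
  next
    case True
    then have P: "pos_def Pa" and lmi: "\<And>x. x \<bullet> (?M *v x) \<le> - 2 * \<rho> * wip Pa x x" by auto
    have zeta_pos: "\<zeta> $ i > 0" for i by (rule left_null_vector_pos[OF no_loops conn zeta])
    \<comment> \<open>\<open>L0 = 0\<close> forces \<open>Y0 = 0\<close>, which reduces the equation
      for \<open>G0\<close> to the commutation rule with \<open>A\<close>.\<close>
    have "Y0 = (mat 1 + G0) ** L0"
      unfolding L0_def matrix_mul_assoc matrix_inv_cancel[OF G0(3)] by simp
    then have "Y0 = 0" by (simp add: L0)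
    then have AG: "A ** G0 = G0 ** A + A"
      using G0(1) by (simp add: algebra_simps)
    obtain \<nu>0 where \<nu>0: "\<nu>0 > 0" and nominal: "\<And>\<nu> y. \<nu> \<ge> \<nu>0 \<Longrightarrow>
        (\<Sum>i\<in>UNIV. \<zeta> $ i * wip Pa (y i) (y i)) = 1 \<Longrightarrow>
        (\<Sum>i\<in>UNIV. \<zeta> $ i * wip Pa (y i) (linear_error_field A C own E H \<nu> y i)) < - (5 / 6 * \<rho>)"
      using nominal_decay[OF P no_loops conn zeta H_def lmi, of "5 / 6 * \<rho>"] rho by auto
    obtain \<kappa> where \<kappa>: "\<kappa> > 0" "\<And>v. \<bar>wip Pa v (G0 *v v)\<bar> \<le> \<kappa> * wip Pa v v"
      by (rule wip_matrix_bound[OF P]) blast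
    obtain K where K: "K > 0" "\<And>v. norm ((G0 + mat 1) *v v) \<le> K * norm v"
      by (rule matrix_norm_bound) blast
    obtain h where h: "h > 0" "\<And>w. norm (H *v w) \<le> h * norm w" by (rule matrix_norm_bound) blast
    obtain kC where kC: "kC > 0" "\<And>v. norm (C *v v) \<le> kC * norm v" by (rule matrix_norm_bound) blast
    obtain cN where cN: "cN > 0" "\<And>v. weighted_norm Pa v \<le> cN * norm v"
      by (rule weighted_norm_le_norm[OF P]) blast
    obtain a where a: "a > 0" "\<And>v. norm v \<le> a * weighted_norm Pa v"
      by (rule norm_le_weighted_norm[OF P]) blast
    obtain m where m: "m > 0" "\<And>y i. (\<Sum>i\<in>UNIV. \<zeta> $ i * wip Pa (y i) (y i)) \<le> 1 \<Longrightarrow> weighted_norm Pa (y i) \<le> m"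
      using weighted_energy_sphere[OF P zeta_pos] by metis
    \<comment> \<open>Logarithmic bounds for the outputs and the coupling terms on the unit sphere
      of the energy, where every node has weighted norm at most \<open>m\<close>.\<close>
    define S1 where "S1 = ln (kC * (a * m))"
    define S2 where "S2 = ln (real CARD('v) * (2 * m))"
    have S1: "norm (local_out own i (C *v v)) \<le> exp S1" if "weighted_norm Pa v \<le> m" for i v
    proof -
      have "norm (local_out own i (C *v v)) \<le> kC * norm v"
        using norm_local_out_le kC(2) by (rule order_trans)
      also have "norm v \<le> a * m"
        using a(2)[of v] mult_left_mono[OF that, of a] a(1) by linarith
      finally show ?thesis using kC(1) a(1) m(1) by (simp add: S1_def)
    qed
    show ?thesis
    proof (rule exI[of _ \<nu>0], intro conjI \<nu>0 allI impI)
      fix \<nu> assume "\<nu> \<ge> \<nu>0"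
      \<comment> \<open>The coefficient of \<open>\<bar>\<mu>\<bar>\<close> in the budget, with
        \<open>c\<close> and \<open>\<tau>\<close> replaced by their bound \<open>\<rho>\<close> so
        that it depends on neither \<open>\<mu>\<close> nor \<open>\<tau>\<close>.\<close>
      define C0 where "C0 = \<rho> * \<kappa> + \<rho> * (2 * (1 + 2 * \<kappa>) * log_bound (ln m) * m)
        + m * (cN * K * h * log_bound S1 + 2 * \<nu> * log_bound S2)"
      have "C0 \<ge> 0"
        unfolding C0_def using rho \<kappa> K h cN m \<nu>0 \<open>\<nu> \<ge> \<nu>0\<close> log_bound_pos
        by (intro add_nonneg_nonneg mult_nonneg_nonneg) (auto simp: less_imp_le)
      \<comment> \<open>The sum of all quantities whose product with
        \<open>\<bar>\<mu>\<bar>\<close> must stay below 1, so that \<open>1 / W\<close> is a common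
        threshold.\<close>
      define W where "W = 4 + 2 * \<kappa> + 2 * K + 4 * (1 + 2 * \<kappa>) + 6 * C0 / \<rho>"
      have C0': "6 * C0 / \<rho> \<ge> 0" using \<open>C0 \<ge> 0\<close> rho by simp
      then have "W > 0" using \<kappa> K by (simp add: W_def)
      have main: "(\<mu> < 0 \<longrightarrow>
          (\<exists>Ts. finite_time_stable (error_system A B C own E G0 Pa H \<nu> \<mu> \<gamma>) Ts \<and>
             (\<forall>e0. Ts e0 \<le> 3 / (\<mu> * (3 * \<tau> - \<rho>)) * net_norm \<mu> G0 Pa e0 powr (- \<mu>)))) \<and>
         (\<mu> > 0 \<longrightarrow> nearly_fixed_time_stable (error_system A B C own E G0 Pa H \<nu> \<mu> \<gamma>))"
        if mu: "\<bar>\<mu>\<bar> < 1 / W" and cont: "continuous_on UNIV (\<lambda>(t, x). \<gamma> t x)"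
          and tau_bounds: "0 < \<tau>" "\<tau> < \<rho> / 3"
          and hyp: "\<forall>t>0. \<forall>(xh :: real^('v \<times> 'n)) x. xh \<noteq> stack (\<lambda>_. x) \<longrightarrow>
            weighted_norm (weight_net Pa)
              (dil_net \<mu> G0 (- ln (net_norm \<mu> G0 Pa (xh - stack (\<lambda>_. x)))) *v mismatch \<gamma> t xh x)
            \<le> \<tau> * net_norm \<mu> G0 Pa (xh - stack (\<lambda>_. x)) powr \<mu>" for \<mu> \<gamma> \<tau>
      proof (cases "\<mu> = 0")
        case False
        have part: "\<bar>\<mu>\<bar> * w \<le> 1" if "0 \<le> w" "w \<le> W" for w
        proof -
          have "\<bar>\<mu>\<bar> * w \<le> \<bar>\<mu>\<bar> * W" using that by (intro mult_left_mono) auto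
          also have "\<dots> \<le> 1" using mu \<open>W > 0\<close> by (simp add: field_simps)
          finally show ?thesis .
        qed
        have mu4: "\<bar>\<mu>\<bar> * 4 \<le> 1" and mu_kappa: "\<bar>\<mu>\<bar> * (2 * \<kappa>) \<le> 1"
          and mu_K: "\<bar>\<mu>\<bar> * (2 * K) \<le> 1" and mu_p: "\<bar>\<mu>\<bar> * (4 * (1 + 2 * \<kappa>)) \<le> 1"
          and mu_C0: "\<bar>\<mu>\<bar> * (6 * C0 / \<rho>) \<le> 1"
          using \<kappa>(1) K(1) C0' by (intro part; simp add: W_def)+
        \<comment> \<open>What the linear decay \<open>5 / 6 * \<rho>\<close> leaves after
          \<open>\<rho> / 6\<close> for the terms of order \<open>\<mu>\<close> and
          \<open>\<tau>\<close> for the perturbation.\<close>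
        define c where "c = 2 / 3 * \<rho> - \<tau>"
        have c_bounds: "c > 0" "c \<le> \<rho>" "\<rho> / 3 - \<tau> < c" using tau_bounds rho by (simp_all add: c_def)
        interpret homogeneous_observer Pa G0 \<mu> \<kappa> A C own E H \<nu> K h cN
        proof
          show "pos_def Pa" by (rule P)
          show "A ** G0 = G0 ** A + A" by (rule AG)
          show "C ** G0 = 0" by (rule G0(2))
          show "\<nu> \<ge> 0" using \<nu>0 \<open>\<nu> \<ge> \<nu>0\<close> by simp
        qed (use \<kappa> K h cN mu4 mu_kappa mu_K in \<open>auto simp: less_imp_le\<close>)
        have S2: "weighted_norm Pa (consensus E y i) \<le> exp S2"
          if y: "\<And>i. weighted_norm Pa (y i) \<le> m" for y i
        proof -
          have "weighted_norm Pa (adj E i j *\<^sub>R (y j - y i)) \<le> 2 * m" for j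
          proof -
            have "weighted_norm Pa (y j - y i) \<le> weighted_norm Pa (y j) + weighted_norm Pa (y i)"
              using weighted_norm_triangle[of "y j" "- y i"] weighted_norm_scaleR[OF P, of "-1" "y i"] by simp
            also have "\<dots> \<le> 2 * m" using y[of i] y[of j] by simp
            finally show ?thesis using m(1) by (simp add: weighted_norm_scaleR[OF P] adj_def)
          qed
          then have "weighted_norm Pa (consensus E y i) \<le> (\<Sum>j\<in>(UNIV :: 'v set). 2 * m)"
            unfolding consensus_def by (intro order_trans[OF weighted_norm_sum] sum_mono)
          then show ?thesis using m(1) by (simp add: S2_def)
        qed
        have budget: "c * (1 + \<bar>\<mu>\<bar> * \<kappa>) + \<tau> * (1 + (2 * (\<bar>\<mu>\<bar> + 2 * (\<bar>\<mu>\<bar> * \<kappa>)) * log_bound (ln m)) * m)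
          + m * (\<bar>\<mu>\<bar> * (cN * K * h * log_bound S1 + 2 * \<nu> * log_bound S2)) \<le> 5 / 6 * \<rho>"
        proof -
          let ?L = "2 * (1 + 2 * \<kappa>) * log_bound (ln m) * m"
          have "c * \<kappa> \<le> \<rho> * \<kappa>" using c_bounds \<kappa>(1) by simp
          moreover have "\<tau> * ?L \<le> \<rho> * ?L"
            using tau_bounds rho \<kappa>(1) m(1) log_bound_pos[of "ln m"] by (intro mult_right_mono) (auto simp: less_imp_le)
          ultimately have "\<bar>\<mu>\<bar> * (c * \<kappa> + \<tau> * ?L + m * (cN * K * h * log_bound S1 + 2 * \<nu> * log_bound S2)) \<le> \<bar>\<mu>\<bar> * C0"
            unfolding C0_def by (intro mult_left_mono[of _ _ "\<bar>\<mu>\<bar>"] add_mono order_refl) auto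
          moreover have "\<bar>\<mu>\<bar> * C0 \<le> \<rho> / 6"
            using mu_C0 rho by (simp add: field_simps)
          moreover have "c * (1 + \<bar>\<mu>\<bar> * \<kappa>) + \<tau> * (1 + (2 * (\<bar>\<mu>\<bar> + 2 * (\<bar>\<mu>\<bar> * \<kappa>)) * log_bound (ln m)) * m)
              + m * (\<bar>\<mu>\<bar> * (cN * K * h * log_bound S1 + 2 * \<nu> * log_bound S2))
            = c + \<tau> + \<bar>\<mu>\<bar> * (c * \<kappa> + \<tau> * ?L + m * (cN * K * h * log_bound S1 + 2 * \<nu> * log_bound S2))"
            by (simp add: algebra_simps)
          ultimately show ?thesis by (simp add: c_def)
        qed
        interpret contracting_observer Pa G0 \<mu> \<kappa> A C own E H \<nu> K h cN B \<zeta> \<gamma> c \<tau> m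
        proof
          show "2 * (\<bar>\<mu>\<bar> + 2 * (\<bar>\<mu>\<bar> * \<kappa>)) \<le> 1 / 2" using mu_p by (simp add: algebra_simps)
          fix y p
          assume q: "(\<Sum>i\<in>UNIV. \<zeta> $ i * wip Pa (y i) (y i)) = 1"
            and p: "\<And>i. weighted_norm Pa (p i) \<le> \<tau> * (weighted_norm Pa (y i)
              + 2 * (\<bar>\<mu>\<bar> + 2 * (\<bar>\<mu>\<bar> * \<kappa>)) * log_bound (ln m))"
          have y: "weighted_norm Pa (y i) \<le> m" for i using q by (intro m) simp
          show "(\<Sum>i\<in>UNIV. \<zeta> $ i * wip Pa (y i) (c *\<^sub>R (dil_gen \<mu> G0 *v y i)
              + error_field A C own E G0 Pa H \<nu> \<mu> y i + p i)) < 0"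
            by (rule energy_decreases[OF _ zeta(2) y q S1[OF y] S2[OF y] nominal[OF \<open>\<nu> \<ge> \<nu>0\<close> q] p _ _ _ budget])
              (use zeta_pos tau_bounds c_bounds \<kappa>(1) log_bound_pos in \<open>auto simp: less_imp_le\<close>)
        qed (use no_loops zeta_pos zeta(2) m c_bounds tau_bounds False cont hyp in auto)
        \<comment> \<open>The rate \<open>\<rho> / 3 - \<tau>\<close>, strictly below
          \<open>c\<close>, is the one that gives the settling time its claimed form.\<close>
        have "finite_time_stable sys (\<lambda>e. nn e powr (- \<mu>) / ((\<rho> / 3 - \<tau>) * - \<mu>))" if "\<mu> < 0"
          using that tau_bounds c_bounds by (intro error_system_finite_time_stable) auto
        moreover have "x / ((\<rho> / 3 - \<tau>) * - \<mu>) = 3 / (\<mu> * (3 * \<tau> - \<rho>)) * x" for x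
          using False tau_bounds by (simp add: field_simps)
        ultimately show ?thesis
          using error_system_nearly_fixed_time_stable
          by (intro conjI impI exI[of _ "\<lambda>e. nn e powr (- \<mu>) / ((\<rho> / 3 - \<tau>) * - \<mu>)"]) auto
      qed simp
      have "1 / W > 0" using \<open>W > 0\<close> by simp
      show "\<exists>\<mu>0>0. \<forall>\<mu> \<gamma> \<tau>.
     \<bar>\<mu>\<bar> < \<mu>0 \<and> \<mu> > - 1 / real (obs_index A C) \<and>
     pos_def Pa \<and>
     pos_def_on {a. fst a \<noteq> o1} (kron (transpose \<Delta> + \<Delta>) Pa) \<and>
     pos_def (Pa ** dil_gen \<mu> G0 + transpose (dil_gen \<mu> G0) ** Pa) \<and>
     neg_def (Pa ** A + transpose A ** Pa + Y ** C + transpose C ** transpose Y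
        + \<rho> *\<^sub>R (Pa ** dil_gen \<mu> G0 + transpose (dil_gen \<mu> G0) ** Pa)) \<and>
     continuous_on UNIV (\<lambda>(t, x). \<gamma> t x) \<and>
     0 < \<tau> \<and> \<tau> < \<rho> / 3 \<and>
     (\<forall>t>0. \<forall>(xh :: real^('v \<times> 'n)) x. xh \<noteq> stack (\<lambda>_. x) \<longrightarrow>
        weighted_norm (weight_net Pa)
          (dil_net \<mu> G0 (- ln (net_norm \<mu> G0 Pa (xh - stack (\<lambda>_. x)))) *v mismatch \<gamma> t xh x)
        \<le> \<tau> * net_norm \<mu> G0 Pa (xh - stack (\<lambda>_. x)) powr \<mu>)
     \<longrightarrow>
     (\<mu> < 0 \<longrightarrow>
        (\<exists>Ts. finite_time_stable (error_system A B C own E G0 Pa H \<nu> \<mu> \<gamma>) Ts \<and>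
           (\<forall>e0. Ts e0 \<le> 3 / (\<mu> * (3 * \<tau> - \<rho>)) * net_norm \<mu> G0 Pa e0 powr (- \<mu>)))) \<and>
     (\<mu> > 0 \<longrightarrow>
        nearly_fixed_time_stable (error_system A B C own E G0 Pa H \<nu> \<mu> \<gamma>))"
        using main \<open>1 / W > 0\<close> by blast
    qed
  qed
qed

end
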